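(* Let $A$ be a commutative $\Bbbk$-algebra and $R$ an $A$-ring. Then: (1) If $\zeta:R^\circ\to R^*$ is injective, then $R^\circ$ is the largest Galois $A$-coring inside $R^*$ with respect to the property $( * )$. That is, $R^\circ$ is a Galois $A$-coring (embedded in $R^*$ by $\zeta$, which satisfies $( * )$), and for every Galois $A$-coring $C$ endowed with an injective $A$-bimodule map $f:C\to R^*$ satisfying $( * )$ there is an injective $A$-coring map $f':C\to R^\circ$ with $\zeta\circ f'=f$. (2) $R^\bullet$ is a Galois $A$-coring if and only if the map $\hat\zeta:R^\circ\to R^\bullet$ is an isomorphism of $A$-corings.
   Context: $\Bbbk$ is a field. An $A$-ring is a $\Bbbk$-algebra $R$ with an algebra map $A\to R$ (image not necessarily central). $R^*=\mathrm{Hom}_{-A}(R,A)$ (right $A$-linear maps) with $(afb)(r)=af(br)$. An $A$-coring is an $A$-bimodule $C$ with $A$-bilinear coassociative $\Delta:C\to C\otimes_AC$, $c\mapsto c_1\otimes_Ac_2$, and $A$-bilinear counit $\varepsilon:C\to A$. $\mathcal A^C$ is the category of right $C$-comodules $(M,\varrho_M)$, $\varrho_M(m)=m_{(0)}\otimes_Am_{(1)}$, with $M_A$ finitely generated projective. For an $A$-bimodule map $f:C\to R^*$ from an $A$-coring, property $( * )$ is: $f(z)(xy)=f(z_1)(f(z_2)(x)y)$, $f(z)(1_R)=\varepsilon(z)$, $f(azb)(x)=af(z)(bx)$. For an essentially small $\Bbbk$-linear category $\mathcal A$ with a faithful $\Bbbk$-linear functor to finitely generated projective right $A$-modules, put $P^*=\mathrm{Hom}_{-A}(P,A)$,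 $T_P=\mathrm{End}_{\mathcal A}(P)$ and $\mathscr R(\mathcal A)=\big(\bigoplus_PP^*\otimes_{T_P}P\big)/\mathfrak J$, where $\mathfrak J$ is the $A$-subbimodule generated by all $q^*\otimes tp-q^*t\otimes p$ with $t\in\mathrm{Hom}_{\mathcal A}(P,Q)$, $p\in P$, $q^*\in Q^*$; it is an $A$-coring with $\Delta(\overline{p^*\otimes p})=\sum_i\overline{p^*\otimes e_i}\otimes_A\overline{e_i^*\otimes p}$ ($\{e_i,e_i^*\}$ a dual basis of $P$) and $\varepsilon(\overline{p^*\otimes p})=p^*(p)$. An $A$-coring $C$ is Galois if $\mathsf{can}_C:\mathscr R(\mathcal A^C)\to C$, $\overline{p^*\otimes p}\mapsto p^*(p_{(0)})p_{(1)}$ (with respect to the forgetful functor), is an isomorphism of $A$-corings. $R^\circ:=\mathscr R(\mathcal A_R)$, where $\mathcal A_R$ is the category of right $R$-modules finitely generated projective as right $A$-modules with the forgetful functor; $\zeta:R^\circ\to R^*$, $\zeta(\overline{p^*\otimes p})(r)=p^*(pr)$, satisfies $( * )$. $R^\bullet$ is the $A$-coring with an $A$-bimodule map $\xi:R^\bullet\to R^*$ satisfying $( * )$ and universal: each $f:C\to R^*$ satisfying $( * )$ equals $\xi\circ\hat f$ for a unique $A$-coring map $\hat f:C\to R^\bullet$. $\hat\zeta:R^\circ\to R^\bullet$ is the unique coring map with $\xi\circ\hat\zeta=\zeta$. *)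

theory Defs
  imports "HOL-Algebra.Free_Abelian_Groups" "HOL-Algebra.Product_Groups" "HOL-Algebra.AbelCoset"
begin

text \<open>
  The fixed rings \<open>\<bbbk>\<close>, \<open>A\<close>, \<open>R\<close> are types \<open>'k\<close>, \<open>'a\<close>, \<open>'r\<close>; modules, bimodules, corings and
  comodules, which vary, have explicit carriers. The sorts \<open>{comm_ring, monoid_mult}\<close> and
  \<open>{ring, monoid_mult}\<close> are the unital (commutative) rings without the axiom \<open>0 \<noteq> 1\<close>, so that zero
  rings are included. As for the library's \<open>module\<close> record, the fields \<open>mult\<close> and \<open>one\<close> that the
  module records inherit from \<open>ring\<close> carry no meaning.
\<close>

subsection \<open>Algebras\<close>

definition unital_ring_hom :: "('x::{ring,monoid_mult} \<Rightarrow> 'y::{ring,monoid_mult}) \<Rightarrow> bool" where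
  "unital_ring_hom h \<longleftrightarrow>
     h 1 = 1 \<and> (\<forall>x y. h (x + y) = h x + h y) \<and> (\<forall>x y. h (x * y) = h x * h y)"

text \<open>A \<open>\<bbbk>\<close>-algebra is given by its unit map \<open>\<eta>\<close>; the scalar multiplication is \<open>c \<cdot> x = \<eta> c * x\<close>.\<close>

definition k_algebra :: "('k::field \<Rightarrow> 'x::{ring,monoid_mult}) \<Rightarrow> bool" where
  "k_algebra \<eta> \<longleftrightarrow> unital_ring_hom \<eta> \<and> (\<forall>c x. \<eta> c * x = x * \<eta> c)"

definition A_ring ::
  "('k::field \<Rightarrow> 'a::{comm_ring,monoid_mult}) \<Rightarrow> ('k \<Rightarrow> 'r::{ring,monoid_mult}) \<Rightarrow> ('a \<Rightarrow> 'r) \<Rightarrow> bool"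
where
  "A_ring \<eta>A \<eta>R \<iota> \<longleftrightarrow>
     k_algebra \<eta>A \<and> k_algebra \<eta>R \<and> unital_ring_hom \<iota> \<and> (\<forall>c. \<iota> (\<eta>A c) = \<eta>R c)"


subsection \<open>Modules and bimodules\<close>

record ('s,'m) rmod = "'m ring" +
  ract :: "'m \<Rightarrow> 's \<Rightarrow> 'm"

record ('s,'t,'m) bimod = "('t,'m) rmod" +
  lact :: "'s \<Rightarrow> 'm \<Rightarrow> 'm"

definition right_module :: "('s::{ring,monoid_mult},'m,'z) rmod_scheme \<Rightarrow> bool" where
  "right_module M \<longleftrightarrow> abelian_group M \<and>
     (\<forall>m\<in>carrier M. \<forall>a. ract M m a \<in> carrier M) \<and>
     (\<forall>m\<in>carrier M. \<forall>n\<in>carrier M. \<forall>a. ract M (m \<oplus>\<^bsub>M\<^esub> n) a = ract M m a \<oplus>\<^bsub>M\<^esub> ract M n a) \<and>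
     (\<forall>m\<in>carrier M. \<forall>a b. ract M m (a + b) = ract M m a \<oplus>\<^bsub>M\<^esub> ract M m b) \<and>
     (\<forall>m\<in>carrier M. \<forall>a b. ract M m (a * b) = ract M (ract M m a) b) \<and>
     (\<forall>m\<in>carrier M. ract M m 1 = m)"

text \<open>Bimodules over the \<open>\<bbbk>\<close>-algebra \<open>A\<close>; the last clause says that both actions restrict to the
  same \<open>\<bbbk>\<close>-vector space structure.\<close>

definition bimodule ::
  "('k::field \<Rightarrow> 'a::{comm_ring,monoid_mult}) \<Rightarrow> ('a,'a,'m,'z) bimod_scheme \<Rightarrow> bool" where
  "bimodule \<eta>A M \<longleftrightarrow> right_module M \<and>
     (\<forall>m\<in>carrier M. \<forall>a. lact M a m \<in> carrier M) \<and>
     (\<forall>m\<in>carrier M. \<forall>n\<in>carrier M. \<forall>a. lact M a (m \<oplus>\<^bsub>M\<^esub> n) = lact M a m \<oplus>\<^bsub>M\<^esub> lact M a n) \<and>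
     (\<forall>m\<in>carrier M. \<forall>a b. lact M (a + b) m = lact M a m \<oplus>\<^bsub>M\<^esub> lact M b m) \<and>
     (\<forall>m\<in>carrier M. \<forall>a b. lact M (a * b) m = lact M a (lact M b m)) \<and>
     (\<forall>m\<in>carrier M. lact M 1 m = m) \<and>
     (\<forall>m\<in>carrier M. \<forall>a b. ract M (lact M a m) b = lact M a (ract M m b)) \<and>
     (\<forall>m\<in>carrier M. \<forall>c. lact M (\<eta>A c) m = ract M m (\<eta>A c))"

definition additive_map :: "('m,'y) ring_scheme \<Rightarrow> ('n,'z) ring_scheme \<Rightarrow> ('m \<Rightarrow> 'n) \<Rightarrow> bool" where
  "additive_map M N f \<longleftrightarrow> f \<in> hom (add_monoid M) (add_monoid N)"

definition rmod_hom :: "('s,'m,'y) rmod_scheme \<Rightarrow> ('s,'n,'z) rmod_scheme \<Rightarrow> ('m \<Rightarrow> 'n) \<Rightarrow> bool" where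
  "rmod_hom M N f \<longleftrightarrow> additive_map M N f \<and> (\<forall>m\<in>carrier M. \<forall>a. f (ract M m a) = ract N (f m) a)"

definition bimod_hom ::
  "('s,'t,'m,'y) bimod_scheme \<Rightarrow> ('s,'t,'n,'z) bimod_scheme \<Rightarrow> ('m \<Rightarrow> 'n) \<Rightarrow> bool" where
  "bimod_hom M N f \<longleftrightarrow> rmod_hom M N f \<and> (\<forall>m\<in>carrier M. \<forall>a. f (lact M a m) = lact N a (f m))"

definition regular_bimod :: "('a::{comm_ring,monoid_mult},'a,'a) bimod" where
  "regular_bimod = \<lparr>carrier = UNIV, mult = (*), one = 1, zero = 0, add = (+),
     ract = (*), lact = (*)\<rparr>"

definition restrict_scalars :: "('a \<Rightarrow> 'r) \<Rightarrow> ('r,'m,'z) rmod_scheme \<Rightarrow> ('a,'m) rmod" where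
  "restrict_scalars \<iota> M = \<lparr>carrier = carrier M, mult = mult M, one = one M, zero = zero M,
     add = add M, ract = (\<lambda>m a. ract M m (\<iota> a))\<rparr>"

text \<open>\<open>A\<^sup>n\<close>, realised as the sequences that vanish from index \<open>n\<close> on.\<close>

definition free_rmod :: "nat \<Rightarrow> ('a::{comm_ring,monoid_mult}, nat \<Rightarrow> 'a) rmod" where
  "free_rmod n = \<lparr>carrier = {v. \<forall>i\<ge>n. v i = 0}, mult = undefined, one = undefined,
     zero = (\<lambda>i. 0), add = (\<lambda>v w i. v i + w i), ract = (\<lambda>v a i. v i * a)\<rparr>"

text \<open>Finitely generated projective: isomorphic to a direct summand of some \<open>A\<^sup>n\<close>.\<close>

definition fg_projective :: "('a::{comm_ring,monoid_mult},'m,'z) rmod_scheme \<Rightarrow> bool" where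
  "fg_projective M \<longleftrightarrow> right_module M \<and>
     (\<exists>n i p. rmod_hom M (free_rmod n) i \<and> rmod_hom (free_rmod n) M p \<and>
        (\<forall>m\<in>carrier M. p (i m) = m))"


subsection \<open>Tensor products\<close>

text \<open>
  \<open>M \<otimes>\<^sub>S N\<close> for a right module \<open>M\<close> and a left module \<open>N\<close> over a ring with underlying set \<open>S\<close>: the free
  abelian group on \<open>M \<times> N\<close> modulo the usual relations. (The ring structure of \<open>S\<close> does not enter.
  For \<open>S = A\<close> we have \<open>S = UNIV\<close>; the other case needed is \<open>S = T\<^sub>P\<close>.)
\<close>

definition tensor_rels ::
  "'s set \<Rightarrow> ('s,'m,'y) rmod_scheme \<Rightarrow> ('s,'t,'n,'z) bimod_scheme \<Rightarrow> (('m \<times> 'n) \<Rightarrow>\<^sub>0 int) set" where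
  "tensor_rels S M N = generate (free_Abelian_group (carrier M \<times> carrier N))
     ({frag_of (m \<oplus>\<^bsub>M\<^esub> m', n) - frag_of (m, n) - frag_of (m', n) | m m' n.
          m \<in> carrier M \<and> m' \<in> carrier M \<and> n \<in> carrier N} \<union>
      {frag_of (m, n \<oplus>\<^bsub>N\<^esub> n') - frag_of (m, n) - frag_of (m, n') | m n n'.
          m \<in> carrier M \<and> n \<in> carrier N \<and> n' \<in> carrier N} \<union>
      {frag_of (ract M m s, n) - frag_of (m, lact N s n) | m s n.
          m \<in> carrier M \<and> s \<in> S \<and> n \<in> carrier N})"

definition tensor_ab ::
  "'s set \<Rightarrow> ('s,'m,'y) rmod_scheme \<Rightarrow> ('s,'t,'n,'z) bimod_scheme \<Rightarrow> (('m \<times> 'n) \<Rightarrow>\<^sub>0 int) set ring"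
where
  "tensor_ab S M N =
     (let Q = free_Abelian_group (carrier M \<times> carrier N) Mod tensor_rels S M N in
      \<lparr>carrier = carrier Q, mult = undefined, one = undefined, zero = one Q, add = mult Q\<rparr>)"

definition pure_tensor ::
  "'s set \<Rightarrow> ('s,'m,'y) rmod_scheme \<Rightarrow> ('s,'t,'n,'z) bimod_scheme \<Rightarrow>
     'm \<Rightarrow> 'n \<Rightarrow> (('m \<times> 'n) \<Rightarrow>\<^sub>0 int) set" where
  "pure_tensor S M N m n =
     tensor_rels S M N #>\<^bsub>free_Abelian_group (carrier M \<times> carrier N)\<^esub> frag_of (m, n)"

text \<open>The additive map on \<open>M \<otimes>\<^sub>S N\<close> with \<open>m \<otimes> n \<mapsto> \<beta> m n\<close>; it exists when \<open>\<beta>\<close> is biadditive and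
  balanced, and it is unique on the carrier because pure tensors generate.\<close>

definition tensor_lift ::
  "'s set \<Rightarrow> ('s,'m,'y) rmod_scheme \<Rightarrow> ('s,'t,'n,'z) bimod_scheme \<Rightarrow> ('g,'x) ring_scheme \<Rightarrow>
     ('m \<Rightarrow> 'n \<Rightarrow> 'g) \<Rightarrow> (('m \<times> 'n) \<Rightarrow>\<^sub>0 int) set \<Rightarrow> 'g" where
  "tensor_lift S M N G \<beta> =
     (SOME h. additive_map (tensor_ab S M N) G h \<and>
        (\<forall>m\<in>carrier M. \<forall>n\<in>carrier N. h (pure_tensor S M N m n) = \<beta> m n))"

definition tensor_r ::
  "'s set \<Rightarrow> ('s,'m,'y) rmod_scheme \<Rightarrow> ('s,'t,'n,'z) bimod_scheme \<Rightarrow>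
     ('t, (('m \<times> 'n) \<Rightarrow>\<^sub>0 int) set) rmod" where
  "tensor_r S M N = ring.extend (tensor_ab S M N) (rmod.fields
     (\<lambda>X b. tensor_lift S M N (tensor_ab S M N) (\<lambda>m n. pure_tensor S M N m (ract N n b)) X))"

definition tensor ::
  "'s set \<Rightarrow> ('q,'s,'m,'y) bimod_scheme \<Rightarrow> ('s,'t,'n,'z) bimod_scheme \<Rightarrow>
     ('q, 't, (('m \<times> 'n) \<Rightarrow>\<^sub>0 int) set) bimod" where
  "tensor S M N = rmod.extend (tensor_r S M N) (bimod.fields
     (\<lambda>a X. tensor_lift S M N (tensor_ab S M N) (\<lambda>m n. pure_tensor S M N (lact M a m) n) X))"

text \<open>\<open>f \<otimes>\<^sub>A g : M \<otimes>\<^sub>A N \<rightarrow> M' \<otimes>\<^sub>A N'\<close>\<close>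

definition tensor_map ::
  "('a,'m,'x1) rmod_scheme \<Rightarrow> ('a,'t,'n,'x2) bimod_scheme \<Rightarrow>
   ('a,'m','x3) rmod_scheme \<Rightarrow> ('a,'t','n','x4) bimod_scheme \<Rightarrow>
   ('m \<Rightarrow> 'm') \<Rightarrow> ('n \<Rightarrow> 'n') \<Rightarrow> (('m \<times> 'n) \<Rightarrow>\<^sub>0 int) set \<Rightarrow> (('m' \<times> 'n') \<Rightarrow>\<^sub>0 int) set" where
  "tensor_map M N M' N' f g =
     tensor_lift UNIV M N (tensor_ab UNIV M' N') (\<lambda>m n. pure_tensor UNIV M' N' (f m) (g n))"

text \<open>\<open>(M \<otimes>\<^sub>A N) \<otimes>\<^sub>A P \<rightarrow> M \<otimes>\<^sub>A (N \<otimes>\<^sub>A P)\<close>\<close>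

definition tensor_assoc ::
  "('a,'m,'x1) rmod_scheme \<Rightarrow> ('a,'a,'n,'x2) bimod_scheme \<Rightarrow> ('a,'a,'p,'x3) bimod_scheme \<Rightarrow>
   (((('m \<times> 'n) \<Rightarrow>\<^sub>0 int) set \<times> 'p) \<Rightarrow>\<^sub>0 int) set \<Rightarrow> (('m \<times> (('n \<times> 'p) \<Rightarrow>\<^sub>0 int) set) \<Rightarrow>\<^sub>0 int) set" where
  "tensor_assoc M N P =
     (let NP = tensor UNIV N P; G = tensor_ab UNIV M NP in
      tensor_lift UNIV (tensor_r UNIV M N) P G
        (\<lambda>X p. tensor_lift UNIV M N G (\<lambda>m n. pure_tensor UNIV M NP m (pure_tensor UNIV N P n p)) X))"


subsection \<open>Corings and comodules\<close>

record ('a,'c) coring = "('a,'a,'c) bimod" +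
  comult :: "'c \<Rightarrow> (('c \<times> 'c) \<Rightarrow>\<^sub>0 int) set"
  counit :: "'c \<Rightarrow> 'a"

definition is_coring :: "('k::field \<Rightarrow> 'a::{comm_ring,monoid_mult}) \<Rightarrow> ('a,'c) coring \<Rightarrow> bool" where
  "is_coring \<eta>A C \<longleftrightarrow> bimodule \<eta>A C \<and>
     bimod_hom C (tensor UNIV C C) (comult C) \<and>
     bimod_hom C regular_bimod (counit C) \<and>
     (\<forall>z\<in>carrier C.
        tensor_assoc C C C (tensor_map C C (tensor UNIV C C) C (comult C) (\<lambda>y. y) (comult C z)) =
        tensor_map C C C (tensor UNIV C C) (\<lambda>x. x) (comult C) (comult C z)) \<and>
     (\<forall>z\<in>carrier C. tensor_lift UNIV C C C (\<lambda>x y. lact C (counit C x) y) (comult C z) = z) \<and>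
     (\<forall>z\<in>carrier C. tensor_lift UNIV C C C (\<lambda>x y. ract C x (counit C y)) (comult C z) = z)"

definition coring_hom ::
  "('a::{comm_ring,monoid_mult},'c) coring \<Rightarrow> ('a,'d) coring \<Rightarrow> ('c \<Rightarrow> 'd) \<Rightarrow> bool" where
  "coring_hom C D f \<longleftrightarrow> bimod_hom C D f \<and>
     (\<forall>z\<in>carrier C. comult D (f z) = tensor_map C C D D f f (comult C z)) \<and>
     (\<forall>z\<in>carrier C. counit D (f z) = counit C z)"

definition coring_iso ::
  "('a::{comm_ring,monoid_mult},'c) coring \<Rightarrow> ('a,'d) coring \<Rightarrow> ('c \<Rightarrow> 'd) \<Rightarrow> bool" where
  "coring_iso C D f \<longleftrightarrow> coring_hom C D f \<and>
     (\<exists>g. coring_hom D C g \<and> (\<forall>z\<in>carrier C. g (f z) = z) \<and> (\<forall>w\<in>carrier D. f (g w) = w))"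

record ('a,'m,'c) comod = "('a,'m) rmod" +
  coact :: "'m \<Rightarrow> (('m \<times> 'c) \<Rightarrow>\<^sub>0 int) set"

definition comodule ::
  "('a::{comm_ring,monoid_mult},'c) coring \<Rightarrow> ('a,'m,'c) comod \<Rightarrow> bool" where
  "comodule C M \<longleftrightarrow> right_module M \<and>
     rmod_hom M (tensor_r UNIV M C) (coact M) \<and>
     (\<forall>m\<in>carrier M.
        tensor_assoc M C C (tensor_map M C (tensor_r UNIV M C) C (coact M) (\<lambda>c. c) (coact M m)) =
        tensor_map M C M (tensor UNIV C C) (\<lambda>n. n) (comult C) (coact M m)) \<and>
     (\<forall>m\<in>carrier M. tensor_lift UNIV M C M (\<lambda>n c. ract M n (counit C c)) (coact M m) = m)"

definition comodule_hom ::
  "('a::{comm_ring,monoid_mult},'c) coring \<Rightarrow> ('a,'m,'c) comod \<Rightarrow> ('a,'n,'c) comod \<Rightarrow>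
     ('m \<Rightarrow> 'n) \<Rightarrow> bool" where
  "comodule_hom C M N t \<longleftrightarrow> rmod_hom M N t \<and>
     (\<forall>m\<in>carrier M. coact N (t m) = tensor_map M C N C t (\<lambda>c. c) (coact M m))"


subsection \<open>Direct sums and quotients of bimodules\<close>

definition bimod_sum :: "'o set \<Rightarrow> ('o \<Rightarrow> ('s,'t,'m) bimod) \<Rightarrow> ('s,'t,'o \<Rightarrow> 'm) bimod" where
  "bimod_sum I M =
     (let G = sum_group I (\<lambda>i. add_monoid (M i)) in
      \<lparr>carrier = carrier G, mult = undefined, one = undefined, zero = one G, add = mult G,
       ract = (\<lambda>x b. \<lambda>i\<in>I. ract (M i) (x i) b), lact = (\<lambda>a x. \<lambda>i\<in>I. lact (M i) a (x i))\<rparr>)"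

definition bimod_inj :: "'o set \<Rightarrow> ('o \<Rightarrow> ('s,'t,'m) bimod) \<Rightarrow> 'o \<Rightarrow> 'm \<Rightarrow> 'o \<Rightarrow> 'm" where
  "bimod_inj I M j x = (\<lambda>i\<in>I. if i = j then x else \<zero>\<^bsub>M i\<^esub>)"

definition subbimodule :: "'m set \<Rightarrow> ('s,'t,'m) bimod \<Rightarrow> bool" where
  "subbimodule J M \<longleftrightarrow> additive_subgroup J M \<and>
     (\<forall>x\<in>J. \<forall>a. lact M a x \<in> J) \<and> (\<forall>x\<in>J. \<forall>b. ract M x b \<in> J)"

definition subbimodule_generated :: "('s,'t,'m) bimod \<Rightarrow> 'm set \<Rightarrow> 'm set" where
  "subbimodule_generated M X = \<Inter>{J. subbimodule J M \<and> X \<subseteq> J}"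

definition bimod_quotient :: "('s,'t,'m) bimod \<Rightarrow> 'm set \<Rightarrow> ('s,'t,'m set) bimod" where
  "bimod_quotient M J =
     \<lparr>carrier = a_rcosets\<^bsub>M\<^esub> J, mult = undefined, one = undefined, zero = J, add = set_add M,
      ract = (\<lambda>X b. \<Union>x\<in>X. J +>\<^bsub>M\<^esub> ract M x b), lact = (\<lambda>a X. \<Union>x\<in>X. J +>\<^bsub>M\<^esub> lact M a x)\<rparr>"


subsection \<open>The coring \<open>\<R>(\<A>)\<close>\<close>

text \<open>\<open>P\<^sup>*\<close> as a bimodule with \<open>A\<close> acting on the left and \<open>T\<^sub>P\<close> acting on the right.\<close>

definition dual_bimod ::
  "('a::{comm_ring,monoid_mult},'m) rmod \<Rightarrow> ('a, 'm \<Rightarrow> 'm, 'm \<Rightarrow> 'a) bimod" where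
  "dual_bimod P =
     \<lparr>carrier = {f \<in> extensional (carrier P). rmod_hom P regular_bimod f},
      mult = undefined, one = undefined,
      zero = (\<lambda>p\<in>carrier P. 0), add = (\<lambda>f g. \<lambda>p\<in>carrier P. f p + g p),
      ract = (\<lambda>f t. \<lambda>p\<in>carrier P. f (t p)), lact = (\<lambda>a f. \<lambda>p\<in>carrier P. a * f p)\<rparr>"

text \<open>\<open>P\<close> as a bimodule with \<open>T\<^sub>P\<close> acting on the left and \<open>A\<close> acting on the right.\<close>

definition endo_bimod :: "('a,'m) rmod \<Rightarrow> ('m \<Rightarrow> 'm, 'a, 'm) bimod" where
  "endo_bimod P = rmod.extend P (bimod.fields (\<lambda>t p. t p))"

definition dual_basis ::
  "('a::{comm_ring,monoid_mult},'m) rmod \<Rightarrow> ('m \<times> ('m \<Rightarrow> 'a)) list \<Rightarrow> bool" where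
  "dual_basis P es \<longleftrightarrow>
     (\<forall>(e, e') \<in> set es. e \<in> carrier P \<and> e' \<in> carrier (dual_bimod P)) \<and>
     (\<forall>p\<in>carrier P. p = (\<Oplus>\<^bsub>P\<^esub>i\<in>{..<length es}. ract P (fst (es ! i)) (snd (es ! i) p)))"

type_synonym ('a,'m) comatrix_elem = "((('m \<Rightarrow> 'a) \<times> 'm) \<Rightarrow>\<^sub>0 int) set"
type_synonym ('o,'a,'m) recon_elem = "('o \<Rightarrow> ('a,'m) comatrix_elem) set"

text \<open>
  A small category with a faithful functor to finitely generated projective right \<open>A\<close>-modules is
  given by its set of objects \<open>Ob\<close>, the functor \<open>U\<close> on objects, and the hom sets \<open>Hm P Q\<close>,
  whose members are identified by faithfulness with maps \<open>carrier (U P) \<rightarrow> carrier (U Q)\<close>.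
\<close>

definition comatrix ::
  "('o \<Rightarrow> ('a::{comm_ring,monoid_mult},'m) rmod) \<Rightarrow> ('o \<Rightarrow> 'o \<Rightarrow> ('m \<Rightarrow> 'm) set) \<Rightarrow> 'o \<Rightarrow>
     ('a,'a,('a,'m) comatrix_elem) bimod" where
  "comatrix U Hm P = tensor (Hm P P) (dual_bimod (U P)) (endo_bimod (U P))"

definition recon_sum ::
  "'o set \<Rightarrow> ('o \<Rightarrow> ('a::{comm_ring,monoid_mult},'m) rmod) \<Rightarrow> ('o \<Rightarrow> 'o \<Rightarrow> ('m \<Rightarrow> 'm) set) \<Rightarrow>
     ('a,'a,'o \<Rightarrow> ('a,'m) comatrix_elem) bimod" where
  "recon_sum Ob U Hm = bimod_sum Ob (comatrix U Hm)"

text \<open>\<open>p\<^sup>* \<otimes> p\<close> in the summand \<open>P\<^sup>* \<otimes> P\<close> of the direct sum\<close>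

definition recon_tensor ::
  "'o set \<Rightarrow> ('o \<Rightarrow> ('a::{comm_ring,monoid_mult},'m) rmod) \<Rightarrow> ('o \<Rightarrow> 'o \<Rightarrow> ('m \<Rightarrow> 'm) set) \<Rightarrow>
     'o \<Rightarrow> ('m \<Rightarrow> 'a) \<Rightarrow> 'm \<Rightarrow> 'o \<Rightarrow> ('a,'m) comatrix_elem" where
  "recon_tensor Ob U Hm P p' p = bimod_inj Ob (comatrix U Hm) P
     (pure_tensor (Hm P P) (dual_bimod (U P)) (endo_bimod (U P)) p' p)"

definition recon_ideal ::
  "'o set \<Rightarrow> ('o \<Rightarrow> ('a::{comm_ring,monoid_mult},'m) rmod) \<Rightarrow> ('o \<Rightarrow> 'o \<Rightarrow> ('m \<Rightarrow> 'm) set) \<Rightarrow>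
     ('o \<Rightarrow> ('a,'m) comatrix_elem) set" where
  "recon_ideal Ob U Hm = subbimodule_generated (recon_sum Ob U Hm)
     {recon_tensor Ob U Hm Q q' (t p) \<ominus>\<^bsub>recon_sum Ob U Hm\<^esub>
      recon_tensor Ob U Hm P (\<lambda>x\<in>carrier (U P). q' (t x)) p | P Q t p q'.
        P \<in> Ob \<and> Q \<in> Ob \<and> t \<in> Hm P Q \<and> p \<in> carrier (U P) \<and> q' \<in> carrier (dual_bimod (U Q))}"

definition recon_bimod ::
  "'o set \<Rightarrow> ('o \<Rightarrow> ('a::{comm_ring,monoid_mult},'m) rmod) \<Rightarrow> ('o \<Rightarrow> 'o \<Rightarrow> ('m \<Rightarrow> 'm) set) \<Rightarrow>
     ('a,'a,('o,'a,'m) recon_elem) bimod" where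
  "recon_bimod Ob U Hm = bimod_quotient (recon_sum Ob U Hm) (recon_ideal Ob U Hm)"

text \<open>The class of \<open>p\<^sup>* \<otimes> p\<close> in \<open>\<R>(\<A>)\<close>. These classes generate \<open>\<R>(\<A>)\<close> additively, so the maps
  chosen by \<open>SOME\<close> from here on are determined on the carrier by their values on them.\<close>

definition recon_class ::
  "'o set \<Rightarrow> ('o \<Rightarrow> ('a::{comm_ring,monoid_mult},'m) rmod) \<Rightarrow> ('o \<Rightarrow> 'o \<Rightarrow> ('m \<Rightarrow> 'm) set) \<Rightarrow>
     'o \<Rightarrow> ('m \<Rightarrow> 'a) \<Rightarrow> 'm \<Rightarrow> ('o,'a,'m) recon_elem" where
  "recon_class Ob U Hm P p' p =
     recon_ideal Ob U Hm +>\<^bsub>recon_sum Ob U Hm\<^esub> recon_tensor Ob U Hm P p' p"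

definition recon_extend ::
  "'o set \<Rightarrow> ('o \<Rightarrow> ('a::{comm_ring,monoid_mult},'m) rmod) \<Rightarrow> ('o \<Rightarrow> 'o \<Rightarrow> ('m \<Rightarrow> 'm) set) \<Rightarrow>
     ('a,'a,'g,'z) bimod_scheme \<Rightarrow> ('o \<Rightarrow> ('m \<Rightarrow> 'a) \<Rightarrow> 'm \<Rightarrow> 'g) \<Rightarrow> ('o,'a,'m) recon_elem \<Rightarrow> 'g" where
  "recon_extend Ob U Hm G \<beta> = (SOME h. bimod_hom (recon_bimod Ob U Hm) G h \<and>
     (\<forall>P\<in>Ob. \<forall>p'\<in>carrier (dual_bimod (U P)). \<forall>p\<in>carrier (U P).
        h (recon_class Ob U Hm P p' p) = \<beta> P p' p))"

definition recon ::
  "'o set \<Rightarrow> ('o \<Rightarrow> ('a::{comm_ring,monoid_mult},'m) rmod) \<Rightarrow> ('o \<Rightarrow> 'o \<Rightarrow> ('m \<Rightarrow> 'm) set) \<Rightarrow>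
     ('a,('o,'a,'m) recon_elem) coring" where
  "recon Ob U Hm =
     (let B = recon_bimod Ob U Hm; T = tensor UNIV B B; cl = recon_class Ob U Hm in
      bimod.extend B (coring.fields
        (recon_extend Ob U Hm T (\<lambda>P p' p.
           let es = SOME es. dual_basis (U P) es in
           \<Oplus>\<^bsub>T\<^esub>i\<in>{..<length es}. pure_tensor UNIV B B (cl P p' (fst (es ! i))) (cl P (snd (es ! i)) p)))
        (recon_extend Ob U Hm regular_bimod (\<lambda>P p' p. p' p))))"


subsection \<open>Galois corings\<close>

text \<open>
  Essential smallness: every finitely generated projective \<open>A\<close>-module is isomorphic to one whose
  carrier is a set of sequences in \<open>A\<close>, so the categories \<open>\<A>\<^sup>C\<close> and \<open>\<A>\<^sub>R\<close> are replaced by their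
  equivalent full subcategories of objects with carrier in \<open>nat \<Rightarrow> 'a\<close> (the module structure on the
  carrier being arbitrary).
\<close>

definition comod_Ob ::
  "('a::{comm_ring,monoid_mult},'c) coring \<Rightarrow> ('a, nat \<Rightarrow> 'a, 'c) comod set" where
  "comod_Ob C = {M. comodule C M \<and> fg_projective M}"

definition comod_Hom ::
  "('a::{comm_ring,monoid_mult},'c) coring \<Rightarrow> ('a, nat \<Rightarrow> 'a, 'c) comod \<Rightarrow>
     ('a, nat \<Rightarrow> 'a, 'c) comod \<Rightarrow> ((nat \<Rightarrow> 'a) \<Rightarrow> (nat \<Rightarrow> 'a)) set" where
  "comod_Hom C M N = {t \<in> extensional (carrier M). comodule_hom C M N t}"

definition comod_recon ::
  "('a::{comm_ring,monoid_mult},'c) coring \<Rightarrow>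
     ('a, (('a, nat \<Rightarrow> 'a, 'c) comod, 'a, nat \<Rightarrow> 'a) recon_elem) coring" where
  "comod_recon C = recon (comod_Ob C) rmod.truncate (comod_Hom C)"

definition can_map ::
  "('a::{comm_ring,monoid_mult},'c) coring \<Rightarrow>
     (('a, nat \<Rightarrow> 'a, 'c) comod, 'a, nat \<Rightarrow> 'a) recon_elem \<Rightarrow> 'c" where
  "can_map C = recon_extend (comod_Ob C) rmod.truncate (comod_Hom C) C
     (\<lambda>P p' p. tensor_lift UNIV P C C (\<lambda>x c. lact C (p' x) c) (coact P p))"

definition galois_coring ::
  "('k::field \<Rightarrow> 'a::{comm_ring,monoid_mult}) \<Rightarrow> ('a,'c) coring \<Rightarrow> bool" where
  "galois_coring \<eta>A C \<longleftrightarrow> is_coring \<eta>A C \<and> coring_iso (comod_recon C) C (can_map C)"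


subsection \<open>The right dual \<open>R\<^sup>*\<close>, and \<open>R\<degree>\<close>\<close>

text \<open>\<open>R\<^sup>* = Hom\<^sub>-\<^sub>A(R, A)\<close> with \<open>(a f b)(r) = a f(b r)\<close>\<close>

definition ring_dual ::
  "('a::{comm_ring,monoid_mult} \<Rightarrow> 'r::{ring,monoid_mult}) \<Rightarrow> ('a,'a,'r \<Rightarrow> 'a) bimod" where
  "ring_dual \<iota> =
     \<lparr>carrier = {f. (\<forall>x y. f (x + y) = f x + f y) \<and> (\<forall>x a. f (x * \<iota> a) = f x * a)},
      mult = undefined, one = undefined, zero = (\<lambda>r. 0), add = (\<lambda>f g r. f r + g r),
      ract = (\<lambda>f b r. f (\<iota> b * r)), lact = (\<lambda>a f r. a * f r)\<rparr>"

text \<open>\<open>f : C \<rightarrow> R\<^sup>*\<close> is an \<open>A\<close>-bimodule map with property \<open>(*)\<close>; products \<open>a y\<close> with \<open>a \<in> A\<close>, \<open>y \<in> R\<close> are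
  \<open>\<iota> a * y\<close>.\<close>

definition star_map ::
  "('a::{comm_ring,monoid_mult} \<Rightarrow> 'r::{ring,monoid_mult}) \<Rightarrow> ('a,'c) coring \<Rightarrow>
     ('c \<Rightarrow> 'r \<Rightarrow> 'a) \<Rightarrow> bool" where
  "star_map \<iota> C f \<longleftrightarrow> bimod_hom C (ring_dual \<iota>) f \<and>
     (\<forall>z\<in>carrier C. \<forall>x y. f z (x * y) =
        tensor_lift UNIV C C regular_bimod (\<lambda>z1 z2. f z1 (\<iota> (f z2 x) * y)) (comult C z)) \<and>
     (\<forall>z\<in>carrier C. f z 1 = counit C z) \<and>
     (\<forall>z\<in>carrier C. \<forall>a b x. f (ract C (lact C a z) b) x = a * f z (\<iota> b * x))"

type_synonym ('a,'r) fin_dual_elem = "(('r, nat \<Rightarrow> 'a) rmod, 'a, nat \<Rightarrow> 'a) recon_elem"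

definition rep_Ob ::
  "('a::{comm_ring,monoid_mult} \<Rightarrow> 'r::{ring,monoid_mult}) \<Rightarrow> ('r, nat \<Rightarrow> 'a) rmod set" where
  "rep_Ob \<iota> = {M. right_module M \<and> fg_projective (restrict_scalars \<iota> M)}"

definition rep_Hom ::
  "('r, nat \<Rightarrow> 'a) rmod \<Rightarrow> ('r, nat \<Rightarrow> 'a) rmod \<Rightarrow> ((nat \<Rightarrow> 'a) \<Rightarrow> (nat \<Rightarrow> 'a)) set" where
  "rep_Hom M N = {t \<in> extensional (carrier M). rmod_hom M N t}"

definition fin_dual ::
  "('a::{comm_ring,monoid_mult} \<Rightarrow> 'r::{ring,monoid_mult}) \<Rightarrow>
     ('a, ('a,'r) fin_dual_elem) coring" where
  "fin_dual \<iota> = recon (rep_Ob \<iota>) (restrict_scalars \<iota>) rep_Hom"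

definition zeta ::
  "('a::{comm_ring,monoid_mult} \<Rightarrow> 'r::{ring,monoid_mult}) \<Rightarrow> ('a,'r) fin_dual_elem \<Rightarrow> 'r \<Rightarrow> 'a" where
  "zeta \<iota> = recon_extend (rep_Ob \<iota>) (restrict_scalars \<iota>) rep_Hom (ring_dual \<iota>)
     (\<lambda>P p' p r. p' (ract P p r))"


subsection \<open>The universal coring \<open>R\<^sup>\<bullet>\<close>\<close>

text \<open>The universal property of \<open>(D, \<xi>)\<close> with respect to all corings whose carrier lies in the type
  \<open>'c\<close>.\<close>

definition universal_for ::
  "'c itself \<Rightarrow> ('k::field \<Rightarrow> 'a::{comm_ring,monoid_mult}) \<Rightarrow> ('a \<Rightarrow> 'r::{ring,monoid_mult}) \<Rightarrow>
     ('a,'d) coring \<Rightarrow> ('d \<Rightarrow> 'r \<Rightarrow> 'a) \<Rightarrow> bool" where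
  "universal_for _ \<eta>A \<iota> D \<xi> \<longleftrightarrow>
     (\<forall>(C :: ('a,'c) coring) f. is_coring \<eta>A C \<and> star_map \<iota> C f \<longrightarrow>
        (\<exists>g. coring_hom C D g \<and> (\<forall>z\<in>carrier C. \<xi> (g z) = f z) \<and>
           (\<forall>g'. coring_hom C D g' \<and> (\<forall>z\<in>carrier C. \<xi> (g' z) = f z) \<longrightarrow>
              (\<forall>z\<in>carrier C. g' z = g z))))"

text \<open>
  \<open>R\<^sup>\<bullet>\<close> is universal among corings of any size. A single formula cannot quantify over the type of the
  test coring \<open>C\<close>, so only corings living in the type of \<open>R\<^sup>\<bullet>\<close> itself or in that of \<open>R\<degree>\<close> are
  tested. As a hypothesis this is implied by the full universal property.
\<close>

definition is_universal_coring ::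
  "('k::field \<Rightarrow> 'a::{comm_ring,monoid_mult}) \<Rightarrow> ('a \<Rightarrow> 'r::{ring,monoid_mult}) \<Rightarrow>
     ('a,'d) coring \<Rightarrow> ('d \<Rightarrow> 'r \<Rightarrow> 'a) \<Rightarrow> bool" where
  "is_universal_coring \<eta>A \<iota> D \<xi> \<longleftrightarrow> is_coring \<eta>A D \<and> star_map \<iota> D \<xi> \<and>
     universal_for TYPE('d) \<eta>A \<iota> D \<xi> \<and>
     universal_for TYPE(('a,'r) fin_dual_elem) \<eta>A \<iota> D \<xi>"

definition zeta_hat ::
  "('a::{comm_ring,monoid_mult} \<Rightarrow> 'r::{ring,monoid_mult}) \<Rightarrow>
     ('a,'d) coring \<Rightarrow> ('d \<Rightarrow> 'r \<Rightarrow> 'a) \<Rightarrow> ('a,'r) fin_dual_elem \<Rightarrow> 'd" where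
  "zeta_hat \<iota> D \<xi> = (SOME g. coring_hom (fin_dual \<iota>) D g \<and>
     (\<forall>z\<in>carrier (fin_dual \<iota>). \<xi> (g z) = zeta \<iota> z))"

end

theory Submission
  imports Defs
begin

text \<open>
  The statement is about two passages between module categories. Let \<open>D\<close> be an \<open>A\<close>-coring with a map
  \<open>\<xi> : D \<rightarrow> R\<^sup>*\<close> satisfying \<open>(*)\<close>. A \<open>D\<close>-comodule \<open>M\<close> becomes an \<open>R\<close>-module by \<open>m r = m\<^sub>0 \<xi>(m\<^sub>1)(r)\<close>
  (\<open>rep_of\<close>); comodule maps are \<open>R\<close>-linear, so by functoriality of \<open>\<R>\<close> (\<open>recon_functor\<close>) there is a coring
  map \<open>F : \<R>(\<A>\<^sup>D) \<rightarrow> R\<degree>\<close>, and \<open>\<zeta> \<circ> F = \<xi> \<circ> can\<close>. Conversely, let \<open>g : R\<degree> \<rightarrow> D\<close> be a coring map. An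
  \<open>R\<close>-module \<open>P\<close> becomes a \<open>D\<close>-comodule by \<open>p \<mapsto> \<Sum> e\<^sub>i \<otimes> g(e\<^sub>i\<^sup>* \<otimes> p)\<close> (\<open>comodule_along\<close>), which gives a
  coring map \<open>G : R\<degree> \<rightarrow> \<R>(\<A>\<^sup>D)\<close> with \<open>can \<circ> G = g\<close>.

  If \<open>\<xi> \<circ> g = \<zeta>\<close>, then an \<open>R\<close>-module is recovered from its comodule, and \<open>F \<circ> G = id\<close>. If moreover
  \<open>can = g \<circ> F\<close>, then a comodule is recovered from its \<open>R\<close>-module too: the coefficients \<open>e\<^sub>i\<^sup>*(p\<^sub>0) p\<^sub>1\<close> of the
  coaction are values of \<open>can\<close>, and those of the new coaction are the corresponding values of \<open>g \<circ> F\<close>. Hence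
  \<open>F\<close> and \<open>G\<close> are inverse to each other, and \<open>can\<close> is an isomorphism if and only if \<open>g\<close> is one. This is
  \<open>can_iso_iff\<close>, from which both parts follow.

  For the first part take \<open>D = R\<degree>\<close>, \<open>\<xi> = \<zeta>\<close> and \<open>g = id\<close>: from \<open>\<zeta> \<circ> F = \<zeta> \<circ> can\<close> and injectivity of \<open>\<zeta>\<close> one
  gets \<open>can = F\<close>, so \<open>R\<degree>\<close> is Galois. A Galois coring \<open>C\<close> with \<open>f : C \<rightarrow> R\<^sup>*\<close> maps to \<open>R\<degree>\<close> by \<open>F \<circ> can\<^sup>-\<^sup>1\<close>, as
  \<open>\<zeta> \<circ> F \<circ> can\<^sup>-\<^sup>1 = f\<close>.

  For the second part take \<open>g\<close> to be the canonical map \<open>R\<degree> \<rightarrow> R\<^sup>\<bullet>\<close>. Both \<open>can\<close> and \<open>g \<circ> F\<close> are coring maps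
  over \<open>R\<^sup>*\<close>, so they agree by the uniqueness half of the universal property (\<open>universal_can\<close>).

  Both \<open>R\<degree>\<close> and \<open>\<R>(\<A>\<^sup>D)\<close> are instances of \<open>\<R>(\<A>)\<close>. Its coring structure, independence of the choice of dual bases
  and the constructions above all come down to one fact, the naturality of \<open>\<Sum> e\<^sub>i \<otimes> e\<^sub>i\<^sup>*\<close>
  (\<open>dual_basis_transport\<close>).
\<close>

section \<open>Additive maps and module axioms\<close>

lemma additive_mapI:
  assumes "\<And>x. x \<in> carrier M \<Longrightarrow> h x \<in> carrier N"
    and "\<And>x y. \<lbrakk>x \<in> carrier M; y \<in> carrier M\<rbrakk> \<Longrightarrow> h (x \<oplus>\<^bsub>M\<^esub> y) = h x \<oplus>\<^bsub>N\<^esub> h y"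
  shows "additive_map M N h"
  using assms by (auto simp: additive_map_def hom_def)

lemma additive_map_closed: "additive_map M N h \<Longrightarrow> x \<in> carrier M \<Longrightarrow> h x \<in> carrier N"
  by (auto simp: additive_map_def hom_def)

lemma additive_map_add:
  "additive_map M N h \<Longrightarrow> x \<in> carrier M \<Longrightarrow> y \<in> carrier M \<Longrightarrow> h (x \<oplus>\<^bsub>M\<^esub> y) = h x \<oplus>\<^bsub>N\<^esub> h y"
  by (auto simp: additive_map_def hom_def)

lemma additive_map_abelian_group_hom:
  assumes "abelian_group M" "abelian_group N" "additive_map M N h"
  shows "abelian_group_hom M N h"
  by (rule abelian_group_homI[OF assms(1,2)])
    (use assms in \<open>auto simp: additive_map_def group_hom_def group_hom_axioms_def abelian_group.a_group\<close>)

lemma additive_map_zero: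
  "abelian_group M \<Longrightarrow> abelian_group N \<Longrightarrow> additive_map M N h \<Longrightarrow> h \<zero>\<^bsub>M\<^esub> = \<zero>\<^bsub>N\<^esub>"
  by (rule abelian_group_hom.hom_zero[OF additive_map_abelian_group_hom])

lemma additive_map_minus:
  "abelian_group M \<Longrightarrow> abelian_group N \<Longrightarrow> additive_map M N h \<Longrightarrow> x \<in> carrier M \<Longrightarrow>
    h (\<ominus>\<^bsub>M\<^esub> x) = \<ominus>\<^bsub>N\<^esub> h x"
  by (rule abelian_group_hom.hom_a_inv[OF additive_map_abelian_group_hom])

lemma additive_map_comp:
  "additive_map M N f \<Longrightarrow> additive_map N K g \<Longrightarrow> additive_map M K (\<lambda>x. g (f x))"
  by (rule additive_mapI) (simp_all add: additive_map_closed additive_map_add)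

lemma additive_map_finsum:
  assumes "abelian_group M" "abelian_group N" "additive_map M N h" "finite I"
    and "\<And>i. i \<in> I \<Longrightarrow> f i \<in> carrier M"
  shows "h (finsum M f I) = finsum N (\<lambda>i. h (f i)) I"
proof -
  interpret M: abelian_group M by fact
  interpret N: abelian_group N by fact
  show ?thesis
    using assms(4,5)
  proof (induction I rule: finite_induct)
    case empty
    then show ?case by (simp add: additive_map_zero[OF assms(1-3)])
  next
    case (insert i I)
    then have "finsum M f (insert i I) = f i \<oplus>\<^bsub>M\<^esub> finsum M f I"
      by (intro M.finsum_insert) auto
    moreover have "finsum N (\<lambda>i. h (f i)) (insert i I) = h (f i) \<oplus>\<^bsub>N\<^esub> finsum N (\<lambda>i. h (f i)) I"
      using insert by (intro N.finsum_insert) (auto intro: additive_map_closed[OF assms(3)])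
    moreover have "finsum M f I \<in> carrier M"
      using insert by (intro M.finsum_closed) auto
    ultimately show ?case
      using insert by (simp add: additive_map_add[OF assms(3)])
  qed
qed

lemma additive_map_sum_of_maps:
  assumes "abelian_group N" "\<And>i. i \<in> I \<Longrightarrow> additive_map M N (h i)"
  shows "additive_map M N (\<lambda>x. finsum N (\<lambda>i. h i x) I)"
proof -
  interpret N: abelian_group N by fact
  show ?thesis
  proof (rule additive_mapI)
    fix x y assume xy: "x \<in> carrier M" "y \<in> carrier M"
    show "(\<Oplus>\<^bsub>N\<^esub>i\<in>I. h i (x \<oplus>\<^bsub>M\<^esub> y)) = (\<Oplus>\<^bsub>N\<^esub>i\<in>I. h i x) \<oplus>\<^bsub>N\<^esub> (\<Oplus>\<^bsub>N\<^esub>i\<in>I. h i y)"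
    proof -
      have "(\<Oplus>\<^bsub>N\<^esub>i\<in>I. h i (x \<oplus>\<^bsub>M\<^esub> y)) = (\<Oplus>\<^bsub>N\<^esub>i\<in>I. h i x \<oplus>\<^bsub>N\<^esub> h i y)"
        using xy by (intro N.finsum_cong') (auto simp: additive_map_add[OF assms(2)] additive_map_closed[OF assms(2)])
      also have "\<dots> = (\<Oplus>\<^bsub>N\<^esub>i\<in>I. h i x) \<oplus>\<^bsub>N\<^esub> (\<Oplus>\<^bsub>N\<^esub>i\<in>I. h i y)"
        using xy by (intro N.finsum_addf) (auto simp: additive_map_closed[OF assms(2)])
      finally show ?thesis .
    qed
  qed (auto intro!: N.finsum_closed simp: Pi_iff additive_map_closed[OF assms(2)])
qed

lemma finsum_swap:
  assumes "abelian_group N" "finite I" "finite J"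
    and "\<And>i j. i \<in> I \<Longrightarrow> j \<in> J \<Longrightarrow> f i j \<in> carrier N"
  shows "finsum N (\<lambda>i. finsum N (\<lambda>j. f i j) J) I = finsum N (\<lambda>j. finsum N (\<lambda>i. f i j) I) J"
proof -
  interpret N: abelian_group N by fact
  show ?thesis
    using assms(2,4)
  proof (induction I rule: finite_induct)
    case (insert i I)
    have "(\<Oplus>\<^bsub>N\<^esub>k\<in>insert i I. \<Oplus>\<^bsub>N\<^esub>j\<in>J. f k j) = (\<Oplus>\<^bsub>N\<^esub>j\<in>J. f i j) \<oplus>\<^bsub>N\<^esub> (\<Oplus>\<^bsub>N\<^esub>k\<in>I. \<Oplus>\<^bsub>N\<^esub>j\<in>J. f k j)"
      using insert by (intro N.finsum_insert) (auto intro!: N.finsum_closed)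
    also have "\<dots> = (\<Oplus>\<^bsub>N\<^esub>j\<in>J. f i j) \<oplus>\<^bsub>N\<^esub> (\<Oplus>\<^bsub>N\<^esub>j\<in>J. \<Oplus>\<^bsub>N\<^esub>k\<in>I. f k j)"
      using insert by simp
    also have "\<dots> = (\<Oplus>\<^bsub>N\<^esub>j\<in>J. f i j \<oplus>\<^bsub>N\<^esub> (\<Oplus>\<^bsub>N\<^esub>k\<in>I. f k j))"
      using insert by (intro N.finsum_addf[symmetric]) (auto intro!: N.finsum_closed)
    also have "\<dots> = (\<Oplus>\<^bsub>N\<^esub>j\<in>J. \<Oplus>\<^bsub>N\<^esub>k\<in>insert i I. f k j)"
      using insert by (intro N.finsum_cong' refl) (auto intro!: N.finsum_insert[symmetric] N.finsum_closed)
    finally show ?case .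
  qed simp
qed

lemma right_moduleD:
  assumes "right_module M"
  shows "abelian_group M"
    and "m \<in> carrier M \<Longrightarrow> ract M m a \<in> carrier M"
    and "m \<in> carrier M \<Longrightarrow> n \<in> carrier M \<Longrightarrow> ract M (m \<oplus>\<^bsub>M\<^esub> n) a = ract M m a \<oplus>\<^bsub>M\<^esub> ract M n a"
    and "m \<in> carrier M \<Longrightarrow> ract M m (a + b) = ract M m a \<oplus>\<^bsub>M\<^esub> ract M m b"
    and "m \<in> carrier M \<Longrightarrow> ract M m (a * b) = ract M (ract M m a) b"
    and "m \<in> carrier M \<Longrightarrow> ract M m 1 = m"
  using assms unfolding right_module_def by auto

definition left_module :: "('s::{ring,monoid_mult},'t,'m,'z) bimod_scheme \<Rightarrow> bool" where
  "left_module M \<longleftrightarrow> abelian_group M \<and>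
     (\<forall>m\<in>carrier M. \<forall>a. lact M a m \<in> carrier M) \<and>
     (\<forall>m\<in>carrier M. \<forall>n\<in>carrier M. \<forall>a. lact M a (m \<oplus>\<^bsub>M\<^esub> n) = lact M a m \<oplus>\<^bsub>M\<^esub> lact M a n) \<and>
     (\<forall>m\<in>carrier M. \<forall>a b. lact M (a + b) m = lact M a m \<oplus>\<^bsub>M\<^esub> lact M b m) \<and>
     (\<forall>m\<in>carrier M. \<forall>a b. lact M (a * b) m = lact M a (lact M b m)) \<and>
     (\<forall>m\<in>carrier M. lact M 1 m = m)"

lemma left_moduleD:
  assumes "left_module M"
  shows "abelian_group M"
    and "m \<in> carrier M \<Longrightarrow> lact M a m \<in> carrier M"
    and "m \<in> carrier M \<Longrightarrow> n \<in> carrier M \<Longrightarrow> lact M a (m \<oplus>\<^bsub>M\<^esub> n) = lact M a m \<oplus>\<^bsub>M\<^esub> lact M a n"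
    and "m \<in> carrier M \<Longrightarrow> lact M (a + b) m = lact M a m \<oplus>\<^bsub>M\<^esub> lact M b m"
    and "m \<in> carrier M \<Longrightarrow> lact M (a * b) m = lact M a (lact M b m)"
    and "m \<in> carrier M \<Longrightarrow> lact M 1 m = m"
  using assms unfolding left_module_def by auto

text \<open>Two commuting actions form a bimodule over the \<open>\<bbbk>\<close>-algebra \<open>A\<close> when \<open>\<bbbk>\<close> acts equally from both
  sides (\<open>bimodule_iff\<close>). This is a separate step since for \<open>\<R>(\<A>)\<close> it rests on the category: the scalars
  have to be morphisms (\<open>is_coring_recon\<close>).\<close>

definition two_sided_module :: "('s::{ring,monoid_mult},'t::{ring,monoid_mult},'m,'z) bimod_scheme \<Rightarrow> bool" where
  "two_sided_module M \<longleftrightarrow> right_module M \<and> left_module M \<and>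
     (\<forall>m\<in>carrier M. \<forall>a b. ract M (lact M a m) b = lact M a (ract M m b))"

lemma two_sided_moduleD:
  assumes "two_sided_module M"
  shows "right_module M" "left_module M"
    and "m \<in> carrier M \<Longrightarrow> ract M (lact M a m) b = lact M a (ract M m b)"
  using assms unfolding two_sided_module_def by auto

lemma bimodule_iff:
  "bimodule \<eta>A M \<longleftrightarrow> two_sided_module M \<and> (\<forall>m\<in>carrier M. \<forall>c. lact M (\<eta>A c) m = ract M m (\<eta>A c))"
  unfolding bimodule_def two_sided_module_def left_module_def right_module_def
  by (intro iffI conjI; elim conjE; assumption)

lemma additive_ract: "right_module M \<Longrightarrow> additive_map M M (\<lambda>m. ract M m a)"
  by (rule additive_mapI) (simp_all add: right_moduleD)

lemma additive_lact: "left_module M \<Longrightarrow> additive_map M M (lact M a)"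
  by (rule additive_mapI) (simp_all add: left_moduleD)

lemma rmod_homD:
  assumes "rmod_hom M N f"
  shows "additive_map M N f" "m \<in> carrier M \<Longrightarrow> f (ract M m a) = ract N (f m) a"
    "m \<in> carrier M \<Longrightarrow> f m \<in> carrier N"
    "m \<in> carrier M \<Longrightarrow> n \<in> carrier M \<Longrightarrow> f (m \<oplus>\<^bsub>M\<^esub> n) = f m \<oplus>\<^bsub>N\<^esub> f n"
  using assms by (auto simp: rmod_hom_def additive_map_closed additive_map_add)

lemma bimod_homD:
  assumes "bimod_hom M N f"
  shows "rmod_hom M N f" "m \<in> carrier M \<Longrightarrow> f (lact M a m) = lact N a (f m)"
    "additive_map M N f" "m \<in> carrier M \<Longrightarrow> f (ract M m b) = ract N (f m) b"
    "m \<in> carrier M \<Longrightarrow> f m \<in> carrier N"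
    "m \<in> carrier M \<Longrightarrow> n \<in> carrier M \<Longrightarrow> f (m \<oplus>\<^bsub>M\<^esub> n) = f m \<oplus>\<^bsub>N\<^esub> f n"
  using assms by (auto simp: bimod_hom_def rmod_hom_def additive_map_closed additive_map_add)

section \<open>Tensor products\<close>

text \<open>The maps \<open>M \<times> N \<rightarrow> G\<close> that factor through \<open>M \<otimes>\<^sub>S N\<close>.\<close>

definition balanced ::
  "'s set \<Rightarrow> ('s,'m,'y) rmod_scheme \<Rightarrow> ('s,'t,'n,'z) bimod_scheme \<Rightarrow> ('g,'x) ring_scheme \<Rightarrow>
     ('m \<Rightarrow> 'n \<Rightarrow> 'g) \<Rightarrow> bool" where
  "balanced S M N G \<beta> \<longleftrightarrow>
     (\<forall>n\<in>carrier N. additive_map M G (\<lambda>m. \<beta> m n)) \<and>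
     (\<forall>m\<in>carrier M. additive_map N G (\<beta> m)) \<and>
     (\<forall>m\<in>carrier M. \<forall>n\<in>carrier N. \<forall>s\<in>S. \<beta> (ract M m s) n = \<beta> m (lact N s n))"

lemma balancedI:
  assumes "\<And>m n. m \<in> carrier M \<Longrightarrow> n \<in> carrier N \<Longrightarrow> \<beta> m n \<in> carrier G"
    and "\<And>m m' n. m \<in> carrier M \<Longrightarrow> m' \<in> carrier M \<Longrightarrow> n \<in> carrier N \<Longrightarrow>
           \<beta> (m \<oplus>\<^bsub>M\<^esub> m') n = \<beta> m n \<oplus>\<^bsub>G\<^esub> \<beta> m' n"
    and "\<And>m n n'. m \<in> carrier M \<Longrightarrow> n \<in> carrier N \<Longrightarrow> n' \<in> carrier N \<Longrightarrow>
           \<beta> m (n \<oplus>\<^bsub>N\<^esub> n') = \<beta> m n \<oplus>\<^bsub>G\<^esub> \<beta> m n'"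
    and "\<And>m n s. m \<in> carrier M \<Longrightarrow> n \<in> carrier N \<Longrightarrow> s \<in> S \<Longrightarrow> \<beta> (ract M m s) n = \<beta> m (lact N s n)"
  shows "balanced S M N G \<beta>"
  unfolding balanced_def using assms by (auto intro!: additive_mapI)

lemma balancedD:
  assumes "balanced S M N G \<beta>" "m \<in> carrier M" "n \<in> carrier N"
  shows "\<beta> m n \<in> carrier G"
    and "m' \<in> carrier M \<Longrightarrow> \<beta> (m \<oplus>\<^bsub>M\<^esub> m') n = \<beta> m n \<oplus>\<^bsub>G\<^esub> \<beta> m' n"
    and "n' \<in> carrier N \<Longrightarrow> \<beta> m (n \<oplus>\<^bsub>N\<^esub> n') = \<beta> m n \<oplus>\<^bsub>G\<^esub> \<beta> m n'"
    and "s \<in> S \<Longrightarrow> \<beta> (ract M m s) n = \<beta> m (lact N s n)"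
proof -
  have "additive_map M G (\<lambda>m. \<beta> m n)" "additive_map N G (\<beta> m)"
    using assms unfolding balanced_def by auto
  then show "\<beta> m n \<in> carrier G"
    and "m' \<in> carrier M \<Longrightarrow> \<beta> (m \<oplus>\<^bsub>M\<^esub> m') n = \<beta> m n \<oplus>\<^bsub>G\<^esub> \<beta> m' n"
    and "n' \<in> carrier N \<Longrightarrow> \<beta> m (n \<oplus>\<^bsub>N\<^esub> n') = \<beta> m n \<oplus>\<^bsub>G\<^esub> \<beta> m n'"
    using assms(2,3) additive_map_add[of M G "\<lambda>m. \<beta> m n" m m'] additive_map_closed[of N G "\<beta> m" n]
    by (auto simp: additive_map_add)
  show "s \<in> S \<Longrightarrow> \<beta> (ract M m s) n = \<beta> m (lact N s n)"
    using assms unfolding balanced_def by blast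
qed

locale tensor_pair =
  fixes S :: "'s set" and M :: "('s,'m,'y) rmod_scheme" and N :: "('s,'t,'n,'z) bimod_scheme"
  assumes abelian_left: "abelian_group M" and abelian_right: "abelian_group N"
    and ract_closed: "\<And>m s. m \<in> carrier M \<Longrightarrow> s \<in> S \<Longrightarrow> ract M m s \<in> carrier M"
    and lact_closed: "\<And>n s. n \<in> carrier N \<Longrightarrow> s \<in> S \<Longrightarrow> lact N s n \<in> carrier N"
begin

abbreviation "F \<equiv> free_Abelian_group (carrier M \<times> carrier N)"
abbreviation "H \<equiv> tensor_rels S M N"
abbreviation "T \<equiv> tensor_ab S M N"
abbreviation "pt \<equiv> pure_tensor S M N"

sublocale M: abelian_group M by (rule abelian_left)
sublocale N: abelian_group N by (rule abelian_right)
sublocale F: comm_group F by (rule abelian_free_Abelian_group)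

lemma keys_frag_diff3:
  "Poly_Mapping.keys (frag_of a - frag_of b - frag_of c) \<subseteq> {a, b, c}"
  using keys_diff[of "frag_of a - frag_of b" "frag_of c"] keys_diff[of "frag_of a" "frag_of b"] by auto

lemma subgroup_rels: "subgroup H F"
  unfolding tensor_rels_def
proof (rule F.generate_is_subgroup, intro Un_least subsetI; (elim CollectE exE conjE; hypsubst)?)
  fix m m' n assume "m \<in> carrier M" "m' \<in> carrier M" "n \<in> carrier N"
  then show "frag_of (m \<oplus>\<^bsub>M\<^esub> m', n) - frag_of (m, n) - frag_of (m', n) \<in> carrier F"
    using keys_frag_diff3[of "(m \<oplus>\<^bsub>M\<^esub> m', n)" "(m, n)" "(m', n)"] by auto
next
  fix m n n' assume "m \<in> carrier M" "n \<in> carrier N" "n' \<in> carrier N"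
  then show "frag_of (m, n \<oplus>\<^bsub>N\<^esub> n') - frag_of (m, n) - frag_of (m, n') \<in> carrier F"
    using keys_frag_diff3[of "(m, n \<oplus>\<^bsub>N\<^esub> n')" "(m, n)" "(m, n')"] by auto
next
  fix m s n assume "m \<in> carrier M" "s \<in> S" "n \<in> carrier N"
  then show "frag_of (ract M m s, n) - frag_of (m, lact N s n) \<in> carrier F"
    using keys_diff[of "frag_of (ract M m s, n)" "frag_of (m, lact N s n)"]
    by (auto simp: ract_closed lact_closed)
qed

lemma normal_rels: "H \<lhd> F"
  using F.subgroup_imp_normal subgroup_rels by blast

lemma comm_quot: "comm_group (F Mod H)"
  by (rule F.abelian_FactGroup[OF subgroup_rels])

lemma add_monoid_T: "add_monoid T = F Mod H"
  by (simp add: tensor_ab_def Let_def FactGroup_def)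

lemma abelian_tensor: "abelian_group T"
  by (rule comm_group_abelian_groupI) (simp only: add_monoid_T comm_quot)

sublocale T: abelian_group T by (rule abelian_tensor)

lemma carrier_T: "carrier T = carrier (F Mod H)"
  and add_T: "add T = mult (F Mod H)"
  by (simp_all add: tensor_ab_def Let_def)

lemma pure_closed [simp, intro]: "m \<in> carrier M \<Longrightarrow> n \<in> carrier N \<Longrightarrow> pt m n \<in> carrier T"
  unfolding carrier_T carrier_FactGroup pure_tensor_def by auto

lemma coset_eqI:
  assumes "a \<in> carrier F" "b \<in> carrier F" "a - b \<in> H"
  shows "H #>\<^bsub>F\<^esub> a = H #>\<^bsub>F\<^esub> b"
proof (rule F.repr_independence[OF _ assms(2) subgroup_rels, symmetric])
  have "a = (a - b) \<otimes>\<^bsub>F\<^esub> b" by simp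
  then show "a \<in> H #>\<^bsub>F\<^esub> b"
    unfolding r_coset_def using assms(3) by blast
qed

lemma coset_eqD:
  assumes "a \<in> carrier F" "b \<in> carrier F" "H #>\<^bsub>F\<^esub> a = H #>\<^bsub>F\<^esub> b"
  shows "a - b \<in> H"
proof -
  have "a \<in> H #>\<^bsub>F\<^esub> b"
    using F.rcos_self[OF assms(1) subgroup_rels] assms(3) by simp
  then show ?thesis unfolding r_coset_def by auto
qed

lemma coset_add:
  assumes "a \<in> carrier F" "b \<in> carrier F"
  shows "(H #>\<^bsub>F\<^esub> a) \<oplus>\<^bsub>T\<^esub> (H #>\<^bsub>F\<^esub> b) = H #>\<^bsub>F\<^esub> (a + b)"
  using normal.rcos_sum[OF normal_rels assms] by (simp add: add_T)

lemma frag_add_closed: "a \<in> carrier F \<Longrightarrow> b \<in> carrier F \<Longrightarrow> a + b \<in> carrier F"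
  using F.m_closed by simp

lemma frag_diff_closed: "a \<in> carrier F \<Longrightarrow> b \<in> carrier F \<Longrightarrow> a - b \<in> carrier F"
  using keys_diff[of a b] by auto

lemma pure_add_left:
  assumes "m \<in> carrier M" "m' \<in> carrier M" "n \<in> carrier N"
  shows "pt (m \<oplus>\<^bsub>M\<^esub> m') n = pt m n \<oplus>\<^bsub>T\<^esub> pt m' n"
proof -
  have "frag_of (m \<oplus>\<^bsub>M\<^esub> m', n) - frag_of (m, n) - frag_of (m', n) \<in> H"
    unfolding tensor_rels_def using assms by (intro generate.incl UnI1) blast
  then have "H #>\<^bsub>F\<^esub> frag_of (m \<oplus>\<^bsub>M\<^esub> m', n) = H #>\<^bsub>F\<^esub> (frag_of (m, n) + frag_of (m', n))"
    using assms by (intro coset_eqI frag_add_closed) (auto simp: algebra_simps)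
  then show ?thesis
    using assms by (simp add: pure_tensor_def coset_add)
qed

lemma pure_add_right:
  assumes "m \<in> carrier M" "n \<in> carrier N" "n' \<in> carrier N"
  shows "pt m (n \<oplus>\<^bsub>N\<^esub> n') = pt m n \<oplus>\<^bsub>T\<^esub> pt m n'"
proof -
  have "frag_of (m, n \<oplus>\<^bsub>N\<^esub> n') - frag_of (m, n) - frag_of (m, n') \<in> H"
    unfolding tensor_rels_def using assms by (intro generate.incl UnI1[OF UnI2]) blast
  then have "H #>\<^bsub>F\<^esub> frag_of (m, n \<oplus>\<^bsub>N\<^esub> n') = H #>\<^bsub>F\<^esub> (frag_of (m, n) + frag_of (m, n'))"
    using assms by (intro coset_eqI frag_add_closed) (auto simp: algebra_simps)
  then show ?thesis
    using assms by (simp add: pure_tensor_def coset_add)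
qed

lemma pure_balanced:
  assumes "m \<in> carrier M" "n \<in> carrier N" "s \<in> S"
  shows "pt (ract M m s) n = pt m (lact N s n)"
proof -
  have "frag_of (ract M m s, n) - frag_of (m, lact N s n) \<in> H"
    unfolding tensor_rels_def using assms by (intro generate.incl UnI2) blast
  then show ?thesis
    unfolding pure_tensor_def using assms
    by (intro coset_eqI) (auto simp: ract_closed lact_closed)
qed

lemma balanced_pure: "balanced S M N T pt"
  by (rule balancedI) (simp_all add: pure_add_left pure_add_right pure_balanced)

lemma additive_pure_left: "n \<in> carrier N \<Longrightarrow> additive_map M T (\<lambda>m. pt m n)"
  and additive_pure_right: "m \<in> carrier M \<Longrightarrow> additive_map N T (pt m)"
  using balanced_pure unfolding balanced_def by auto

text \<open>The map \<open>frag_of (m, n) \<mapsto> \<beta> m n\<close> on the free group kills the three kinds of generators of the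
  relations because \<open>\<beta>\<close> is additive in each argument and balanced.\<close>

lemma exists_lift:
  assumes G: "abelian_group G" and \<beta>: "balanced S M N G \<beta>"
  shows "\<exists>h. additive_map T G h \<and> (\<forall>m\<in>carrier M. \<forall>n\<in>carrier N. h (pt m n) = \<beta> m n)"
proof -
  interpret G: abelian_group G by fact
  have "(\<lambda>(m, n). \<beta> m n) ` (carrier M \<times> carrier N) \<subseteq> carrier (add_monoid G)"
    using balancedD(1)[OF \<beta>] by auto
  then obtain h where h: "h \<in> hom F (add_monoid G)"
    and h_frag: "\<And>x. x \<in> carrier M \<times> carrier N \<Longrightarrow> h (frag_of x) = (case x of (m, n) \<Rightarrow> \<beta> m n)"
    using comm_group.free_Abelian_group_universal[OF G.a_comm_group] by blast
  interpret h: group_hom F "add_monoid G" h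
    using h by (simp add: group_hom_def group_hom_axioms_def G.a_group F.is_group)
  have h_diff: "h (a - b) = h a \<ominus>\<^bsub>G\<^esub> h b" if "a \<in> carrier F" "b \<in> carrier F" for a b
  proof -
    have "h a = h ((a - b) \<otimes>\<^bsub>F\<^esub> b)" by simp
    moreover have ab: "a - b \<in> carrier F" using that keys_diff[of a b] by auto
    ultimately have "h a = h (a - b) \<oplus>\<^bsub>G\<^esub> h b" using that(2) h.hom_mult[of "a - b" b] by simp
    then show ?thesis
      using ab that h.hom_closed by (simp add: a_minus_def G.a_assoc G.r_neg)
  qed
  have "H \<subseteq> kernel F (add_monoid G) h"
    unfolding tensor_rels_def
  proof (rule F.generate_subgroup_incl[OF _ h.subgroup_kernel], intro Un_least subsetI;
         (elim CollectE exE conjE; hypsubst)?)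
    fix m m' n assume mn: "m \<in> carrier M" "m' \<in> carrier M" "n \<in> carrier N"
    then show "frag_of (m \<oplus>\<^bsub>M\<^esub> m', n) - frag_of (m, n) - frag_of (m', n) \<in> kernel F (add_monoid G) h"
      by (simp add: kernel_def h_diff frag_diff_closed h_frag balancedD[OF \<beta>] a_minus_def G.minus_add G.a_ac
          G.r_neg G.r_neg1 del: carrier_free_Abelian_group_iff)
  next
    fix m n n' assume mn: "m \<in> carrier M" "n \<in> carrier N" "n' \<in> carrier N"
    then show "frag_of (m, n \<oplus>\<^bsub>N\<^esub> n') - frag_of (m, n) - frag_of (m, n') \<in> kernel F (add_monoid G) h"
      by (simp add: kernel_def h_diff frag_diff_closed h_frag balancedD[OF \<beta>] a_minus_def G.minus_add G.a_ac
          G.r_neg G.r_neg1 del: carrier_free_Abelian_group_iff)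
  next
    fix m s n assume mn: "m \<in> carrier M" "s \<in> S" "n \<in> carrier N"
    then show "frag_of (ract M m s, n) - frag_of (m, lact N s n) \<in> kernel F (add_monoid G) h"
      by (simp add: kernel_def h_diff frag_diff_closed h_frag balancedD[OF \<beta>] a_minus_def
          G.r_neg ract_closed lact_closed del: carrier_free_Abelian_group_iff)
  qed
  then have "h a = h b" if "a \<in> carrier F" "b \<in> carrier F" "H #>\<^bsub>F\<^esub> a = H #>\<^bsub>F\<^esub> b" for a b
  proof -
    have "h (a - b) = \<zero>\<^bsub>G\<^esub>" using coset_eqD[OF that] \<open>H \<subseteq> _\<close> by (auto simp: kernel_def)
    then show ?thesis
      using h.hom_mult[of "a - b" b] frag_diff_closed[OF that(1,2)] that(2) h.hom_closed[OF that(2)] by simp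
  qed
  then obtain g where g: "g \<in> hom (F Mod H) (add_monoid G)"
    and g_coset: "\<And>x. x \<in> carrier F \<Longrightarrow> g (H #>\<^bsub>F\<^esub> x) = h x"
    using FactGroup_universal[OF h normal_rels] by metis
  have "additive_map T G g" using g unfolding additive_map_def add_monoid_T .
  moreover have "\<forall>m\<in>carrier M. \<forall>n\<in>carrier N. g (pt m n) = \<beta> m n"
    using g_coset h_frag by (auto simp: pure_tensor_def)
  ultimately show ?thesis by blast
qed

lemma
  assumes "abelian_group G" "balanced S M N G \<beta>"
  shows additive_lift: "additive_map T G (tensor_lift S M N G \<beta>)"
    and lift_pure [simp]: "m \<in> carrier M \<Longrightarrow> n \<in> carrier N \<Longrightarrow> tensor_lift S M N G \<beta> (pt m n) = \<beta> m n"
  using someI_ex[OF exists_lift[OF assms]] unfolding tensor_lift_def by auto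

text \<open>Since \<open>- (m \<otimes> n) = (- m) \<otimes> n\<close>, sums of pure tensors already form a subgroup.\<close>

lemma tensor_induct [consumes 1, case_names pure add]:
  assumes X: "X \<in> carrier T"
    and pure: "\<And>m n. m \<in> carrier M \<Longrightarrow> n \<in> carrier N \<Longrightarrow> P (pt m n)"
    and add: "\<And>X Y. X \<in> carrier T \<Longrightarrow> Y \<in> carrier T \<Longrightarrow> P X \<Longrightarrow> P Y \<Longrightarrow> P (X \<oplus>\<^bsub>T\<^esub> Y)"
  shows "P X"
proof -
  obtain c where c: "Poly_Mapping.keys c \<subseteq> carrier M \<times> carrier N" "X = H #>\<^bsub>F\<^esub> c"
    using X by (auto simp: carrier_T carrier_FactGroup)
  have zero: "P \<zero>\<^bsub>T\<^esub>"
    using pure[of "\<zero>\<^bsub>M\<^esub>" "\<zero>\<^bsub>N\<^esub>"] additive_map_zero[OF M.abelian_group_axioms T.abelian_group_axioms additive_pure_left]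
    by auto
  \<comment> \<open>\<open>P\<close> must be carried along with its value at the negative, as the free group is generated by
    subtraction.\<close>
  have "P (H #>\<^bsub>F\<^esub> c) \<and> P (H #>\<^bsub>F\<^esub> (- c))"
  proof (rule free_Abelian_group_induct[OF c(1)])
    have "H #>\<^bsub>F\<^esub> 0 = \<zero>\<^bsub>T\<^esub>"
      using F.coset_mult_one subgroup.subset[OF subgroup_rels] by (simp add: tensor_ab_def Let_def FactGroup_def)
    then show "P (H #>\<^bsub>F\<^esub> 0) \<and> P (H #>\<^bsub>F\<^esub> (- 0))" using zero by simp
  next
    fix x y assume 2: "Poly_Mapping.keys x \<subseteq> carrier M \<times> carrier N" "Poly_Mapping.keys y \<subseteq> carrier M \<times> carrier N"
      "P (H #>\<^bsub>F\<^esub> x) \<and> P (H #>\<^bsub>F\<^esub> (- x))" "P (H #>\<^bsub>F\<^esub> y) \<and> P (H #>\<^bsub>F\<^esub> (- y))"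
    have *: "x \<in> carrier F" "y \<in> carrier F" "- x \<in> carrier F" "- y \<in> carrier F"
      using 2 by auto
    have "P ((H #>\<^bsub>F\<^esub> x) \<oplus>\<^bsub>T\<^esub> (H #>\<^bsub>F\<^esub> (- y)))" "P ((H #>\<^bsub>F\<^esub> y) \<oplus>\<^bsub>T\<^esub> (H #>\<^bsub>F\<^esub> (- x)))"
      using 2 * by (auto intro!: add simp: carrier_T carrier_FactGroup)
    then show "P (H #>\<^bsub>F\<^esub> (x - y)) \<and> P (H #>\<^bsub>F\<^esub> (- (x - y)))" using * by (simp only: coset_add) simp
  next
    fix a assume 3: "a \<in> carrier M \<times> carrier N"
    then obtain m n where a: "a = (m, n)" "m \<in> carrier M" "n \<in> carrier N" by auto
    have "H #>\<^bsub>F\<^esub> (- frag_of a) = \<ominus>\<^bsub>T\<^esub> pt m n"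
    proof (rule T.minus_equality[symmetric])
      have "- frag_of a \<in> carrier F" using 3 by simp
      then show "(H #>\<^bsub>F\<^esub> (- frag_of a)) \<oplus>\<^bsub>T\<^esub> pt m n = \<zero>\<^bsub>T\<^esub>"
        using F.coset_mult_one subgroup.subset[OF subgroup_rels] 3 a
        by (simp add: pure_tensor_def coset_add) (simp add: tensor_ab_def Let_def FactGroup_def)
    next
      show "pt m n \<in> carrier T" using a by simp
      show "H #>\<^bsub>F\<^esub> (- frag_of a) \<in> carrier T"
        using 3 by (auto simp: carrier_T carrier_FactGroup)
    qed
    also have "\<dots> = pt (\<ominus>\<^bsub>M\<^esub> m) n"
      using additive_map_minus[OF M.abelian_group_axioms T.abelian_group_axioms additive_pure_left] a by simp
    finally show "P (H #>\<^bsub>F\<^esub> frag_of a) \<and> P (H #>\<^bsub>F\<^esub> (- frag_of a))"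
      using pure a by (auto simp flip: pure_tensor_def)
  qed
  then show ?thesis using c by simp
qed

lemma tensor_ext:
  assumes "additive_map T G h" "additive_map T G h'"
    and "\<And>m n. m \<in> carrier M \<Longrightarrow> n \<in> carrier N \<Longrightarrow> h (pt m n) = h' (pt m n)"
    and "X \<in> carrier T"
  shows "h X = h' X"
  using assms(4) by (induction rule: tensor_induct) (simp_all add: assms(3) additive_map_add[OF assms(1)] additive_map_add[OF assms(2)])

end

lemma tensor_r_simps [simp]:
  "carrier (tensor_r S M N) = carrier (tensor_ab S M N)"
  "zero (tensor_r S M N) = zero (tensor_ab S M N)"
  "add (tensor_r S M N) = add (tensor_ab S M N)"
  by (simp_all add: tensor_r_def ring.extend_def rmod.fields_def)

lemma ract_tensor_r:
  "ract (tensor_r S M N) X b =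
     tensor_lift S M N (tensor_ab S M N) (\<lambda>m n. pure_tensor S M N m (ract N n b)) X"
  by (simp add: tensor_r_def ring.extend_def rmod.fields_def)

lemma tensor_simps [simp]:
  "carrier (tensor S M N) = carrier (tensor_ab S M N)"
  "zero (tensor S M N) = zero (tensor_ab S M N)"
  "add (tensor S M N) = add (tensor_ab S M N)"
  by (simp_all add: tensor_def rmod.extend_def bimod.fields_def)

lemma ract_tensor: "ract (tensor S M N) X b = ract (tensor_r S M N) X b"
  by (simp add: tensor_def rmod.extend_def bimod.fields_def)

lemma lact_tensor:
  "lact (tensor S M N) a X =
     tensor_lift S M N (tensor_ab S M N) (\<lambda>m n. pure_tensor S M N (lact M a m) n) X"
  by (simp add: tensor_def rmod.extend_def bimod.fields_def)

lemma finsum_cong_structure: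
  assumes "carrier M = carrier N" "add M = add N" "zero M = zero N"
  shows "finsum M f I = finsum N f I"
  unfolding finsum_def finprod_def using assms by simp

lemma abelian_group_from_comm_group:
  assumes "comm_group G" "carrier M = carrier G" "add M = mult G" "zero M = one G"
  shows "abelian_group M"
proof -
  interpret G: comm_group G by fact
  show ?thesis
    by (rule abelian_groupI) (simp_all add: assms(2-4) G.m_assoc G.l_inv_ex, simp_all add: G.m_comm)
qed

lemma abelian_group_cong:
  assumes "abelian_group M" "carrier N = carrier M" "add N = add M" "zero N = zero M"
  shows "abelian_group N"
  by (rule abelian_group_from_comm_group[OF abelian_group.a_comm_group[OF assms(1)]]) (simp_all add: assms)

lemma additive_map_cong_structure:
  assumes "carrier M = carrier M'" "add M = add M'" "carrier N = carrier N'" "add N = add N'"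
  shows "additive_map M N f \<longleftrightarrow> additive_map M' N' f"
  unfolding additive_map_def hom_def using assms by simp

lemma additive_map_tensor_iff [simp]:
  "additive_map (tensor S M N) G h \<longleftrightarrow> additive_map (tensor_ab S M N) G h"
  "additive_map G (tensor S M N) h' \<longleftrightarrow> additive_map G (tensor_ab S M N) h'"
  "additive_map (tensor_r S' M' N') G g \<longleftrightarrow> additive_map (tensor_ab S' M' N') G g"
  "additive_map G (tensor_r S' M' N') g' \<longleftrightarrow> additive_map G (tensor_ab S' M' N') g'"
  by (rule additive_map_cong_structure; simp)+

text \<open>A tensor product sees only part of the two records. This identifies the tensor products of a coring, of its
  underlying bimodule, and of comodules with the same underlying module.\<close>

lemma tensor_rels_cong:
  assumes "carrier M = carrier M'" "add M = add M'" "ract M = ract M'"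
    and "carrier N = carrier N'" "add N = add N'" "lact N = lact N'"
  shows "tensor_rels S M N = tensor_rels S M' N'"
  unfolding tensor_rels_def using assms by simp

lemma tensor_ab_cong:
  assumes "carrier M = carrier M'" "add M = add M'" "ract M = ract M'"
    and "carrier N = carrier N'" "add N = add N'" "lact N = lact N'"
  shows "tensor_ab S M N = tensor_ab S M' N'" "pure_tensor S M N = pure_tensor S M' N'"
    "tensor_lift S M N = tensor_lift S M' N'"
  unfolding tensor_ab_def pure_tensor_def tensor_lift_def fun_eq_iff
  using assms tensor_rels_cong[OF assms] by (simp_all add: tensor_ab_def pure_tensor_def)

context tensor_pair
begin

lemma pure_finsum_left:
  "finite I \<Longrightarrow> (\<And>i. i \<in> I \<Longrightarrow> f i \<in> carrier M) \<Longrightarrow> n \<in> carrier N \<Longrightarrow>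
    pt (finsum M f I) n = finsum T (\<lambda>i. pt (f i) n) I"
  by (rule additive_map_finsum[OF abelian_left abelian_tensor additive_pure_left])

lemma pure_finsum_right:
  "finite I \<Longrightarrow> (\<And>i. i \<in> I \<Longrightarrow> f i \<in> carrier N) \<Longrightarrow> m \<in> carrier M \<Longrightarrow>
    pt m (finsum N f I) = finsum T (\<lambda>i. pt m (f i)) I"
  by (rule additive_map_finsum[OF abelian_right abelian_tensor additive_pure_right])

lemma lift_finsum:
  "abelian_group G \<Longrightarrow> balanced S M N G \<beta> \<Longrightarrow> finite I \<Longrightarrow> (\<And>i. i \<in> I \<Longrightarrow> X i \<in> carrier T) \<Longrightarrow>
    tensor_lift S M N G \<beta> (finsum T X I) = finsum G (\<lambda>i. tensor_lift S M N G \<beta> (X i)) I"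
  by (rule additive_map_finsum[OF abelian_tensor _ additive_lift])

end

locale tensor_right = tensor_pair S M N
  for S :: "'s set" and M :: "('s,'m,'y) rmod_scheme" and N :: "('s,'t::{ring,monoid_mult},'n,'z) bimod_scheme" +
  assumes right_module_right: "right_module N"
    and right_commute: "\<And>n s b. n \<in> carrier N \<Longrightarrow> s \<in> S \<Longrightarrow> ract N (lact N s n) b = lact N s (ract N n b)"
begin

lemma balanced_ract: "balanced S M N T (\<lambda>m n. pt m (ract N n b))"
  by (rule balancedI)
    (simp_all add: right_moduleD[OF right_module_right] pure_add_left pure_add_right pure_balanced
      right_commute)

abbreviation "RT \<equiv> tensor_r S M N"

lemma ract_pure [simp]: "m \<in> carrier M \<Longrightarrow> n \<in> carrier N \<Longrightarrow> ract RT (pt m n) b = pt m (ract N n b)"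
  by (simp add: ract_tensor_r abelian_tensor balanced_ract)

lemma additive_ract_tensor: "additive_map T T (\<lambda>X. ract RT X b)"
  by (simp add: ract_tensor_r additive_lift abelian_tensor balanced_ract)

lemmas ract_tensor_closed = additive_map_closed[OF additive_ract_tensor]
lemmas ract_tensor_add = additive_map_add[OF additive_ract_tensor]

lemma right_module_tensor_r: "right_module RT"
  unfolding right_module_def
proof (intro conjI ballI allI)
  show "abelian_group RT"
    by (rule abelian_group_cong[OF abelian_tensor]) simp_all
next
  fix X a b assume X: "X \<in> carrier RT"
  show "ract RT X (a + b) = ract RT X a \<oplus>\<^bsub>RT\<^esub> ract RT X b"
    using X[simplified]
    by (induction rule: tensor_induct)
      (simp_all add: right_moduleD[OF right_module_right] pure_add_right ract_tensor_add ract_tensor_closed T.a_ac)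
  show "ract RT X (a * b) = ract RT (ract RT X a) b"
    using X[simplified]
    by (induction rule: tensor_induct)
      (simp_all add: right_moduleD[OF right_module_right] ract_tensor_add ract_tensor_closed)
  show "ract RT X 1 = X"
    using X[simplified]
    by (induction rule: tensor_induct)
      (simp_all add: right_moduleD[OF right_module_right] ract_tensor_add ract_tensor_closed)
qed (use ract_tensor_add ract_tensor_closed in \<open>simp_all\<close>)

end

locale tensor_both = tensor_right S M N
  for S :: "'s set" and M :: "('q::{ring,monoid_mult},'s,'m,'y) bimod_scheme" and N :: "('s,'t::{ring,monoid_mult},'n,'z) bimod_scheme" +
  assumes left_module_left: "left_module M"
    and left_commute: "\<And>m s a. m \<in> carrier M \<Longrightarrow> s \<in> S \<Longrightarrow> lact M a (ract M m s) = ract M (lact M a m) s"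
begin

lemma balanced_lact: "balanced S M N T (\<lambda>m n. pt (lact M a m) n)"
  by (rule balancedI)
    (simp_all add: left_moduleD[OF left_module_left] pure_add_left pure_add_right pure_balanced left_commute)

abbreviation "BT \<equiv> tensor S M N"

lemma lact_pure [simp]: "m \<in> carrier M \<Longrightarrow> n \<in> carrier N \<Longrightarrow> lact BT a (pt m n) = pt (lact M a m) n"
  by (simp add: lact_tensor abelian_tensor balanced_lact)

lemma additive_lact_tensor: "additive_map T T (lact BT a)"
proof -
  have "lact BT a = tensor_lift S M N T (\<lambda>m n. pt (lact M a m) n)"
    by (rule ext) (rule lact_tensor)
  then show ?thesis by (simp add: additive_lift abelian_tensor balanced_lact)
qed

lemmas lact_tensor_closed = additive_map_closed[OF additive_lact_tensor]
lemmas lact_tensor_add = additive_map_add[OF additive_lact_tensor]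

lemma two_sided_module_tensor: "two_sided_module BT"
  unfolding two_sided_module_def left_module_def
proof (intro conjI ballI allI)
  show "right_module BT"
    using right_module_tensor_r abelian_group_cong[of RT BT]
    unfolding right_module_def by (simp add: ract_tensor)
  show "abelian_group BT"
    by (rule abelian_group_cong[OF abelian_tensor]) simp_all
next
  fix X a b assume X: "X \<in> carrier BT"
  show "lact BT (a + b) X = lact BT a X \<oplus>\<^bsub>BT\<^esub> lact BT b X"
    using X[simplified]
    by (induction rule: tensor_induct)
      (simp_all add: left_moduleD[OF left_module_left] pure_add_left lact_tensor_add lact_tensor_closed T.a_ac)
  show "lact BT (a * b) X = lact BT a (lact BT b X)"
    using X[simplified]
    by (induction rule: tensor_induct)
      (simp_all add: left_moduleD[OF left_module_left] lact_tensor_add lact_tensor_closed)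
  show "lact BT 1 X = X"
    using X[simplified]
    by (induction rule: tensor_induct)
      (simp_all add: left_moduleD[OF left_module_left] lact_tensor_add lact_tensor_closed)
  show "ract BT (lact BT a X) b' = lact BT a (ract BT X b')" for b'
    by (rule tensor_ext[OF _ _ _ X[simplified], where G = T])
      (auto simp: ract_tensor left_moduleD[OF left_module_left] right_moduleD[OF right_module_right]
        intro!: additive_map_comp[OF additive_lact_tensor additive_ract_tensor]
        additive_map_comp[OF additive_ract_tensor additive_lact_tensor])
qed (use lact_tensor_add lact_tensor_closed in \<open>simp_all\<close>)

end

lemma two_sided_abelian: "two_sided_module M \<Longrightarrow> abelian_group M"
  by (simp add: two_sided_moduleD right_moduleD)

lemma tensor_pair_UNIV: "right_module M \<Longrightarrow> left_module N \<Longrightarrow> tensor_pair UNIV M N"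
  by (rule tensor_pair.intro) (auto simp: right_moduleD left_moduleD)

lemma tensor_right_UNIV: "right_module M \<Longrightarrow> two_sided_module N \<Longrightarrow> tensor_right UNIV M N"
  by (intro tensor_right.intro tensor_pair_UNIV tensor_right_axioms.intro) (auto simp: two_sided_moduleD)

lemma tensor_both_UNIV: "two_sided_module M \<Longrightarrow> two_sided_module N \<Longrightarrow> tensor_both UNIV M N"
  by (intro tensor_both.intro tensor_right_UNIV tensor_both_axioms.intro) (auto simp: two_sided_moduleD)

section \<open>Direct sums and quotients\<close>

lemma bimod_sum_simps:
  "zero (bimod_sum I M) = (\<lambda>i\<in>I. \<zero>\<^bsub>M i\<^esub>)"
  "add (bimod_sum I M) = (\<lambda>x y. \<lambda>i\<in>I. x i \<oplus>\<^bsub>M i\<^esub> y i)"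
  "ract (bimod_sum I M) x b = (\<lambda>i\<in>I. ract (M i) (x i) b)"
  "lact (bimod_sum I M) a x = (\<lambda>i\<in>I. lact (M i) a (x i))"
  by (simp_all add: bimod_sum_def Let_def)

locale bimod_family =
  fixes I :: "'o set" and M :: "'o \<Rightarrow> ('s::{ring,monoid_mult},'t::{ring,monoid_mult},'m) bimod"
  assumes two_sided: "\<And>i. i \<in> I \<Longrightarrow> two_sided_module (M i)"
begin

abbreviation "D \<equiv> bimod_sum I M"
abbreviation "inc \<equiv> bimod_inj I M"

lemma right: "i \<in> I \<Longrightarrow> right_module (M i)" and left: "i \<in> I \<Longrightarrow> left_module (M i)"
  using two_sided two_sided_moduleD by auto

lemma abelian: "i \<in> I \<Longrightarrow> abelian_group (M i)"
  using right right_moduleD by auto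

lemma group: "i \<in> I \<Longrightarrow> group (add_monoid (M i))"
  using abelian abelian_group.a_group by auto

lemma carrier_sum:
  "carrier D = {x \<in> \<Pi>\<^sub>E i\<in>I. carrier (M i). finite {i \<in> I. x i \<noteq> \<zero>\<^bsub>M i\<^esub>}}"
proof -
  have "carrier D = carrier (sum_group I (\<lambda>i. add_monoid (M i)))"
    by (simp add: bimod_sum_def Let_def)
  then show ?thesis by (simp add: carrier_sum_group group)
qed

lemma sum_memD: "x \<in> carrier D \<Longrightarrow> i \<in> I \<Longrightarrow> x i \<in> carrier (M i)"
  by (auto simp: carrier_sum)

lemma abelian_sum: "abelian_group D"
proof (rule abelian_group_from_comm_group, rule group.group_comm_groupI)
  show "group (sum_group I (\<lambda>i. add_monoid (M i)))"
    by (simp add: group)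
  fix x y assume "x \<in> carrier (sum_group I (\<lambda>i. add_monoid (M i)))" "y \<in> carrier (sum_group I (\<lambda>i. add_monoid (M i)))"
  then show "x \<otimes>\<^bsub>sum_group I (\<lambda>i. add_monoid (M i))\<^esub> y = y \<otimes>\<^bsub>sum_group I (\<lambda>i. add_monoid (M i))\<^esub> x"
    by (auto simp: carrier_sum_group group intro!: restrict_ext abelian_monoid.a_comm[OF abelian_group.axioms(1)[OF abelian]])
qed (simp_all add: bimod_sum_def Let_def)

sublocale D: abelian_group D by (rule abelian_sum)

lemma act_closed:
  assumes "x \<in> carrier D" "\<And>i. i \<in> I \<Longrightarrow> additive_map (M i) (M i) (f i)"
  shows "(\<lambda>i\<in>I. f i (x i)) \<in> carrier D"
proof -
  have "{i \<in> I. f i (x i) \<noteq> \<zero>\<^bsub>M i\<^esub>} \<subseteq> {i \<in> I. x i \<noteq> \<zero>\<^bsub>M i\<^esub>}"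
    using additive_map_zero[OF abelian abelian assms(2)] by auto
  then have "finite {i \<in> I. (\<lambda>i\<in>I. f i (x i)) i \<noteq> \<zero>\<^bsub>M i\<^esub>}"
    using assms(1) by (auto simp: carrier_sum elim: rev_finite_subset intro: finite_subset cong: conj_cong)
  then show ?thesis
    using assms additive_map_closed by (fastforce simp: carrier_sum PiE_iff)
qed

lemma two_sided_module_sum: "two_sided_module D"
proof -
  have "lact D a x \<in> carrier D" "ract D x b \<in> carrier D" if "x \<in> carrier D" for a b x
    unfolding bimod_sum_simps using that act_closed[of x "\<lambda>i. lact (M i) a"] act_closed[of x "\<lambda>i m. ract (M i) m b"]
    by (auto simp: additive_lact left additive_ract right)
  moreover have "(\<lambda>i\<in>I. lact (M i) 1 (x i)) = x" "(\<lambda>i\<in>I. ract (M i) (x i) 1) = x" if "x \<in> carrier D" for x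
    using that by (auto simp: fun_eq_iff carrier_sum PiE_iff extensional_def right_moduleD(6)[OF right] left_moduleD(6)[OF left])
  ultimately show ?thesis
    unfolding two_sided_module_def right_module_def left_module_def
    by (auto simp: abelian_sum bimod_sum_simps right_moduleD[OF right] left_moduleD[OF left] sum_memD
        two_sided_moduleD(3)[OF two_sided] intro!: restrict_ext)
qed

lemma inc_closed: "i \<in> I \<Longrightarrow> m \<in> carrier (M i) \<Longrightarrow> inc i m \<in> carrier D"
  by (auto simp: carrier_sum bimod_inj_def abelian_group.axioms(1)[OF abelian] abelian_monoid.zero_closed
      intro: finite_subset[of _ "{i}"] cong: conj_cong)

lemma additive_inc: "i \<in> I \<Longrightarrow> additive_map (M i) D (inc i)"
  by (rule additive_mapI)
    (auto simp: inc_closed, auto simp: bimod_sum_simps bimod_inj_def abelian_group.axioms(1)[OF abelian]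
      abelian_monoid.l_zero abelian_monoid.zero_closed intro!: restrict_ext)

lemma inc_act:
  assumes "i \<in> I" "m \<in> carrier (M i)"
  shows "lact D a (inc i m) = inc i (lact (M i) a m)" "ract D (inc i m) b = inc i (ract (M i) m b)"
  using additive_map_zero[OF abelian abelian additive_lact[OF left]]
    additive_map_zero[OF abelian abelian additive_ract[OF right]]
  by (auto simp: bimod_sum_simps bimod_inj_def intro!: restrict_ext)

text \<open>An element is the sum of its finitely many components. The zero element has a case of its own, as \<open>I\<close> may
  be empty.\<close>

lemma sum_induct [consumes 1, case_names zero inc add]:
  assumes x: "x \<in> carrier D" and zero: "P \<zero>\<^bsub>D\<^esub>"
    and inc: "\<And>i m. i \<in> I \<Longrightarrow> m \<in> carrier (M i) \<Longrightarrow> P (inc i m)"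
    and add: "\<And>x y. x \<in> carrier D \<Longrightarrow> y \<in> carrier D \<Longrightarrow> P x \<Longrightarrow> P y \<Longrightarrow> P (x \<oplus>\<^bsub>D\<^esub> y)"
  shows "P x"
proof -
  have "P x" if "finite J" "x \<in> carrier D" "{i \<in> I. x i \<noteq> \<zero>\<^bsub>M i\<^esub>} \<subseteq> J" for J x
    using that
  proof (induction J arbitrary: x rule: finite_induct)
    case empty
    then have "x = \<zero>\<^bsub>D\<^esub>"
      by (auto simp: carrier_sum bimod_sum_simps PiE_def extensional_def fun_eq_iff)
    then show ?case using zero by simp
  next
    case (insert j J)
    show ?case
    proof (cases "j \<in> I")
      case False
      then have "{i \<in> I. x i \<noteq> \<zero>\<^bsub>M i\<^esub>} \<subseteq> J" using insert.prems by auto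
      then show ?thesis using insert by blast
    next
      case True
      interpret Mj: abelian_group "M j" using abelian True .
      define y where "y = x(j := \<zero>\<^bsub>M j\<^esub>)"
      have "{i \<in> I. y i \<noteq> \<zero>\<^bsub>M i\<^esub>} \<subseteq> {i \<in> I. x i \<noteq> \<zero>\<^bsub>M i\<^esub>}" "{i \<in> I. y i \<noteq> \<zero>\<^bsub>M i\<^esub>} \<subseteq> J"
        using insert.prems by (auto simp: y_def)
      moreover have y: "y \<in> carrier D"
      proof -
        have "finite {i \<in> I. y i \<noteq> \<zero>\<^bsub>M i\<^esub>}"
          using calculation insert.hyps(1) finite_subset by blast
        moreover have "y \<in> (\<Pi>\<^sub>E i\<in>I. carrier (M i))"
          using insert.prems(1) True by (auto simp: carrier_sum y_def PiE_iff extensional_def)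
        ultimately show ?thesis by (simp add: carrier_sum)
      qed
      ultimately have "P y" using insert.IH by blast
      have "x = inc j (x j) \<oplus>\<^bsub>D\<^esub> y"
        using insert.prems(1) True
        by (auto simp: fun_eq_iff bimod_sum_simps bimod_inj_def y_def carrier_sum PiE_iff extensional_def
            abelian_monoid.l_zero[OF abelian_group.axioms(1)[OF abelian]])
      then show ?thesis
        using add[of "inc j (x j)" y] inc[of j "x j"] inc_closed y \<open>P y\<close> True sum_memD[OF insert.prems(1)]
        by simp
    qed
  qed
  from this[OF _ x, of "{i \<in> I. x i \<noteq> \<zero>\<^bsub>M i\<^esub>}"] show ?thesis
    using x by (auto simp: carrier_sum)
qed

lemma sum_lift:
  assumes G: "abelian_group G" and f: "\<And>i. i \<in> I \<Longrightarrow> additive_map (M i) G (f i)"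
  shows "\<exists>h. additive_map D G h \<and> (\<forall>i\<in>I. \<forall>m\<in>carrier (M i). h (inc i m) = f i m)"
proof -
  interpret G: abelian_group G by fact
  define h where "h = (\<lambda>x. gfinprod (add_monoid G) (\<lambda>i. f i (x i)) I)"
  have "h \<in> hom (sum_group I (\<lambda>i. add_monoid (M i))) (add_monoid G)"
    unfolding h_def using f group
    by (intro comm_group.hom_group_sum[OF G.a_comm_group]) (auto simp: additive_map_def)
  then have "additive_map D G h"
    unfolding additive_map_def by (simp add: hom_def bimod_sum_def Let_def)
  moreover have "h (inc j m) = f j m" if "j \<in> I" "m \<in> carrier (M j)" for j m
  proof -
    have "h (inc j m) = gfinprod (add_monoid G) (\<lambda>i. if i = j then f j m else \<one>\<^bsub>add_monoid G\<^esub>) I"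
      unfolding h_def
    proof (rule comm_monoid.gfinprod_cong[OF G.a_comm_monoid refl])
      show "(\<lambda>i. f i (inc j m i)) \<in> I \<rightarrow> carrier (add_monoid G)"
        using that additive_map_closed[OF f] sum_memD[OF inc_closed[OF that]] by auto
    qed (auto simp: simp_implies_def bimod_inj_def additive_map_zero[OF abelian G f])
    also have "\<dots> = gfinprod (add_monoid G) (\<lambda>i. if i = j then f j m else \<one>\<^bsub>add_monoid G\<^esub>) {j}"
      using that f[OF that(1)]
      by (intro comm_monoid.gfinprod_mono_neutral_cong_right[OF G.a_comm_monoid]) (auto simp: additive_map_closed)
    also have "\<dots> = f j m"
      using that f[OF that(1)] additive_map_closed[of "M j" G "f j" m]
      by (simp add: comm_monoid.gfinprod_insert[OF G.a_comm_monoid] comm_monoid.gfinprod_eq_finprod[OF G.a_comm_monoid]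
          comm_monoid.finprod_insert[OF G.a_comm_monoid] comm_monoid.finprod_empty[OF G.a_comm_monoid]
          monoid.r_one[OF comm_monoid.axioms(1)[OF G.a_comm_monoid]])
    finally show ?thesis .
  qed
  ultimately show ?thesis by blast
qed

end

lemma subbimodule_carrier: "two_sided_module M \<Longrightarrow> subbimodule (carrier M) M"
proof -
  assume M: "two_sided_module M"
  interpret abelian_group M using M by (simp add: two_sided_moduleD right_moduleD)
  show ?thesis
    unfolding subbimodule_def using M two_sided_moduleD[OF M]
    by (auto simp: right_moduleD left_moduleD additive_subgroup_def add.subgroup_self)
qed

lemma subbimodule_generated:
  assumes M: "two_sided_module M" and X: "X \<subseteq> carrier M"
  shows "subbimodule (subbimodule_generated M X) M" "X \<subseteq> subbimodule_generated M X"
    "subbimodule J M \<Longrightarrow> X \<subseteq> J \<Longrightarrow> subbimodule_generated M X \<subseteq> J"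
proof -
  interpret abelian_group M using M by (simp add: two_sided_moduleD right_moduleD)
  let ?F = "{J. subbimodule J M \<and> X \<subseteq> J}"
  have "carrier M \<in> ?F" using subbimodule_carrier[OF M] X by simp
  then have "subgroup (\<Inter>?F) (add_monoid M)"
    by (intro add.subgroups_Inter) (auto simp: subbimodule_def additive_subgroup_def)
  then show "subbimodule (subbimodule_generated M X) M"
    unfolding subbimodule_def additive_subgroup_def subbimodule_generated_def by blast
qed (auto simp: subbimodule_generated_def)

locale bimod_ideal =
  fixes M :: "('s::{ring,monoid_mult},'t::{ring,monoid_mult},'m) bimod" and J
  assumes two_sided: "two_sided_module M" and subbimodule: "subbimodule J M"
begin

lemma right: "right_module M" and left: "left_module M"
  using two_sided two_sided_moduleD by auto

sublocale abelian_group M using right right_moduleD by auto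

abbreviation "Q \<equiv> bimod_quotient M J"
abbreviation "pr x \<equiv> J +>\<^bsub>M\<^esub> x"

sublocale J: abelian_subgroup J M
  using subbimodule by (intro abelian_subgroupI3) (auto simp: subbimodule_def abelian_group_axioms)

lemma quotient_simps:
  "carrier Q = a_rcosets\<^bsub>M\<^esub> J" "zero Q = J" "add Q = set_add M"
  "ract Q X b = (\<Union>x\<in>X. J +>\<^bsub>M\<^esub> ract M x b)" "lact Q a X = (\<Union>x\<in>X. J +>\<^bsub>M\<^esub> lact M a x)"
  by (simp_all add: bimod_quotient_def)

lemma abelian_quotient: "abelian_group Q"
  by (rule abelian_group_from_comm_group[OF J.a_factorgroup_is_comm_group])
    (simp_all add: quotient_simps A_FactGroup_def FactGroup_def A_RCOSETS_def set_add_def)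

sublocale Q: abelian_group Q by (rule abelian_quotient)

lemma quotient_cases: "X \<in> carrier Q \<Longrightarrow> \<exists>x\<in>carrier M. X = pr x"
  by (auto simp: quotient_simps A_RCOSETS_def' a_r_coset_def')

lemma additive_pr: "additive_map M Q pr"
  by (rule additive_mapI) (simp_all add: quotient_simps J.a_rcos_sum a_rcosetsI J.a_subset)

lemma pr_eqI: "x \<in> carrier M \<Longrightarrow> y \<in> carrier M \<Longrightarrow> x \<ominus>\<^bsub>M\<^esub> y \<in> J \<Longrightarrow> pr x = pr y"
proof -
  assume xy: "x \<in> carrier M" "y \<in> carrier M" "x \<ominus>\<^bsub>M\<^esub> y \<in> J"
  then have "x = (x \<ominus>\<^bsub>M\<^esub> y) \<oplus>\<^bsub>M\<^esub> y" by (simp add: a_minus_def a_assoc l_neg)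
  then have "x \<in> pr y" using xy(3) unfolding a_r_coset_def' by blast
  then show ?thesis using J.a_repr_independence' xy(2) by blast
qed

text \<open>The actions on a quotient are unions over all representatives; these unions have only one member when the
  action preserves the ideal.\<close>

lemma pr_act:
  assumes x: "x \<in> carrier M" and f: "additive_map M M f" and fJ: "\<And>j. j \<in> J \<Longrightarrow> f j \<in> J"
  shows "(\<Union>x'\<in>pr x. pr (f x')) = pr (f x)"
proof -
  have "pr (f x') = pr (f x)" if x': "x' \<in> pr x" for x'
  proof -
    obtain j where j: "j \<in> J" "x' = j \<oplus>\<^bsub>M\<^esub> x" using x' by (auto simp: a_r_coset_def')
    have "f x' = f j \<oplus>\<^bsub>M\<^esub> f x"
      using j x J.a_subset by (auto simp: additive_map_add[OF f])
    then have "f x' \<in> pr (f x)"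
      using fJ j by (auto simp: a_r_coset_def')
    then show ?thesis
      using additive_map_closed[OF f x] J.a_repr_independence' by blast
  qed
  moreover have "x \<in> pr x" using J.a_rcos_self x by simp
  ultimately show ?thesis by blast
qed

lemma pr_lact: "x \<in> carrier M \<Longrightarrow> lact Q a (pr x) = pr (lact M a x)"
  and pr_ract: "x \<in> carrier M \<Longrightarrow> ract Q (pr x) b = pr (ract M x b)"
  unfolding quotient_simps
  by (rule pr_act, simp_all add: additive_lact[OF left] additive_ract[OF right],
      use subbimodule in \<open>simp add: subbimodule_def\<close>)+

lemma two_sided_module_quotient: "two_sided_module Q"
proof -
  note [simp] = pr_lact pr_ract additive_map_add[OF additive_pr, symmetric]
    right_moduleD(2-)[OF right] left_moduleD(2-)[OF left] two_sided_moduleD(3)[OF two_sided]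
  have cl: "pr x \<in> carrier Q" if "x \<in> carrier M" for x
    using additive_map_closed[OF additive_pr that] .
  show ?thesis
    unfolding two_sided_module_def right_module_def left_module_def
    by (intro conjI ballI allI abelian_quotient; (drule quotient_cases)+; elim bexE; simp add: cl)
qed

lemma quotient_lift:
  assumes G: "abelian_group G" and h: "additive_map M G h" and hJ: "\<And>j. j \<in> J \<Longrightarrow> h j = \<zero>\<^bsub>G\<^esub>"
  shows "\<exists>h'. additive_map Q G h' \<and> (\<forall>x\<in>carrier M. h' (pr x) = h x)"
proof -
  interpret G: abelian_group G by fact
  have "h x = h y" if "x \<in> carrier M" "y \<in> carrier M" "pr x = pr y" for x y
  proof -
    have "x \<in> pr y" using J.a_rcos_self[OF that(1)] that(3) by simp
    then obtain j where j: "j \<in> J" "x = j \<oplus>\<^bsub>M\<^esub> y" by (auto simp: a_r_coset_def')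
    then show ?thesis
      using J.a_subset that hJ additive_map_closed[OF h] by (auto simp: additive_map_add[OF h])
  qed
  then obtain g where g: "\<And>x. x \<in> carrier M \<Longrightarrow> h x = g (pr x)"
    using function_factors_left_gen[of "\<lambda>x. x \<in> carrier M" pr h] by blast
  have "additive_map Q G g"
  proof (rule additive_mapI)
    fix X assume "X \<in> carrier Q"
    then obtain x where x: "x \<in> carrier M" "X = pr x" using quotient_cases by blast
    then show "g X \<in> carrier G" using g additive_map_closed[OF h] by metis
    fix Y assume "Y \<in> carrier Q"
    then obtain y where y: "y \<in> carrier M" "Y = pr y" using quotient_cases by blast
    have "X \<oplus>\<^bsub>Q\<^esub> Y = pr (x \<oplus>\<^bsub>M\<^esub> y)"
      using x y additive_map_add[OF additive_pr] by simp
    then show "g (X \<oplus>\<^bsub>Q\<^esub> Y) = g X \<oplus>\<^bsub>G\<^esub> g Y"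
      using x y by (simp flip: g add: additive_map_add[OF h])
  qed
  then show ?thesis using g by metis
qed

end

section \<open>The bimodule underlying the reconstructed coring\<close>

lemma dual_bimod_simps:
  "f \<in> carrier (dual_bimod P) \<longleftrightarrow> f \<in> extensional (carrier P) \<and> rmod_hom P regular_bimod f"
  "zero (dual_bimod P) = (\<lambda>p\<in>carrier P. 0)"
  "add (dual_bimod P) = (\<lambda>f g. \<lambda>p\<in>carrier P. f p + g p)"
  "ract (dual_bimod P) = (\<lambda>f t. \<lambda>p\<in>carrier P. f (t p))"
  "lact (dual_bimod P) = (\<lambda>a f. \<lambda>p\<in>carrier P. a * f p)"
  by (auto simp: dual_bimod_def)

lemma endo_bimod_simps [simp]:
  "carrier (endo_bimod P) = carrier P" "zero (endo_bimod P) = zero P" "add (endo_bimod P) = add P"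
  "ract (endo_bimod P) = ract P" "lact (endo_bimod P) t p = t p"
  by (simp_all add: endo_bimod_def rmod.extend_def bimod.fields_def)

lemma regular_bimod_simps [simp]:
  "carrier regular_bimod = UNIV" "zero regular_bimod = 0" "add regular_bimod = (+)"
  "ract regular_bimod = (*)" "lact regular_bimod = (*)"
  by (simp_all add: regular_bimod_def)

lemma abelian_regular: "abelian_group regular_bimod"
proof (rule abelian_groupI)
  fix x :: "'a :: {comm_ring,monoid_mult}"
  show "\<exists>y\<in>carrier regular_bimod. y \<oplus>\<^bsub>regular_bimod\<^esub> x = \<zero>\<^bsub>regular_bimod\<^esub>"
    by (rule bexI[of _ "- x"]) simp_all
qed (simp_all add: algebra_simps)

lemma two_sided_module_regular: "two_sided_module regular_bimod"
  unfolding two_sided_module_def left_module_def right_module_def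
  by (simp add: abelian_regular algebra_simps)

lemma dual_apply:
  assumes "f \<in> carrier (dual_bimod P)"
  shows "x \<in> carrier P \<Longrightarrow> y \<in> carrier P \<Longrightarrow> f (x \<oplus>\<^bsub>P\<^esub> y) = f x + f y"
    and "x \<in> carrier P \<Longrightarrow> f (ract P x a) = f x * a"
    and "x \<notin> carrier P \<Longrightarrow> f x = undefined"
    and "additive_map P regular_bimod f"
  using assms by (auto simp: dual_bimod_simps extensional_def dest: rmod_homD)

lemma dualI:
  assumes "f \<in> extensional (carrier P)"
    and "\<And>x y. x \<in> carrier P \<Longrightarrow> y \<in> carrier P \<Longrightarrow> f (x \<oplus>\<^bsub>P\<^esub> y) = f x + f y"
    and "\<And>x a. x \<in> carrier P \<Longrightarrow> f (ract P x a) = f x * a"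
  shows "f \<in> carrier (dual_bimod P)"
  using assms by (auto simp: dual_bimod_simps rmod_hom_def intro: additive_mapI)

lemma dual_precompose:
  assumes "right_module P" "rmod_hom P Q t" "f \<in> carrier (dual_bimod Q)"
  shows "(\<lambda>x\<in>carrier P. f (t x)) \<in> carrier (dual_bimod P)"
proof -
  interpret abelian_group P using assms(1) by (rule right_moduleD)
  show ?thesis
    by (rule dualI) (simp_all add: rmod_homD[OF assms(2)] dual_apply[OF assms(3)] right_moduleD[OF assms(1)])
qed

lemma dual_closed:
  assumes "right_module P" "f \<in> carrier (dual_bimod P)"
  shows "g \<in> carrier (dual_bimod P) \<Longrightarrow> f \<oplus>\<^bsub>dual_bimod P\<^esub> g \<in> carrier (dual_bimod P)"
    and "lact (dual_bimod P) a f \<in> carrier (dual_bimod P)"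
proof -
  interpret abelian_group P using assms(1) by (rule right_moduleD)
  show "g \<in> carrier (dual_bimod P) \<Longrightarrow> f \<oplus>\<^bsub>dual_bimod P\<^esub> g \<in> carrier (dual_bimod P)"
    using dual_apply[OF assms(2)] dual_apply[of g P] right_moduleD(2)[OF assms(1)]
    by (intro dualI) (simp_all add: dual_bimod_simps(3) algebra_simps)
  show "lact (dual_bimod P) a f \<in> carrier (dual_bimod P)"
    using dual_apply[OF assms(2)] right_moduleD(2)[OF assms(1)]
    by (intro dualI) (simp_all add: dual_bimod_simps(5) algebra_simps)
qed

lemma abelian_dual:
  assumes "right_module P" shows "abelian_group (dual_bimod P)"
proof -
  interpret P: abelian_group P using assms by (rule right_moduleD)
  show ?thesis
  proof (rule abelian_groupI)
    fix f assume f: "f \<in> carrier (dual_bimod P)"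
    show "\<exists>g\<in>carrier (dual_bimod P). g \<oplus>\<^bsub>dual_bimod P\<^esub> f = \<zero>\<^bsub>dual_bimod P\<^esub>"
    proof (rule bexI[of _ "lact (dual_bimod P) (- 1) f"])
      show "lact (dual_bimod P) (- 1) f \<oplus>\<^bsub>dual_bimod P\<^esub> f = \<zero>\<^bsub>dual_bimod P\<^esub>"
        by (auto simp: dual_bimod_simps(2-))
    qed (rule dual_closed[OF assms f])
    show "\<zero>\<^bsub>dual_bimod P\<^esub> \<oplus>\<^bsub>dual_bimod P\<^esub> f = f"
      using dual_apply(3)[OF f] by (auto simp: dual_bimod_simps(2-))
  next
    show "\<zero>\<^bsub>dual_bimod P\<^esub> \<in> carrier (dual_bimod P)"
      by (rule dualI) (simp_all add: dual_bimod_simps(2-) right_moduleD[OF assms])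
  qed (auto simp: dual_closed[OF assms], auto simp: dual_bimod_simps(3) algebra_simps)
qed

lemma left_module_dual:
  assumes "right_module P" shows "left_module (dual_bimod P)"
  unfolding left_module_def
  using abelian_dual[OF assms] dual_closed[OF assms] dual_apply(3)[symmetric]
  by (auto simp: dual_bimod_simps(3-) algebra_simps fun_eq_iff)

lemma right_module_endo:
  assumes "right_module P" shows "right_module (endo_bimod P)"
  using assms abelian_group_cong[of P "endo_bimod P"] by (simp add: right_module_def)

text \<open>What a family of maps \<open>P\<^sup>* \<times> P \<rightarrow> G\<close> has to satisfy in order to induce a bimodule map on
  \<open>\<R>(\<A>)\<close>.\<close>

definition natural_pairing ::
  "'o set \<Rightarrow> ('o \<Rightarrow> ('a::{comm_ring,monoid_mult},'m) rmod) \<Rightarrow> ('o \<Rightarrow> 'o \<Rightarrow> ('m \<Rightarrow> 'm) set) \<Rightarrow>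
     ('a,'a,'g,'z) bimod_scheme \<Rightarrow> ('o \<Rightarrow> ('m \<Rightarrow> 'a) \<Rightarrow> 'm \<Rightarrow> 'g) \<Rightarrow> bool" where
  "natural_pairing Ob U Hm G \<beta> \<longleftrightarrow>
     (\<forall>P\<in>Ob. \<forall>p'\<in>carrier (dual_bimod (U P)). rmod_hom (U P) G (\<beta> P p')) \<and>
     (\<forall>P\<in>Ob. \<forall>p\<in>carrier (U P). additive_map (dual_bimod (U P)) G (\<lambda>p'. \<beta> P p' p) \<and>
        (\<forall>p'\<in>carrier (dual_bimod (U P)). \<forall>a. \<beta> P (lact (dual_bimod (U P)) a p') p = lact G a (\<beta> P p' p))) \<and>
     (\<forall>P\<in>Ob. \<forall>Q\<in>Ob. \<forall>t\<in>Hm P Q. \<forall>p\<in>carrier (U P). \<forall>q'\<in>carrier (dual_bimod (U Q)).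
        \<beta> Q q' (t p) = \<beta> P (\<lambda>x\<in>carrier (U P). q' (t x)) p)"

locale module_category =
  fixes Ob :: "'o set" and U :: "'o \<Rightarrow> ('a::{comm_ring,monoid_mult},'m) rmod" and Hm :: "'o \<Rightarrow> 'o \<Rightarrow> ('m \<Rightarrow> 'm) set"
  assumes U_module: "\<And>P. P \<in> Ob \<Longrightarrow> right_module (U P)"
    and Hm_hom: "\<And>P Q t. P \<in> Ob \<Longrightarrow> Q \<in> Ob \<Longrightarrow> t \<in> Hm P Q \<Longrightarrow> rmod_hom (U P) (U Q) t"
begin

abbreviation "dl P \<equiv> dual_bimod (U P)"
abbreviation "cx P \<equiv> pure_tensor (Hm P P) (dl P) (endo_bimod (U P))"

text \<open>The two actions of \<open>A\<close> descend to \<open>P\<^sup>* \<otimes> P\<close> over the endomorphism ring because endomorphisms are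
  \<open>A\<close>-linear.\<close>

lemma tensor_both_comatrix: "P \<in> Ob \<Longrightarrow> tensor_both (Hm P P) (dl P) (endo_bimod (U P))"
proof (intro tensor_both.intro tensor_right.intro tensor_pair.intro tensor_right_axioms.intro tensor_both_axioms.intro)
  assume P: "P \<in> Ob"
  note module = U_module[OF P]
  show "abelian_group (dl P)" "left_module (dl P)" "right_module (endo_bimod (U P))" "abelian_group (endo_bimod (U P))"
    by (rule abelian_dual[OF module] left_module_dual[OF module] right_module_endo[OF module]
          right_moduleD(1)[OF right_module_endo[OF module]])+
  fix t assume t: "t \<in> Hm P P"
  note hom = Hm_hom[OF P P t]
  show "m \<in> carrier (dl P) \<Longrightarrow> ract (dl P) m t \<in> carrier (dl P)" for m
    using dual_precompose[OF module hom] by (simp add: dual_bimod_simps(4))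
  show "n \<in> carrier (endo_bimod (U P)) \<Longrightarrow> lact (endo_bimod (U P)) t n \<in> carrier (endo_bimod (U P))" for n
    using rmod_homD(3)[OF hom] by simp
  show "n \<in> carrier (endo_bimod (U P)) \<Longrightarrow>
      ract (endo_bimod (U P)) (lact (endo_bimod (U P)) t n) b = lact (endo_bimod (U P)) t (ract (endo_bimod (U P)) n b)" for n b
    using rmod_homD(2)[OF hom] by simp
  show "lact (dl P) a (ract (dl P) m t) = ract (dl P) (lact (dl P) a m) t" for a m
    using rmod_homD(3)[OF hom] by (auto simp: dual_bimod_simps(2-))
qed

lemma bimod_family_comatrix: "bimod_family Ob (comatrix U Hm)"
  by (rule bimod_family.intro) (simp add: comatrix_def tensor_both.two_sided_module_tensor[OF tensor_both_comatrix])

sublocale sum: bimod_family Ob "comatrix U Hm"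
  by (rule bimod_family_comatrix)

abbreviation "rt \<equiv> recon_tensor Ob U Hm"
abbreviation "RS \<equiv> recon_sum Ob U Hm"

lemma RS_eq: "RS = bimod_sum Ob (comatrix U Hm)"
  by (simp add: recon_sum_def)

lemma two_sided_RS: "two_sided_module RS"
  by (simp add: RS_eq sum.two_sided_module_sum)

lemma hom_closed:
  assumes "P \<in> Ob" "Q \<in> Ob" "t \<in> Hm P Q"
  shows "p \<in> carrier (U P) \<Longrightarrow> t p \<in> carrier (U Q)"
    and "q' \<in> carrier (dl Q) \<Longrightarrow> (\<lambda>x\<in>carrier (U P). q' (t x)) \<in> carrier (dl P)"
  using rmod_homD(3)[OF Hm_hom[OF assms]] dual_precompose[OF U_module[OF assms(1)] Hm_hom[OF assms]] by auto

lemma rt_closed: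
  assumes "P \<in> Ob" "p' \<in> carrier (dl P)" "p \<in> carrier (U P)"
  shows "cx P p' p \<in> carrier (comatrix U Hm P)" "rt P p' p \<in> carrier RS"
proof -
  interpret tensor_both "Hm P P" "dl P" "endo_bimod (U P)" by (rule tensor_both_comatrix) fact
  show "cx P p' p \<in> carrier (comatrix U Hm P)"
    using assms by (simp add: comatrix_def)
  then show "rt P p' p \<in> carrier RS"
    using assms by (simp add: recon_tensor_def RS_eq sum.inc_closed)
qed

definition ideal_gens where
  "ideal_gens = {rt Q q' (t p) \<ominus>\<^bsub>RS\<^esub> rt P (\<lambda>x\<in>carrier (U P). q' (t x)) p | P Q t p q'.
        P \<in> Ob \<and> Q \<in> Ob \<and> t \<in> Hm P Q \<and> p \<in> carrier (U P) \<and> q' \<in> carrier (dl Q)}"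

lemma abelian_RS: "abelian_group RS"
  by (rule two_sided_abelian[OF two_sided_RS])

lemma ideal_gens_subset: "ideal_gens \<subseteq> carrier RS"
proof -
  interpret RS: abelian_group RS by (rule abelian_RS)
  show ?thesis
  proof
    fix x assume "x \<in> ideal_gens"
    then obtain P Q t p q' where x: "x = rt Q q' (t p) \<ominus>\<^bsub>RS\<^esub> rt P (\<lambda>x\<in>carrier (U P). q' (t x)) p"
      and *: "P \<in> Ob" "Q \<in> Ob" "t \<in> Hm P Q" "p \<in> carrier (U P)" "q' \<in> carrier (dl Q)"
      unfolding ideal_gens_def by blast
    then show "x \<in> carrier RS"
      using hom_closed[OF *(1-3)] rt_closed(2) by simp
  qed
qed

lemma ideal_eq: "recon_ideal Ob U Hm = subbimodule_generated RS ideal_gens"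
  by (simp add: recon_ideal_def ideal_gens_def)

sublocale quot: bimod_ideal RS "recon_ideal Ob U Hm"
  by (rule bimod_ideal.intro) (simp_all add: two_sided_RS ideal_eq subbimodule_generated(1) ideal_gens_subset)

abbreviation "B \<equiv> recon_bimod Ob U Hm"
abbreviation "cl \<equiv> recon_class Ob U Hm"

lemma B_eq: "B = bimod_quotient RS (recon_ideal Ob U Hm)"
  by (simp add: recon_bimod_def)

lemma two_sided_B: "two_sided_module B"
  by (simp add: B_eq quot.two_sided_module_quotient)

lemma abelian_B: "abelian_group B"
  by (rule two_sided_abelian[OF two_sided_B])

lemma class_eq: "cl P p' p = quot.pr (rt P p' p)"
  by (simp add: recon_class_def)

lemma class_closed [simp]:
  "P \<in> Ob \<Longrightarrow> p' \<in> carrier (dl P) \<Longrightarrow> p \<in> carrier (U P) \<Longrightarrow> cl P p' p \<in> carrier B"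
  by (simp add: class_eq B_eq additive_map_closed[OF quot.additive_pr] rt_closed)

lemma additive_comatrix_pr: "P \<in> Ob \<Longrightarrow> additive_map (comatrix U Hm P) B (\<lambda>X. quot.pr (bimod_inj Ob (comatrix U Hm) P X))"
  unfolding B_eq RS_eq by (rule additive_map_comp[OF sum.additive_inc quot.additive_pr[unfolded RS_eq]])

lemma class_add_left:
  assumes "P \<in> Ob" "p' \<in> carrier (dl P)" "q' \<in> carrier (dl P)" "p \<in> carrier (U P)"
  shows "cl P (p' \<oplus>\<^bsub>dl P\<^esub> q') p = cl P p' p \<oplus>\<^bsub>B\<^esub> cl P q' p"
proof -
  interpret tensor_both "Hm P P" "dl P" "endo_bimod (U P)" by (rule tensor_both_comatrix) fact
  have "cx P (p' \<oplus>\<^bsub>dl P\<^esub> q') p = cx P p' p \<oplus>\<^bsub>comatrix U Hm P\<^esub> cx P q' p"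
    using pure_add_left assms by (simp add: comatrix_def)
  then show ?thesis
    unfolding class_eq recon_tensor_def
    using additive_map_add[OF additive_comatrix_pr[OF assms(1)]] rt_closed(1) assms by metis
qed

lemma class_add_right:
  assumes "P \<in> Ob" "p' \<in> carrier (dl P)" "p \<in> carrier (U P)" "q \<in> carrier (U P)"
  shows "cl P p' (p \<oplus>\<^bsub>U P\<^esub> q) = cl P p' p \<oplus>\<^bsub>B\<^esub> cl P p' q"
proof -
  interpret tensor_both "Hm P P" "dl P" "endo_bimod (U P)" by (rule tensor_both_comatrix) fact
  have "cx P p' (p \<oplus>\<^bsub>U P\<^esub> q) = cx P p' p \<oplus>\<^bsub>comatrix U Hm P\<^esub> cx P p' q"
    using pure_add_right assms by (simp add: comatrix_def)
  then show ?thesis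
    unfolding class_eq recon_tensor_def
    using additive_map_add[OF additive_comatrix_pr[OF assms(1)]] rt_closed(1) assms by metis
qed

lemma rt_act:
  assumes "P \<in> Ob" "p' \<in> carrier (dl P)" "p \<in> carrier (U P)"
  shows "lact RS a (rt P p' p) = rt P (lact (dl P) a p') p"
    and "ract RS (rt P p' p) a = rt P p' (ract (U P) p a)"
proof -
  interpret tensor_both "Hm P P" "dl P" "endo_bimod (U P)" by (rule tensor_both_comatrix) fact
  have "lact (comatrix U Hm P) a (cx P p' p) = cx P (lact (dl P) a p') p"
    "ract (comatrix U Hm P) (cx P p' p) a = cx P p' (ract (U P) p a)"
    using assms by (simp_all add: comatrix_def ract_tensor)
  then show "lact RS a (rt P p' p) = rt P (lact (dl P) a p') p"
    and "ract RS (rt P p' p) a = rt P p' (ract (U P) p a)"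
    unfolding recon_tensor_def RS_eq using assms rt_closed(1)[OF assms] by (simp_all add: sum.inc_act)
qed

lemma class_lact: "P \<in> Ob \<Longrightarrow> p' \<in> carrier (dl P) \<Longrightarrow> p \<in> carrier (U P) \<Longrightarrow>
    lact B a (cl P p' p) = cl P (lact (dl P) a p') p"
  and class_ract: "P \<in> Ob \<Longrightarrow> p' \<in> carrier (dl P) \<Longrightarrow> p \<in> carrier (U P) \<Longrightarrow>
    ract B (cl P p' p) a = cl P p' (ract (U P) p a)"
  by (simp_all add: class_eq B_eq quot.pr_lact quot.pr_ract rt_closed rt_act)

lemma class_hom:
  assumes "P \<in> Ob" "Q \<in> Ob" "t \<in> Hm P Q" "p \<in> carrier (U P)" "q' \<in> carrier (dl Q)"
  shows "cl Q q' (t p) = cl P (\<lambda>x\<in>carrier (U P). q' (t x)) p"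
  unfolding class_eq
proof (rule quot.pr_eqI)
  have "rt Q q' (t p) \<ominus>\<^bsub>RS\<^esub> rt P (\<lambda>x\<in>carrier (U P). q' (t x)) p \<in> ideal_gens"
    unfolding ideal_gens_def using assms by blast
  then show "rt Q q' (t p) \<ominus>\<^bsub>RS\<^esub> rt P (\<lambda>x\<in>carrier (U P). q' (t x)) p \<in> recon_ideal Ob U Hm"
    unfolding ideal_eq using subbimodule_generated(2)[OF two_sided_RS ideal_gens_subset] by blast
qed (use assms hom_closed[OF assms(1-3)] rt_closed(2) in simp_all)

text \<open>The classes of \<open>p\<^sup>* \<otimes> p\<close> generate: apply induction in the quotient, in the direct sum and in each
  tensor product.\<close>

lemma recon_induct [consumes 1, case_names zero cls add]:
  assumes X: "X \<in> carrier B" and zero: "R \<zero>\<^bsub>B\<^esub>"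
    and cls: "\<And>P p' p. P \<in> Ob \<Longrightarrow> p' \<in> carrier (dl P) \<Longrightarrow> p \<in> carrier (U P) \<Longrightarrow> R (cl P p' p)"
    and add: "\<And>X Y. X \<in> carrier B \<Longrightarrow> Y \<in> carrier B \<Longrightarrow> R X \<Longrightarrow> R Y \<Longrightarrow> R (X \<oplus>\<^bsub>B\<^esub> Y)"
  shows "R X"
proof -
  note pr_add = additive_map_add[OF quot.additive_pr, folded B_eq]
    and pr_closed = additive_map_closed[OF quot.additive_pr, folded B_eq]
  have inc: "R (quot.pr (bimod_inj Ob (comatrix U Hm) P Y))" if P: "P \<in> Ob" and Y: "Y \<in> carrier (comatrix U Hm P)" for P Y
  proof -
    interpret tensor_both "Hm P P" "dl P" "endo_bimod (U P)" by (rule tensor_both_comatrix) fact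
    note hom = additive_comatrix_pr[OF P, unfolded comatrix_def additive_map_tensor_iff, folded comatrix_def]
    have "Y \<in> carrier T" using Y by (simp add: comatrix_def)
    then show ?thesis
    proof (induction Y rule: tensor_induct)
      case (pure m n)
      then show ?case using cls[OF P] by (simp add: class_eq recon_tensor_def)
    next
      case (add X Y)
      then show ?case
        using assms(4) additive_map_add[OF hom] additive_map_closed[OF hom] by simp
    qed
  qed
  obtain x where x: "x \<in> carrier RS" "X = quot.pr x"
    using quot.quotient_cases X by (auto simp: B_eq)
  have "R (quot.pr x)"
    using x(1)[unfolded RS_eq]
  proof (induction x rule: sum.sum_induct)
    case zero
    have "quot.pr \<zero>\<^bsub>RS\<^esub> = \<zero>\<^bsub>B\<^esub>"
      using additive_map_zero[OF abelian_RS _ quot.additive_pr] abelian_B by (simp add: B_eq)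
    then show ?case using assms(2) by (simp add: RS_eq)
  next
    case (add x y)
    then show ?case
      using assms(4) pr_add pr_closed by (simp flip: RS_eq)
  qed (rule inc)
  then show ?thesis using x by simp
qed

lemma recon_ext:
  assumes "abelian_group G" "additive_map B G h" "additive_map B G h'"
    and "\<And>P p' p. P \<in> Ob \<Longrightarrow> p' \<in> carrier (dl P) \<Longrightarrow> p \<in> carrier (U P) \<Longrightarrow> h (cl P p' p) = h' (cl P p' p)"
    and "X \<in> carrier B"
  shows "h X = h' X"
  using assms(5)
  by (induction rule: recon_induct)
    (simp_all add: assms(4) additive_map_zero[OF abelian_B assms(1)] assms(2,3)
      additive_map_add[OF assms(2)] additive_map_add[OF assms(3)])

text \<open>A natural pairing factors through each tensor product, then through the direct sum. The resulting map is
  linear on both sides, so its kernel is a subbimodule; by naturality it contains the generators of the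
  ideal, hence the ideal.\<close>

lemma recon_extend_ex:
  assumes G: "two_sided_module G" and \<beta>: "natural_pairing Ob U Hm G \<beta>"
  shows "\<exists>h. bimod_hom B G h \<and>
    (\<forall>P\<in>Ob. \<forall>p'\<in>carrier (dl P). \<forall>p\<in>carrier (U P). h (cl P p' p) = \<beta> P p' p)"
proof -
  have GA: "abelian_group G" and GR: "right_module G" and GL: "left_module G"
    by (rule two_sided_abelian[OF G] two_sided_moduleD[OF G])+
  have \<beta>_hom: "rmod_hom (U P) G (\<beta> P p')" if "P \<in> Ob" "p' \<in> carrier (dl P)" for P p'
    using \<beta> that unfolding natural_pairing_def by blast
  have \<beta>_add: "additive_map (dl P) G (\<lambda>p'. \<beta> P p' p)" if "P \<in> Ob" "p \<in> carrier (U P)" for P p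
    using \<beta> that unfolding natural_pairing_def by blast
  have \<beta>_lact: "\<beta> P (lact (dl P) a p') p = lact G a (\<beta> P p' p)" if "P \<in> Ob" "p \<in> carrier (U P)" "p' \<in> carrier (dl P)" for P p p' a
    using \<beta> that unfolding natural_pairing_def by blast
  have \<beta>_nat: "\<beta> Q q' (t p) = \<beta> P (\<lambda>x\<in>carrier (U P). q' (t x)) p"
    if "P \<in> Ob" "Q \<in> Ob" "t \<in> Hm P Q" "p \<in> carrier (U P)" "q' \<in> carrier (dl Q)" for P Q t p q'
    using \<beta> that unfolding natural_pairing_def by blast
  have "\<exists>h. additive_map (comatrix U Hm P) G h \<and> (\<forall>p'\<in>carrier (dl P). \<forall>p\<in>carrier (U P). h (cx P p' p) = \<beta> P p' p)"
    if P: "P \<in> Ob" for P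
  proof -
    interpret tensor_both "Hm P P" "dl P" "endo_bimod (U P)" by (rule tensor_both_comatrix) fact
    have "balanced (Hm P P) (dl P) (endo_bimod (U P)) G (\<beta> P)"
      unfolding balanced_def
    proof (intro conjI ballI)
      fix n assume "n \<in> carrier (endo_bimod (U P))"
      then show "additive_map (dl P) G (\<lambda>m. \<beta> P m n)" using \<beta>_add P by simp
    next
      fix m assume "m \<in> carrier (dl P)"
      then have "additive_map (U P) G (\<beta> P m)" using \<beta>_hom[OF P] rmod_homD(1) by blast
      then show "additive_map (endo_bimod (U P)) G (\<beta> P m)"
        using additive_map_cong_structure[of "U P" "endo_bimod (U P)" G G] by simp
    next
      fix m n t assume "m \<in> carrier (dl P)" "n \<in> carrier (endo_bimod (U P))" "t \<in> Hm P P"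
      then show "\<beta> P (ract (dl P) m t) n = \<beta> P m (lact (endo_bimod (U P)) t n)"
        using \<beta>_nat[OF P P] by (simp add: dual_bimod_simps(4))
    qed
    from exists_lift[OF GA this] show ?thesis by (simp add: comatrix_def)
  qed
  then obtain f where f: "\<And>P. P \<in> Ob \<Longrightarrow> additive_map (comatrix U Hm P) G (f P)"
    and f_cx: "\<And>P p' p. P \<in> Ob \<Longrightarrow> p' \<in> carrier (dl P) \<Longrightarrow> p \<in> carrier (U P) \<Longrightarrow> f P (cx P p' p) = \<beta> P p' p"
    by metis
  obtain h where h: "additive_map RS G h"
    and h_inc: "\<And>P X. P \<in> Ob \<Longrightarrow> X \<in> carrier (comatrix U Hm P) \<Longrightarrow> h (bimod_inj Ob (comatrix U Hm) P X) = f P X"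
    using sum.sum_lift[OF GA f] unfolding RS_eq by blast
  have h_rt: "h (rt P p' p) = \<beta> P p' p" if "P \<in> Ob" "p' \<in> carrier (dl P)" "p \<in> carrier (U P)" for P p' p
    using that by (simp add: recon_tensor_def h_inc rt_closed f_cx)
  \<comment> \<open>Both sides of the linearity equations are additive, hence determined by pure tensors.\<close>
  have RS_ext: "k x = k' x" if k: "additive_map RS G k" "additive_map RS G k'"
    and eq: "\<And>P p' p. P \<in> Ob \<Longrightarrow> p' \<in> carrier (dl P) \<Longrightarrow> p \<in> carrier (U P) \<Longrightarrow> k (rt P p' p) = k' (rt P p' p)"
    and x: "x \<in> carrier RS" for k k' x
    using x[unfolded RS_eq]
  proof (induction x rule: sum.sum_induct)
    case zero
    then show ?case
      using additive_map_zero[OF abelian_RS GA k(1)] additive_map_zero[OF abelian_RS GA k(2)] by (simp add: RS_eq)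
  next
    case (inc P X)
    interpret tensor_both "Hm P P" "dl P" "endo_bimod (U P)" by (rule tensor_both_comatrix) fact
    have add: "additive_map T G (\<lambda>X. k (bimod_inj Ob (comatrix U Hm) P X))"
      "additive_map T G (\<lambda>X. k' (bimod_inj Ob (comatrix U Hm) P X))"
      using additive_map_comp[OF sum.additive_inc[OF inc(1)] k(1)[unfolded RS_eq]]
        additive_map_comp[OF sum.additive_inc[OF inc(1)] k(2)[unfolded RS_eq]]
      by (simp_all add: comatrix_def additive_map_cong_structure[of "comatrix U Hm P" T G G])
    have "X \<in> carrier T" using inc(2) by (simp add: comatrix_def)
    from tensor_ext[OF add _ this] show ?case
      using eq[OF inc(1)] by (simp add: recon_tensor_def)
  next
    case (add x y)
    then show ?case using additive_map_add[OF k(1)] additive_map_add[OF k(2)] by (simp add: RS_eq)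
  qed
  have RSR: "right_module RS" and RSL: "left_module RS"
    by (rule two_sided_moduleD[OF two_sided_RS])+
  have h_lact: "h (lact RS a x) = lact G a (h x)" if "x \<in> carrier RS" for x a
    by (rule RS_ext[OF additive_map_comp[OF additive_lact[OF RSL] h] additive_map_comp[OF h additive_lact[OF GL]] _ that])
      (simp add: rt_act h_rt \<beta>_lact left_moduleD[OF left_module_dual[OF U_module]])
  have h_ract: "h (ract RS x a) = ract G (h x) a" if "x \<in> carrier RS" for x a
    by (rule RS_ext[OF additive_map_comp[OF additive_ract[OF RSR] h] additive_map_comp[OF h additive_ract[OF GR]] _ that])
      (simp add: rt_act h_rt rmod_homD(2)[OF \<beta>_hom] right_moduleD[OF U_module])
  define K where "K = {x \<in> carrier RS. h x = \<zero>\<^bsub>G\<^esub>}"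
  interpret G: abelian_group G by (rule GA)
  have h0: "h \<zero>\<^bsub>RS\<^esub> = \<zero>\<^bsub>G\<^esub>" by (rule additive_map_zero[OF abelian_RS GA h])
  have "subbimodule K RS"
  proof -
    have "additive_subgroup K RS"
    proof (rule additive_subgroupI, rule quot.add.subgroupI)
      fix x y assume "x \<in> K" "y \<in> K"
      then show "x \<oplus>\<^bsub>RS\<^esub> y \<in> K" "\<ominus>\<^bsub>RS\<^esub> x \<in> K"
        by (simp_all add: K_def additive_map_add[OF h] additive_map_minus[OF abelian_RS GA h] G.add.inv_one)
    qed (use h0 in \<open>auto simp: K_def\<close>)
    moreover have "lact G a \<zero>\<^bsub>G\<^esub> = \<zero>\<^bsub>G\<^esub>" "ract G \<zero>\<^bsub>G\<^esub> a = \<zero>\<^bsub>G\<^esub>" for a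
      using additive_map_zero[OF GA GA additive_lact[OF GL]] additive_map_zero[OF GA GA additive_ract[OF GR]] by auto
    ultimately show ?thesis
      unfolding subbimodule_def
      by (auto simp: K_def h_lact h_ract left_moduleD[OF RSL] right_moduleD[OF RSR])
  qed
  moreover have "ideal_gens \<subseteq> K"
  proof
    fix x assume "x \<in> ideal_gens"
    then obtain P Q t p q' where x: "x = rt Q q' (t p) \<ominus>\<^bsub>RS\<^esub> rt P (\<lambda>x\<in>carrier (U P). q' (t x)) p"
      and *: "P \<in> Ob" "Q \<in> Ob" "t \<in> Hm P Q" "p \<in> carrier (U P)" "q' \<in> carrier (dl Q)"
      unfolding ideal_gens_def by blast
    then have **: "t p \<in> carrier (U Q)" "(\<lambda>x\<in>carrier (U P). q' (t x)) \<in> carrier (dl P)"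
      using hom_closed[OF *(1-3)] by simp_all
    have "h x = h (rt Q q' (t p)) \<oplus>\<^bsub>G\<^esub> \<ominus>\<^bsub>G\<^esub> h (rt P (\<lambda>x\<in>carrier (U P). q' (t x)) p)"
      using * ** rt_closed by (simp add: x a_minus_def additive_map_add[OF h] additive_map_minus[OF abelian_RS GA h])
    also have "\<dots> = \<zero>\<^bsub>G\<^esub>"
      using * ** rmod_homD(3)[OF \<beta>_hom[OF *(2,5)]] \<beta>_nat[OF *, symmetric] by (simp add: h_rt G.r_neg)
    finally show "x \<in> K"
      using * ** rt_closed by (simp add: K_def x)
  qed
  ultimately have "recon_ideal Ob U Hm \<subseteq> K"
    unfolding ideal_eq by (rule subbimodule_generated(3)[OF two_sided_RS ideal_gens_subset])
  then obtain h' where h': "additive_map B G h'" and h'_pr: "\<And>x. x \<in> carrier RS \<Longrightarrow> h' (quot.pr x) = h x"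
    using quot.quotient_lift[OF GA h] unfolding B_eq K_def by blast
  have "bimod_hom B G h'"
    unfolding bimod_hom_def rmod_hom_def
  proof (intro conjI ballI allI)
    fix X a assume "X \<in> carrier B"
    then obtain x where "x \<in> carrier RS" "X = quot.pr x" using quot.quotient_cases by (auto simp: B_eq)
    then show "h' (ract B X a) = ract G (h' X) a" "h' (lact B a X) = lact G a (h' X)"
      by (simp_all add: B_eq quot.pr_ract quot.pr_lact h'_pr h_ract h_lact left_moduleD[OF RSL] right_moduleD[OF RSR])
  qed (rule h')
  moreover have "h' (cl P p' p) = \<beta> P p' p" if "P \<in> Ob" "p' \<in> carrier (dl P)" "p \<in> carrier (U P)" for P p' p
    using that by (simp add: class_eq h'_pr rt_closed h_rt)
  ultimately show ?thesis by blast
qed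

lemma
  assumes "two_sided_module G" "natural_pairing Ob U Hm G \<beta>"
  shows recon_extend_hom: "bimod_hom B G (recon_extend Ob U Hm G \<beta>)"
    and recon_extend_class: "P \<in> Ob \<Longrightarrow> p' \<in> carrier (dl P) \<Longrightarrow> p \<in> carrier (U P) \<Longrightarrow>
      recon_extend Ob U Hm G \<beta> (cl P p' p) = \<beta> P p' p"
  using someI_ex[OF recon_extend_ex[OF assms]] unfolding recon_extend_def by auto

end

section \<open>Maps between tensor products\<close>

definition left_linear :: "('s,'t,'m,'y) bimod_scheme \<Rightarrow> ('s,'u,'n,'z) bimod_scheme \<Rightarrow> ('m \<Rightarrow> 'n) \<Rightarrow> bool" where
  "left_linear M N g \<longleftrightarrow> additive_map M N g \<and> (\<forall>m\<in>carrier M. \<forall>a. g (lact M a m) = lact N a (g m))"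

lemma left_linearD:
  assumes "left_linear M N g"
  shows "additive_map M N g" "m \<in> carrier M \<Longrightarrow> g (lact M a m) = lact N a (g m)"
    "m \<in> carrier M \<Longrightarrow> g m \<in> carrier N"
    "m \<in> carrier M \<Longrightarrow> n \<in> carrier M \<Longrightarrow> g (m \<oplus>\<^bsub>M\<^esub> n) = g m \<oplus>\<^bsub>N\<^esub> g n"
  using assms by (auto simp: left_linear_def additive_map_closed additive_map_add)

lemma bimod_hom_left_linear: "bimod_hom M N f \<Longrightarrow> left_linear M N f"
  by (simp add: left_linear_def bimod_homD)

lemma bimod_hom_iff: "bimod_hom M N f \<longleftrightarrow> rmod_hom M N f \<and> left_linear M N f"
  by (auto simp: bimod_hom_def left_linear_def dest: rmod_homD)

lemma left_linear_id: "left_linear M M (\<lambda>x. x)"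
  by (simp add: left_linear_def additive_map_def hom_def)

lemma (in tensor_both) left_linear_pure: "n \<in> carrier N \<Longrightarrow> left_linear M BT (\<lambda>m. pt m n)"
  using additive_pure_left[of n] by (simp add: left_linear_def)

lemma rmod_hom_id: "rmod_hom M M (\<lambda>x. x)"
  by (simp add: rmod_hom_def additive_map_def hom_def)

lemma
  assumes "tensor_pair UNIV M N" "tensor_pair UNIV M' N'" "rmod_hom M M' f" "left_linear N N' g"
  shows additive_tensor_map: "additive_map (tensor_ab UNIV M N) (tensor_ab UNIV M' N') (tensor_map M N M' N' f g)"
    and tensor_map_pure: "m \<in> carrier M \<Longrightarrow> n \<in> carrier N \<Longrightarrow>
      tensor_map M N M' N' f g (pure_tensor UNIV M N m n) = pure_tensor UNIV M' N' (f m) (g n)"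
proof -
  interpret A: tensor_pair UNIV M N by fact
  interpret B: tensor_pair UNIV M' N' by fact
  have "balanced UNIV M N (tensor_ab UNIV M' N') (\<lambda>m n. pure_tensor UNIV M' N' (f m) (g n))"
    by (rule balancedI)
      (simp_all add: rmod_homD[OF assms(3)] left_linearD[OF assms(4)] B.pure_add_left B.pure_add_right B.pure_balanced)
  then show "additive_map (tensor_ab UNIV M N) (tensor_ab UNIV M' N') (tensor_map M N M' N' f g)"
    and "m \<in> carrier M \<Longrightarrow> n \<in> carrier N \<Longrightarrow>
      tensor_map M N M' N' f g (pure_tensor UNIV M N m n) = pure_tensor UNIV M' N' (f m) (g n)"
    unfolding tensor_map_def by (simp_all add: A.additive_lift B.abelian_tensor)
qed

text \<open>In a coring the left factor of \<open>(C \<otimes> C) \<otimes> C\<close> is a bimodule, for comodules the left factor of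
  \<open>(M \<otimes> C) \<otimes> C\<close> is only a right module; the tensor products are the same.\<close>

lemma tensor_left_cong:
  "tensor_ab UNIV (tensor UNIV M N) P = tensor_ab UNIV (tensor_r UNIV M N) P"
  "pure_tensor UNIV (tensor UNIV M N) P = pure_tensor UNIV (tensor_r UNIV M N) P"
  "tensor_lift UNIV (tensor UNIV M N) P = tensor_lift UNIV (tensor_r UNIV M N) P"
  by (rule tensor_ab_cong; simp add: ract_tensor fun_eq_iff)+

lemma
  assumes M: "right_module M" and N: "two_sided_module N" and P: "two_sided_module P"
  shows additive_tensor_assoc:
      "additive_map (tensor_ab UNIV (tensor_r UNIV M N) P) (tensor_ab UNIV M (tensor UNIV N P)) (tensor_assoc M N P)"
    and tensor_assoc_pure: "X \<in> carrier (tensor_ab UNIV M N) \<Longrightarrow> p \<in> carrier P \<Longrightarrow>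
      tensor_assoc M N P (pure_tensor UNIV (tensor_r UNIV M N) P X p) =
        tensor_map M N M (tensor UNIV N P) (\<lambda>m. m) (\<lambda>n. pure_tensor UNIV N P n p) X"
    and tensor_assoc_pure_pure: "m \<in> carrier M \<Longrightarrow> n \<in> carrier N \<Longrightarrow> p \<in> carrier P \<Longrightarrow>
      tensor_assoc M N P (pure_tensor UNIV (tensor_r UNIV M N) P (pure_tensor UNIV M N m n) p) =
        pure_tensor UNIV M (tensor UNIV N P) m (pure_tensor UNIV N P n p)"
proof -
  interpret MN: tensor_right UNIV M N by (rule tensor_right_UNIV[OF M N])
  interpret NP: tensor_both UNIV N P by (rule tensor_both_UNIV[OF N P])
  have NP2: "two_sided_module (tensor UNIV N P)" by (rule NP.two_sided_module_tensor)
  interpret M_NP: tensor_right UNIV M "tensor UNIV N P" by (rule tensor_right_UNIV[OF M NP2])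
  interpret MN_P: tensor_right UNIV "tensor_r UNIV M N" P
    by (rule tensor_right_UNIV[OF MN.right_module_tensor_r P])
  let ?G = "tensor_ab UNIV M (tensor UNIV N P)"
  let ?k = "\<lambda>p. tensor_map M N M (tensor UNIV N P) (\<lambda>m. m) (\<lambda>n. pure_tensor UNIV N P n p)"
  note lin = NP.left_linear_pure
  note k_add = additive_tensor_map[OF MN.tensor_pair_axioms M_NP.tensor_pair_axioms rmod_hom_id lin]
  note k_pure = tensor_map_pure[OF MN.tensor_pair_axioms M_NP.tensor_pair_axioms rmod_hom_id lin]
  have \<beta>: "balanced UNIV (tensor_r UNIV M N) P ?G (\<lambda>X p. ?k p X)"
    unfolding balanced_def
  proof (intro conjI ballI)
    fix p assume "p \<in> carrier P"
    then show "additive_map (tensor_r UNIV M N) ?G (?k p)" using k_add by simp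
  next
    fix X assume "X \<in> carrier (tensor_r UNIV M N)"
    then have X: "X \<in> carrier (tensor_ab UNIV M N)" by simp
    show "additive_map P ?G (\<lambda>p. ?k p X)"
    proof (rule additive_mapI)
      fix p q assume pq: "p \<in> carrier P" "q \<in> carrier P"
      then have pq': "p \<oplus>\<^bsub>P\<^esub> q \<in> carrier P" using NP.N.a_closed by simp
      have sum: "additive_map MN.T ?G (\<lambda>X. ?k p X \<oplus>\<^bsub>?G\<^esub> ?k q X)"
        using pq additive_map_closed[OF k_add] additive_map_add[OF k_add]
        by (intro additive_mapI) (simp_all add: M_NP.T.a_ac)
      show "?k (p \<oplus>\<^bsub>P\<^esub> q) X = ?k p X \<oplus>\<^bsub>?G\<^esub> ?k q X"
        by (rule MN.tensor_ext[OF k_add[OF pq'] sum _ X])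
          (use pq pq' in \<open>simp add: k_pure NP.pure_add_right M_NP.pure_add_right[simplified]\<close>)
    qed (use X additive_map_closed[OF k_add] in blast)
  next
    fix X p a assume "X \<in> carrier (tensor_r UNIV M N)" and p: "p \<in> carrier P"
    then have X: "X \<in> carrier (tensor_ab UNIV M N)" by simp
    have ap: "lact P a p \<in> carrier P" using p NP.lact_closed by simp
    show "?k p (ract (tensor_r UNIV M N) X a) = ?k (lact P a p) X"
      by (rule MN.tensor_ext[OF additive_map_comp[OF MN.additive_ract_tensor k_add[OF p]] k_add[OF ap] _ X])
        (use p ap in \<open>simp add: k_pure right_moduleD[OF NP.right_module_right] NP.pure_balanced
          right_moduleD(2)[OF two_sided_moduleD(1)[OF N]]\<close>)
  qed
  have assoc: "tensor_assoc M N P = tensor_lift UNIV (tensor_r UNIV M N) P ?G (\<lambda>X p. ?k p X)"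
    by (simp add: tensor_assoc_def tensor_map_def Let_def)
  show "additive_map (tensor_ab UNIV (tensor_r UNIV M N) P) ?G (tensor_assoc M N P)"
    unfolding assoc by (rule MN_P.additive_lift[OF M_NP.abelian_tensor \<beta>])
  show *: "X \<in> carrier (tensor_ab UNIV M N) \<Longrightarrow> p \<in> carrier P \<Longrightarrow>
      tensor_assoc M N P (pure_tensor UNIV (tensor_r UNIV M N) P X p) = ?k p X" for X p
    unfolding assoc by (rule MN_P.lift_pure[OF M_NP.abelian_tensor \<beta>]) simp_all
  show "m \<in> carrier M \<Longrightarrow> n \<in> carrier N \<Longrightarrow> p \<in> carrier P \<Longrightarrow>
      tensor_assoc M N P (pure_tensor UNIV (tensor_r UNIV M N) P (pure_tensor UNIV M N m n) p) =
        pure_tensor UNIV M (tensor UNIV N P) m (pure_tensor UNIV N P n p)"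
    by (simp add: * k_pure)
qed

section \<open>Dual bases\<close>

lemma ract_zero: "right_module M \<Longrightarrow> m \<in> carrier M \<Longrightarrow> ract M m 0 = \<zero>\<^bsub>M\<^esub>"
proof -
  assume M: "right_module M" "m \<in> carrier M"
  interpret abelian_group M using M(1) by (rule right_moduleD)
  have "ract M m 0 \<oplus>\<^bsub>M\<^esub> ract M m 0 = ract M m 0 \<oplus>\<^bsub>M\<^esub> \<zero>\<^bsub>M\<^esub>"
    using right_moduleD(4)[OF M, of 0 0] right_moduleD(2)[OF M] by simp
  then show ?thesis using right_moduleD(2)[OF M, of 0] add.l_cancel_one[of "ract M m 0" "ract M m 0"] by simp
qed

text \<open>The images of the standard basis of \<open>A\<^sup>n\<close> with the coordinate functions of the embedding.\<close>

lemma fg_projective_dual_basis: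
  fixes P :: "('a::{comm_ring,monoid_mult},'m) rmod"
  assumes "fg_projective P"
  shows "\<exists>es. dual_basis P es"
proof -
  have P: "right_module P" using assms by (simp add: fg_projective_def)
  interpret P: abelian_group P using P by (rule right_moduleD)
  obtain n i p where i: "rmod_hom P (free_rmod n) i" and p: "rmod_hom (free_rmod n) P p"
    and pi: "\<And>m. m \<in> carrier P \<Longrightarrow> p (i m) = m"
    using assms unfolding fg_projective_def by blast
  define u :: "nat \<Rightarrow> nat \<Rightarrow> 'a" where "u j = (\<lambda>k. if k = j then 1 else 0)" for j
  define es where "es = map (\<lambda>j. (p (u j), \<lambda>x\<in>carrier P. i x j)) [0..<n]"
  have u: "u j \<in> carrier (free_rmod n)" if "j < n" for j
    using that by (simp add: free_rmod_def u_def)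
  have p_trunc: "p (\<lambda>k. if k < l then v k else 0) = (\<Oplus>\<^bsub>P\<^esub>j\<in>{..<l}. ract P (p (u j)) (v j))"
    if "l \<le> n" for l v
    using that
  proof (induction l)
    case 0
    have z: "(\<lambda>_. 0) \<in> carrier (free_rmod n)" by (simp add: free_rmod_def)
    have "p (\<lambda>_. 0) = ract P (p (\<lambda>_. 0)) 0"
      using rmod_homD(2)[OF p z, of 0] by (simp add: free_rmod_def)
    then show ?case using ract_zero[OF P rmod_homD(3)[OF p z]] by simp
  next
    case (Suc l)
    have l: "(\<lambda>k. if k < l then v k else 0) \<in> carrier (free_rmod n)"
      and l': "ract (free_rmod n) (u l) (v l) \<in> carrier (free_rmod n)"
      using Suc.prems by (auto simp: free_rmod_def u_def)
    have "(\<lambda>k. if k < Suc l then v k else 0) =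
        (\<lambda>k. if k < l then v k else 0) \<oplus>\<^bsub>free_rmod n\<^esub> ract (free_rmod n) (u l) (v l)"
      by (auto simp: free_rmod_def u_def fun_eq_iff less_Suc_eq)
    then have "p (\<lambda>k. if k < Suc l then v k else 0) =
        (\<Oplus>\<^bsub>P\<^esub>j\<in>{..<l}. ract P (p (u j)) (v j)) \<oplus>\<^bsub>P\<^esub> ract P (p (u l)) (v l)"
      using Suc rmod_homD(4)[OF p l l'] rmod_homD(2)[OF p u] by simp
    also have "\<dots> = (\<Oplus>\<^bsub>P\<^esub>j\<in>insert l {..<l}. ract P (p (u j)) (v j))"
      using Suc.prems rmod_homD(3)[OF p u] right_moduleD(2)[OF P]
      by (subst P.finsum_insert) (auto intro!: P.a_comm P.finsum_closed)
    finally show ?case by (simp add: lessThan_Suc)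
  qed
  have "dual_basis P es"
    unfolding dual_basis_def
  proof (rule conjI, goal_cases)
    case 1
    show ?case
    proof -
      have "(\<lambda>x\<in>carrier P. i x j) \<in> carrier (dual_bimod P)" for j
        by (rule dualI) (simp_all add: rmod_homD[OF i] right_moduleD[OF P], simp_all add: free_rmod_def)
      then show ?thesis using rmod_homD(3)[OF p u] by (auto simp: es_def)
    qed
  next
    case 2
    show ?case
    proof
      fix x assume x: "x \<in> carrier P"
      have "i x = (\<lambda>k. if k < n then i x k else 0)"
        using rmod_homD(3)[OF i x] by (auto simp: free_rmod_def)
      then have "x = (\<Oplus>\<^bsub>P\<^esub>j\<in>{..<n}. ract P (p (u j)) (i x j))"
        using pi[OF x] p_trunc[of n "i x"] by simp
      also have "\<dots> = (\<Oplus>\<^bsub>P\<^esub>j\<in>{..<length es}. ract P (fst (es ! j)) (snd (es ! j) x))"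
        using x rmod_homD(3)[OF p u] right_moduleD(2)[OF P]
        by (intro P.finsum_cong') (auto simp: es_def)
      finally show "x = (\<Oplus>\<^bsub>P\<^esub>j\<in>{..<length es}. ract P (fst (es ! j)) (snd (es ! j) x))" .
    qed
  qed
  then show ?thesis by blast
qed

lemma dual_basisD:
  assumes "dual_basis P es"
  shows "j < length es \<Longrightarrow> fst (es ! j) \<in> carrier P" "j < length es \<Longrightarrow> snd (es ! j) \<in> carrier (dual_bimod P)"
    and "p \<in> carrier P \<Longrightarrow> (\<Oplus>\<^bsub>P\<^esub>i\<in>{..<length es}. ract P (fst (es ! i)) (snd (es ! i) p)) = p"
  using assms nth_mem[of j es] unfolding dual_basis_def by (auto simp: case_prod_beta)

text \<open>\<open>f = \<Sum> f(e\<^sub>i) e\<^sub>i\<^sup>*\<close>, from \<open>x = \<Sum> e\<^sub>i e\<^sub>i\<^sup>*(x)\<close>.\<close>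

lemma dual_expand:
  assumes P: "right_module P" and es: "dual_basis P es" and f: "f \<in> carrier (dual_bimod P)"
  shows "(\<Oplus>\<^bsub>dual_bimod P\<^esub>i\<in>{..<length es}. lact (dual_bimod P) (f (fst (es ! i))) (snd (es ! i))) = f" (is "?s = f")
proof
  fix x
  interpret P: abelian_group P using P by (rule right_moduleD)
  interpret D: abelian_group "dual_bimod P" using P by (rule abelian_dual)
  have s: "?s \<in> carrier (dual_bimod P)"
    by (rule D.finsum_closed) (auto intro!: dual_closed(2)[OF P] dual_basisD[OF es])
  show "?s x = f x"
  proof (cases "x \<in> carrier P")
    case True
    have ev: "additive_map (dual_bimod P) regular_bimod (\<lambda>g. g x)"
      using True by (intro additive_mapI) (auto simp: dual_bimod_simps(3))
    have "?s x = (\<Oplus>\<^bsub>regular_bimod\<^esub>i\<in>{..<length es}. lact (dual_bimod P) (f (fst (es ! i))) (snd (es ! i)) x)"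
      by (rule additive_map_finsum[OF abelian_dual[OF P] abelian_regular ev])
        (auto intro!: dual_closed(2)[OF P] dual_basisD[OF es])
    also have "\<dots> = (\<Oplus>\<^bsub>regular_bimod\<^esub>i\<in>{..<length es}. f (ract P (fst (es ! i)) (snd (es ! i) x)))"
      using True dual_basisD[OF es]
      by (intro abelian_monoid.finsum_cong'[OF abelian_group.axioms(1)[OF abelian_regular]])
        (auto simp: dual_bimod_simps(5) dual_apply(2)[OF f])
    also have "\<dots> = f (\<Oplus>\<^bsub>P\<^esub>i\<in>{..<length es}. ract P (fst (es ! i)) (snd (es ! i) x))"
      using True dual_basisD[OF es] right_moduleD(2)[OF P]
      by (intro additive_map_finsum[OF right_moduleD(1)[OF P] abelian_regular dual_apply(4)[OF f], symmetric]) auto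
    finally show ?thesis using dual_basisD(3)[OF es True] by simp
  qed (use dual_apply(3)[OF s] dual_apply(3)[OF f] in simp)
qed

text \<open>The canonical element \<open>\<Sum> e\<^sub>i \<otimes> e\<^sub>i\<^sup>*\<close> is natural: a linear map \<open>t : P \<rightarrow> Q\<close> can be moved from
  one factor to the other. In coordinates both sides equal \<open>\<Sum> u(f\<^sub>j) f\<^sub>j\<^sup>*(t e\<^sub>i) \<otimes> \<phi>(e\<^sub>i\<^sup>*)\<close>. Everything that
  depends on a choice of dual basis is controlled by this.\<close>

lemma dual_basis_transport:
  assumes P: "right_module P" and Q: "right_module Q" and M: "right_module M" and N: "left_module N"
    and es: "dual_basis P es" and fs: "dual_basis Q fs"
    and t: "rmod_hom P Q t" and u: "rmod_hom Q M u" and \<phi>: "left_linear (dual_bimod P) N \<phi>"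
  shows "(\<Oplus>\<^bsub>tensor_ab UNIV M N\<^esub>j\<in>{..<length fs}.
            pure_tensor UNIV M N (u (fst (fs ! j))) (\<phi> (\<lambda>x\<in>carrier P. snd (fs ! j) (t x)))) =
         (\<Oplus>\<^bsub>tensor_ab UNIV M N\<^esub>i\<in>{..<length es}.
            pure_tensor UNIV M N (u (t (fst (es ! i)))) (\<phi> (snd (es ! i))))"
proof -
  interpret MN: tensor_pair UNIV M N by (rule tensor_pair_UNIV[OF M N])
  let ?c = "\<lambda>j i. snd (fs ! j) (t (fst (es ! i)))"
  note [simp] = dual_basisD(1,2)[OF es] dual_basisD(1,2)[OF fs] rmod_homD(3)[OF t] rmod_homD(3)[OF u] left_linearD(3)[OF \<phi>]
    right_moduleD(2)[OF Q] right_moduleD(2)[OF M] left_moduleD(2)[OF N] dual_closed(2)[OF P]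
  have \<phi>_expand: "\<phi> (\<lambda>x\<in>carrier P. snd (fs ! j) (t x)) = (\<Oplus>\<^bsub>N\<^esub>i\<in>{..<length es}. lact N (?c j i) (\<phi> (snd (es ! i))))"
    if j: "j < length fs" for j
  proof -
    let ?f = "\<lambda>x\<in>carrier P. snd (fs ! j) (t x)"
    have f: "?f \<in> carrier (dual_bimod P)"
      using j by (intro dual_precompose[OF P t]) simp
    have "\<phi> ?f = \<phi> (\<Oplus>\<^bsub>dual_bimod P\<^esub>i\<in>{..<length es}. lact (dual_bimod P) (?f (fst (es ! i))) (snd (es ! i)))"
      using dual_expand[OF P es f] by simp
    also have "\<dots> = (\<Oplus>\<^bsub>N\<^esub>i\<in>{..<length es}. \<phi> (lact (dual_bimod P) (?f (fst (es ! i))) (snd (es ! i))))"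
      by (rule additive_map_finsum[OF abelian_dual[OF P] MN.abelian_right left_linearD(1)[OF \<phi>]]) auto
    also have "\<dots> = (\<Oplus>\<^bsub>N\<^esub>i\<in>{..<length es}. lact N (?c j i) (\<phi> (snd (es ! i))))"
      by (rule MN.N.finsum_cong') (auto simp: left_linearD(2)[OF \<phi>])
    finally show ?thesis .
  qed
  have "(\<Oplus>\<^bsub>MN.T\<^esub>j\<in>{..<length fs}. MN.pt (u (fst (fs ! j))) (\<phi> (\<lambda>x\<in>carrier P. snd (fs ! j) (t x)))) =
    (\<Oplus>\<^bsub>MN.T\<^esub>j\<in>{..<length fs}. \<Oplus>\<^bsub>MN.T\<^esub>i\<in>{..<length es}. MN.pt (u (ract Q (fst (fs ! j)) (?c j i))) (\<phi> (snd (es ! i))))"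
  proof (rule MN.T.finsum_cong'[OF refl])
    fix j assume "j \<in> {..<length fs}"
    then have j: "j < length fs" by simp
    show "MN.pt (u (fst (fs ! j))) (\<phi> (\<lambda>x\<in>carrier P. snd (fs ! j) (t x))) =
      (\<Oplus>\<^bsub>MN.T\<^esub>i\<in>{..<length es}. MN.pt (u (ract Q (fst (fs ! j)) (?c j i))) (\<phi> (snd (es ! i))))"
      using j unfolding \<phi>_expand[OF j]
      by (subst MN.pure_finsum_right, simp, simp, simp, intro MN.T.finsum_cong'[OF refl])
        (simp_all add: Pi_iff rmod_homD(2)[OF u] MN.pure_balanced)
  qed (auto intro!: MN.T.finsum_closed)
  also have "\<dots> = (\<Oplus>\<^bsub>MN.T\<^esub>i\<in>{..<length es}. \<Oplus>\<^bsub>MN.T\<^esub>j\<in>{..<length fs}. MN.pt (u (ract Q (fst (fs ! j)) (?c j i))) (\<phi> (snd (es ! i))))"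
    by (rule finsum_swap[OF MN.abelian_tensor]) auto
  also have "\<dots> = (\<Oplus>\<^bsub>MN.T\<^esub>i\<in>{..<length es}. MN.pt (u (t (fst (es ! i)))) (\<phi> (snd (es ! i))))"
  proof (rule MN.T.finsum_cong'[OF refl])
    fix i assume "i \<in> {..<length es}"
    then have i: "i < length es" by simp
    have "u (t (fst (es ! i))) = u (\<Oplus>\<^bsub>Q\<^esub>j\<in>{..<length fs}. ract Q (fst (fs ! j)) (?c j i))"
      using i dual_basisD(3)[OF fs, of "t (fst (es ! i))"] by simp
    also have "\<dots> = (\<Oplus>\<^bsub>M\<^esub>j\<in>{..<length fs}. u (ract Q (fst (fs ! j)) (?c j i)))"
      by (rule additive_map_finsum[OF right_moduleD(1)[OF Q] MN.abelian_left rmod_homD(1)[OF u]]) auto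
    finally show "(\<Oplus>\<^bsub>MN.T\<^esub>j\<in>{..<length fs}. MN.pt (u (ract Q (fst (fs ! j)) (?c j i))) (\<phi> (snd (es ! i)))) =
        MN.pt (u (t (fst (es ! i)))) (\<phi> (snd (es ! i)))"
      using i MN.pure_finsum_left[of "{..<length fs}" "\<lambda>j. u (ract Q (fst (fs ! j)) (?c j i))" "\<phi> (snd (es ! i))"]
      by simp
  qed auto
  finally show ?thesis .
qed

lemma dual_basis_independent:
  assumes P: "right_module P" and M: "right_module M" and N: "left_module N"
    and es: "dual_basis P es" and fs: "dual_basis P fs"
    and u: "rmod_hom P M u" and \<phi>: "left_linear (dual_bimod P) N \<phi>"
  shows "(\<Oplus>\<^bsub>tensor_ab UNIV M N\<^esub>j\<in>{..<length fs}. pure_tensor UNIV M N (u (fst (fs ! j))) (\<phi> (snd (fs ! j)))) =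
         (\<Oplus>\<^bsub>tensor_ab UNIV M N\<^esub>i\<in>{..<length es}. pure_tensor UNIV M N (u (fst (es ! i))) (\<phi> (snd (es ! i))))"
proof -
  interpret MN: tensor_pair UNIV M N by (rule tensor_pair_UNIV[OF M N])
  have "(\<lambda>x\<in>carrier P. snd (fs ! j) x) = snd (fs ! j)" if "j < length fs" for j
    using dual_basisD(2)[OF fs that] by (simp add: dual_bimod_simps(1) extensional_restrict)
  then have "(\<Oplus>\<^bsub>MN.T\<^esub>j\<in>{..<length fs}. MN.pt (u (fst (fs ! j))) (\<phi> (snd (fs ! j)))) =
    (\<Oplus>\<^bsub>MN.T\<^esub>j\<in>{..<length fs}. MN.pt (u (fst (fs ! j))) (\<phi> (\<lambda>x\<in>carrier P. snd (fs ! j) x)))"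
    by (intro MN.T.finsum_cong')
      (auto intro!: MN.pure_closed simp: rmod_homD(3)[OF u] left_linearD(3)[OF \<phi>] dual_basisD(1,2)[OF fs])
  then show ?thesis
    using dual_basis_transport[OF P P M N es fs rmod_hom_id u \<phi>] by simp
qed

section \<open>The reconstructed coring\<close>

lemma two_sided_module_cong:
  assumes "two_sided_module M"
    and "carrier N = carrier M" "add N = add M" "zero N = zero M" "ract N = ract M" "lact N = lact M"
  shows "two_sided_module N"
proof -
  have "abelian_group N"
    by (rule abelian_group_cong[OF two_sided_abelian[OF assms(1)]]) (simp_all add: assms)
  then show ?thesis
    using assms unfolding two_sided_module_def right_module_def left_module_def by simp
qed

lemma bimod_hom_cong_structure:
  assumes "carrier M = carrier M'" "add M = add M'" "ract M = ract M'" "lact M = lact M'"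
    and "carrier N = carrier N'" "add N = add N'" "ract N = ract N'" "lact N = lact N'"
  shows "bimod_hom M N f \<longleftrightarrow> bimod_hom M' N' f"
  using assms additive_map_cong_structure[of M M' N N' f] by (simp add: bimod_hom_def rmod_hom_def)

text \<open>The part of the coring axioms that makes the conditions on a coring map meaningful:
  both structure maps exist and are bilinear.\<close>

definition coring_data :: "('a::{comm_ring,monoid_mult},'c) coring \<Rightarrow> bool" where
  "coring_data C \<longleftrightarrow> two_sided_module C \<and> bimod_hom C (tensor UNIV C C) (comult C) \<and>
     bimod_hom C regular_bimod (counit C)"

lemma coring_dataD:
  assumes "coring_data C"
  shows "two_sided_module C" "bimod_hom C (tensor UNIV C C) (comult C)" "bimod_hom C regular_bimod (counit C)"
    "tensor_both UNIV C C" "right_module C" "left_module C" "abelian_group C"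
    "z \<in> carrier C \<Longrightarrow> comult C z \<in> carrier (tensor_ab UNIV C C)"
    "additive_map C (tensor_ab UNIV C C) (comult C)"
  using assms two_sided_moduleD[of C] two_sided_abelian[of C] tensor_both_UNIV[of C C]
    bimod_homD(5)[of C "tensor UNIV C C" "comult C"] bimod_homD(3)[of C "tensor UNIV C C" "comult C"]
  unfolding coring_data_def by simp_all

lemma is_coring_data: "is_coring \<eta>A C \<Longrightarrow> coring_data C"
  by (simp add: is_coring_def coring_data_def bimodule_iff)

locale fgp_category =
  fixes Ob :: "'o set" and U :: "'o \<Rightarrow> ('a::{comm_ring,monoid_mult},'m) rmod" and Hm :: "'o \<Rightarrow> 'o \<Rightarrow> ('m \<Rightarrow> 'm) set"
  assumes fg: "\<And>P. P \<in> Ob \<Longrightarrow> fg_projective (U P)"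
    and hom: "\<And>P Q t. P \<in> Ob \<Longrightarrow> Q \<in> Ob \<Longrightarrow> t \<in> Hm P Q \<Longrightarrow> rmod_hom (U P) (U Q) t"

sublocale fgp_category \<subseteq> module_category Ob U Hm
  by unfold_locales (use fg hom in \<open>auto simp: fg_projective_def\<close>)

context fgp_category
begin

abbreviation "C \<equiv> recon Ob U Hm"
abbreviation "basis P \<equiv> SOME es. dual_basis (U P) es"

lemma dual_basis_basis: "P \<in> Ob \<Longrightarrow> dual_basis (U P) (basis P)"
  using someI_ex[OF fg_projective_dual_basis[OF fg]] .

lemma recon_simps:
  "carrier C = carrier B" "zero C = zero B" "add C = add B" "ract C = ract B" "lact C = lact B"
  "comult C = recon_extend Ob U Hm (tensor UNIV B B) (\<lambda>P p' p.
           \<Oplus>\<^bsub>tensor UNIV B B\<^esub>i\<in>{..<length (basis P)}.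
             pure_tensor UNIV B B (cl P p' (fst (basis P ! i))) (cl P (snd (basis P ! i)) p))"
  "counit C = recon_extend Ob U Hm regular_bimod (\<lambda>P p' p. p' p)"
  by (simp_all add: recon_def bimod.extend_def coring.fields_def Let_def)

lemma tensor_C: "tensor_ab UNIV C C = tensor_ab UNIV B B" "pure_tensor UNIV C C = pure_tensor UNIV B B"
  "tensor_lift UNIV C C = tensor_lift UNIV B B"
  by (rule tensor_ab_cong; simp add: recon_simps)+

lemma two_sided_C: "two_sided_module C"
  by (rule two_sided_module_cong[OF two_sided_B]) (simp_all add: recon_simps)

sublocale CC: tensor_both UNIV C C
  by (rule tensor_both_UNIV[OF two_sided_C two_sided_C])

lemma class_C [simp]: "P \<in> Ob \<Longrightarrow> p' \<in> carrier (dl P) \<Longrightarrow> p \<in> carrier (U P) \<Longrightarrow> cl P p' p \<in> carrier C"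
  by (simp add: recon_simps)

lemma class_linear_right: "P \<in> Ob \<Longrightarrow> p' \<in> carrier (dl P) \<Longrightarrow> rmod_hom (U P) C (cl P p')"
  by (auto simp: rmod_hom_def recon_simps class_add_right class_ract intro!: additive_mapI)

lemma class_linear_left: "P \<in> Ob \<Longrightarrow> p \<in> carrier (U P) \<Longrightarrow> left_linear (dl P) C (\<lambda>p'. cl P p' p)"
  by (auto simp: left_linear_def recon_simps class_add_left class_lact intro!: additive_mapI)

lemma C_ext:
  assumes "abelian_group G" "additive_map C G h" "additive_map C G h'"
    and "\<And>P p' p. P \<in> Ob \<Longrightarrow> p' \<in> carrier (dl P) \<Longrightarrow> p \<in> carrier (U P) \<Longrightarrow> h (cl P p' p) = h' (cl P p' p)"
    and "X \<in> carrier C"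
  shows "h X = h' X"
proof (rule recon_ext[OF assms(1)])
  show "additive_map B G h" "additive_map B G h'"
    using assms(2,3) additive_map_cong_structure[of C B G G] by (simp_all add: recon_simps)
  show "X \<in> carrier B" using assms(5) by (simp add: recon_simps)
qed (rule assms(4))

lemma
  assumes "two_sided_module G" "natural_pairing Ob U Hm G \<beta>"
  shows extend_hom: "bimod_hom C G (recon_extend Ob U Hm G \<beta>)"
    and extend_class: "P \<in> Ob \<Longrightarrow> p' \<in> carrier (dl P) \<Longrightarrow> p \<in> carrier (U P) \<Longrightarrow>
      recon_extend Ob U Hm G \<beta> (cl P p' p) = \<beta> P p' p"
  using recon_extend_hom[OF assms] recon_extend_class[OF assms] bimod_hom_cong_structure[of C B G G]
  by (simp_all add: recon_simps)

text \<open>The comultiplication on the class of \<open>p\<^sup>* \<otimes> p\<close>. The dual basis is a parameter because maps between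
  reconstructed corings do not respect the chosen ones.\<close>

definition split_sum where
  "split_sum P es p' p = (\<Oplus>\<^bsub>CC.T\<^esub>i\<in>{..<length es}. CC.pt (cl P p' (fst (es ! i))) (cl P (snd (es ! i)) p))"

lemma split_sum_independent:
  assumes "P \<in> Ob" "dual_basis (U P) es" "dual_basis (U P) fs" "p' \<in> carrier (dl P)" "p \<in> carrier (U P)"
  shows "split_sum P fs p' p = split_sum P es p' p"
  unfolding split_sum_def
  by (rule dual_basis_independent[OF U_module[OF assms(1)] two_sided_moduleD(1,2)[OF two_sided_C] assms(2,3)
        class_linear_right[OF assms(1,4)] class_linear_left[OF assms(1,5)]])

text \<open>Naturality in \<open>t : P \<rightarrow> Q\<close> is \<open>dual_basis_transport\<close>: the classes of \<open>q\<^sup>* \<otimes> x\<close> are linear in \<open>x \<in> Q\<close>, those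
  of \<open>f \<otimes> p\<close> are linear in \<open>f \<in> P\<^sup>*\<close>.\<close>

lemma natural_pairing_split:
  "natural_pairing Ob U Hm (tensor UNIV C C) (\<lambda>P. split_sum P (basis P))"
  unfolding natural_pairing_def
proof (intro conjI ballI allI)
  fix P p' assume P: "P \<in> Ob" and p': "p' \<in> carrier (dl P)"
  note [simp] = dual_basisD(1,2)[OF dual_basis_basis[OF P]]
  have pt: "additive_map (U P) CC.T (\<lambda>p. CC.pt (cl P p' (fst (basis P ! i))) (cl P (snd (basis P ! i)) p))"
    if "i < length (basis P)" for i
    using that P p' rmod_homD(1)[OF class_linear_right]
    by (intro additive_map_comp[OF _ CC.additive_pure_right]) auto
  show "rmod_hom (U P) (tensor UNIV C C) (split_sum P (basis P) p')"
    unfolding rmod_hom_def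
  proof (intro conjI ballI allI)
    show "additive_map (U P) (tensor UNIV C C) (split_sum P (basis P) p')"
      unfolding split_sum_def additive_map_tensor_iff
      by (rule additive_map_sum_of_maps[OF CC.abelian_tensor]) (simp add: pt)
    fix p a assume p: "p \<in> carrier (U P)"
    have "ract (tensor UNIV C C) (split_sum P (basis P) p' p) a =
      (\<Oplus>\<^bsub>CC.T\<^esub>i\<in>{..<length (basis P)}. ract (tensor_r UNIV C C) (CC.pt (cl P p' (fst (basis P ! i))) (cl P (snd (basis P ! i)) p)) a)"
      unfolding split_sum_def ract_tensor
      using P p' p by (intro additive_map_finsum[OF CC.abelian_tensor CC.abelian_tensor CC.additive_ract_tensor]) auto
    also have "\<dots> = split_sum P (basis P) p' (ract (U P) p a)"
      unfolding split_sum_def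
      using P p' p rmod_homD(2)[OF class_linear_right] right_moduleD(2)[OF U_module]
      by (intro CC.T.finsum_cong')
        (auto simp: right_moduleD(2)[OF two_sided_moduleD(1)[OF two_sided_C]] simp del: CC.pure_closed intro!: CC.pure_closed)
    finally show "split_sum P (basis P) p' (ract (U P) p a) = ract (tensor UNIV C C) (split_sum P (basis P) p' p) a" ..
  qed
next
  fix P p assume P: "P \<in> Ob" and p: "p \<in> carrier (U P)"
  note [simp] = dual_basisD(1,2)[OF dual_basis_basis[OF P]]
  have pt: "additive_map (dl P) CC.T (\<lambda>p'. CC.pt (cl P p' (fst (basis P ! i))) (cl P (snd (basis P ! i)) p))"
    if "i < length (basis P)" for i
    using that P p left_linearD(1)[OF class_linear_left]
    by (intro additive_map_comp[OF _ CC.additive_pure_left]) auto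
  show "additive_map (dl P) (tensor UNIV C C) (\<lambda>p'. split_sum P (basis P) p' p)"
    unfolding split_sum_def additive_map_tensor_iff
    by (rule additive_map_sum_of_maps[OF CC.abelian_tensor]) (simp add: pt)
  fix p' a assume p': "p' \<in> carrier (dl P)"
  have "lact (tensor UNIV C C) a (split_sum P (basis P) p' p) =
      (\<Oplus>\<^bsub>CC.T\<^esub>i\<in>{..<length (basis P)}. lact (tensor UNIV C C) a (CC.pt (cl P p' (fst (basis P ! i))) (cl P (snd (basis P ! i)) p)))"
    unfolding split_sum_def
    using P p' p by (intro additive_map_finsum[OF CC.abelian_tensor CC.abelian_tensor CC.additive_lact_tensor]) auto
  also have "\<dots> = split_sum P (basis P) (lact (dl P) a p') p"
    unfolding split_sum_def
    using P p' p left_linearD(2)[OF class_linear_left] dual_closed(2)[OF U_module]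
    by (intro CC.T.finsum_cong')
      (auto simp: left_moduleD(2)[OF two_sided_moduleD(2)[OF two_sided_C]] simp del: CC.pure_closed intro!: CC.pure_closed)
  finally show "split_sum P (basis P) (lact (dl P) a p') p = lact (tensor UNIV C C) a (split_sum P (basis P) p' p)" ..
next
  fix P Q t p q' assume PQ: "P \<in> Ob" "Q \<in> Ob" "t \<in> Hm P Q" and p: "p \<in> carrier (U P)" and q': "q' \<in> carrier (dl Q)"
  note [simp] = dual_basisD(1,2)[OF dual_basis_basis[OF PQ(1)]] dual_basisD(1,2)[OF dual_basis_basis[OF PQ(2)]]
  have "split_sum Q (basis Q) q' (t p) =
    (\<Oplus>\<^bsub>CC.T\<^esub>j\<in>{..<length (basis Q)}. CC.pt (cl Q q' (fst (basis Q ! j))) (cl P (\<lambda>x\<in>carrier (U P). snd (basis Q ! j) (t x)) p))"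
    unfolding split_sum_def using PQ p q' hom_closed[OF PQ]
    by (intro CC.T.finsum_cong') (auto simp: class_hom[OF PQ p] intro!: CC.pure_closed class_C)
  also have "\<dots> = (\<Oplus>\<^bsub>CC.T\<^esub>i\<in>{..<length (basis P)}. CC.pt (cl Q q' (t (fst (basis P ! i)))) (cl P (snd (basis P ! i)) p))"
    by (rule dual_basis_transport[OF U_module[OF PQ(1)] U_module[OF PQ(2)] two_sided_moduleD(1,2)[OF two_sided_C]
          dual_basis_basis[OF PQ(1)] dual_basis_basis[OF PQ(2)] Hm_hom[OF PQ] class_linear_right[OF PQ(2) q']
          class_linear_left[OF PQ(1) p]])
  also have "\<dots> = split_sum P (basis P) (\<lambda>x\<in>carrier (U P). q' (t x)) p"
    unfolding split_sum_def using PQ p q' hom_closed[OF PQ]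
    by (intro CC.T.finsum_cong') (auto simp: class_hom[OF PQ _ q'] intro!: CC.pure_closed class_C)
  finally show "split_sum Q (basis Q) q' (t p) = split_sum P (basis P) (\<lambda>x\<in>carrier (U P). q' (t x)) p" .
qed

lemma comult_eq: "comult C = recon_extend Ob U Hm (tensor UNIV C C) (\<lambda>P. split_sum P (basis P))"
proof -
  have T: "tensor UNIV C C = tensor UNIV B B"
    by (simp add: tensor_def tensor_r_def tensor_C recon_simps)
  have "(\<lambda>P. split_sum P (basis P)) = (\<lambda>P p' p.
           \<Oplus>\<^bsub>tensor UNIV B B\<^esub>i\<in>{..<length (basis P)}.
             pure_tensor UNIV B B (cl P p' (fst (basis P ! i))) (cl P (snd (basis P ! i)) p))"
    unfolding split_sum_def by (intro ext) (simp add: tensor_C finsum_cong_structure[of "tensor UNIV B B" "tensor_ab UNIV B B"])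
  then show ?thesis by (simp add: recon_simps(6) T)
qed

lemma natural_pairing_eval: "natural_pairing Ob U Hm regular_bimod (\<lambda>P p' p. p' p)"
  unfolding natural_pairing_def
  by (auto simp: dual_bimod_simps intro!: additive_mapI)

lemma coring_data_C: "coring_data C"
proof -
  have "bimod_hom C (tensor UNIV C C) (comult C)"
    unfolding comult_eq by (rule extend_hom[OF CC.two_sided_module_tensor natural_pairing_split])
  moreover have "bimod_hom C regular_bimod (counit C)"
    unfolding recon_simps(7) by (rule extend_hom[OF two_sided_module_regular natural_pairing_eval])
  ultimately show ?thesis by (simp add: coring_data_def two_sided_C)
qed

lemma comult_class:
  assumes "P \<in> Ob" "dual_basis (U P) es" "p' \<in> carrier (dl P)" "p \<in> carrier (U P)"
  shows "comult C (cl P p' p) = split_sum P es p' p"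
  unfolding comult_eq extend_class[OF CC.two_sided_module_tensor natural_pairing_split assms(1,3,4)]
  by (rule split_sum_independent[OF assms(1,2) dual_basis_basis assms(3,4)]) fact

lemma counit_class:
  "P \<in> Ob \<Longrightarrow> p' \<in> carrier (dl P) \<Longrightarrow> p \<in> carrier (U P) \<Longrightarrow> counit C (cl P p' p) = p' p"
  unfolding recon_simps(7) by (rule extend_class[OF two_sided_module_regular natural_pairing_eval])

text \<open>Compatibility with the coring structure can be checked on generators, and with a dual basis adapted
  to each generator.\<close>

lemma coring_homI:
  assumes D: "coring_data D" and h: "bimod_hom C D h"
    and comult: "\<And>P p' p. P \<in> Ob \<Longrightarrow> p' \<in> carrier (dl P) \<Longrightarrow> p \<in> carrier (U P) \<Longrightarrow>
      \<exists>es. dual_basis (U P) es \<and> comult D (h (cl P p' p)) = (\<Oplus>\<^bsub>tensor_ab UNIV D D\<^esub>i\<in>{..<length es}.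
        pure_tensor UNIV D D (h (cl P p' (fst (es ! i)))) (h (cl P (snd (es ! i)) p)))"
    and counit: "\<And>P p' p. P \<in> Ob \<Longrightarrow> p' \<in> carrier (dl P) \<Longrightarrow> p \<in> carrier (U P) \<Longrightarrow>
      counit D (h (cl P p' p)) = p' p"
  shows "coring_hom C D h"
proof -
  interpret D: tensor_both UNIV D D by (rule coring_dataD(4)[OF D])
  note hr = bimod_homD(1)[OF h] and hl = bimod_hom_left_linear[OF h]
  note tm = additive_tensor_map[OF CC.tensor_pair_axioms D.tensor_pair_axioms hr hl]
  show ?thesis
    unfolding coring_hom_def
  proof (intro conjI ballI h)
    fix z assume z: "z \<in> carrier C"
    show "counit D (h z) = counit C z"
      by (rule C_ext[OF abelian_regular _ _ _ z])
        (auto simp: counit counit_class intro!: additive_map_comp[OF bimod_homD(3)[OF h]]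
          bimod_homD(3)[OF coring_dataD(3)[OF D]] bimod_homD(3)[OF coring_dataD(3)[OF coring_data_C]])
    show "comult D (h z) = tensor_map C C D D h h (comult C z)"
    proof (rule C_ext[OF D.abelian_tensor _ _ _ z])
      show "additive_map C D.T (\<lambda>z. comult D (h z))"
        by (rule additive_map_comp[OF bimod_homD(3)[OF h] coring_dataD(9)[OF D]])
      show "additive_map C D.T (\<lambda>z. tensor_map C C D D h h (comult C z))"
        by (rule additive_map_comp[OF coring_dataD(9)[OF coring_data_C] tm])
      fix P p' p assume P: "P \<in> Ob" and p': "p' \<in> carrier (dl P)" and p: "p \<in> carrier (U P)"
      from comult[OF this] obtain es where es: "dual_basis (U P) es"
        and c: "comult D (h (cl P p' p)) = (\<Oplus>\<^bsub>D.T\<^esub>i\<in>{..<length es}.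
          D.pt (h (cl P p' (fst (es ! i)))) (h (cl P (snd (es ! i)) p)))" by blast
      note [simp] = dual_basisD(1,2)[OF es]
      have "tensor_map C C D D h h (comult C (cl P p' p)) = (\<Oplus>\<^bsub>D.T\<^esub>i\<in>{..<length es}.
          tensor_map C C D D h h (CC.pt (cl P p' (fst (es ! i))) (cl P (snd (es ! i)) p)))"
        unfolding comult_class[OF P es p' p] split_sum_def
        using P p' p by (intro additive_map_finsum[OF CC.abelian_tensor D.abelian_tensor tm]) auto
      also have "\<dots> = comult D (h (cl P p' p))"
        unfolding c using P p' p
        by (intro D.T.finsum_cong')
          (auto simp: tensor_map_pure[OF CC.tensor_pair_axioms D.tensor_pair_axioms hr hl] bimod_homD(5)[OF h]
            intro!: D.pure_closed)
      finally show "comult D (h (cl P p' p)) = tensor_map C C D D h h (comult C (cl P p' p))" ..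
    qed
  qed
qed

end

lemma finsum_tensor [simp]:
  "finsum (tensor S M N) f I = finsum (tensor_ab S M N) f I"
  "finsum (tensor_r S' M' N') f' I' = finsum (tensor_ab S' M' N') f' I'"
  by (rule finsum_cong_structure; simp)+

lemma balanced_counit:
  assumes "coring_data C"
  shows "balanced UNIV C C C (\<lambda>x y. lact C (counit C x) y)" "balanced UNIV C C C (\<lambda>x y. ract C x (counit C y))"
proof -
  note e = bimod_homD[OF coring_dataD(3)[OF assms]]
  show "balanced UNIV C C C (\<lambda>x y. lact C (counit C x) y)" "balanced UNIV C C C (\<lambda>x y. ract C x (counit C y))"
    by (rule balancedI; simp add: e left_moduleD[OF coring_dataD(6)[OF assms]] right_moduleD[OF coring_dataD(5)[OF assms]])+
qed

context fgp_category
begin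

text \<open>On generators both sides are \<open>\<Sum> (p\<^sup>* \<otimes> e\<^sub>j) \<otimes> (e\<^sub>j\<^sup>* \<otimes> e\<^sub>i) \<otimes> (e\<^sub>i\<^sup>* \<otimes> p)\<close>, summed in different orders.\<close>

lemma coassociative:
  assumes z: "z \<in> carrier C"
  shows "tensor_assoc C C C (tensor_map C C (tensor UNIV C C) C (comult C) (\<lambda>y. y) (comult C z)) =
    tensor_map C C C (tensor UNIV C C) (\<lambda>x. x) (comult C) (comult C z)"
proof -
  have T2: "two_sided_module (tensor UNIV C C)" by (rule CC.two_sided_module_tensor)
  interpret L: tensor_both UNIV "tensor UNIV C C" C by (rule tensor_both_UNIV[OF T2 two_sided_C])
  interpret R: tensor_both UNIV C "tensor UNIV C C" by (rule tensor_both_UNIV[OF two_sided_C T2])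
  note \<Delta> = coring_dataD(2)[OF coring_data_C]
  note \<Delta>_closed = coring_dataD(8)[OF coring_data_C]
  let ?l = "tensor_map C C (tensor UNIV C C) C (comult C) (\<lambda>y. y)"
  let ?r = "tensor_map C C C (tensor UNIV C C) (\<lambda>x. x) (comult C)"
  note l_add = additive_tensor_map[OF CC.tensor_pair_axioms L.tensor_pair_axioms bimod_homD(1)[OF \<Delta>] left_linear_id]
  note l_pure = tensor_map_pure[OF CC.tensor_pair_axioms L.tensor_pair_axioms bimod_homD(1)[OF \<Delta>] left_linear_id]
  note r_add = additive_tensor_map[OF CC.tensor_pair_axioms R.tensor_pair_axioms rmod_hom_id bimod_hom_left_linear[OF \<Delta>]]
  note r_pure = tensor_map_pure[OF CC.tensor_pair_axioms R.tensor_pair_axioms rmod_hom_id bimod_hom_left_linear[OF \<Delta>]]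
  note a_add = additive_tensor_assoc[OF two_sided_moduleD(1)[OF two_sided_C] two_sided_C two_sided_C, folded tensor_left_cong]
  note a_pure = tensor_assoc_pure_pure[OF two_sided_moduleD(1)[OF two_sided_C] two_sided_C two_sided_C, folded tensor_left_cong]
  show ?thesis
  proof (rule C_ext[OF R.abelian_tensor _ _ _ z])
    show "additive_map C R.T (\<lambda>z. tensor_assoc C C C (?l (comult C z)))"
      by (rule additive_map_comp[OF coring_dataD(9)[OF coring_data_C] additive_map_comp[OF l_add a_add]])
    show "additive_map C R.T (\<lambda>z. ?r (comult C z))"
      by (rule additive_map_comp[OF coring_dataD(9)[OF coring_data_C] r_add])
    fix P p' p assume P: "P \<in> Ob" and p': "p' \<in> carrier (dl P)" and p: "p \<in> carrier (U P)"
    define n where "n = length (basis P)"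
    define e where "e i = fst (basis P ! i)" for i
    define e' where "e' i = snd (basis P ! i)" for i
    have es: "dual_basis (U P) (basis P)" using P by (rule dual_basis_basis)
    have e [simp]: "i < n \<Longrightarrow> e i \<in> carrier (U P)" "i < n \<Longrightarrow> e' i \<in> carrier (dl P)" for i
      using dual_basisD(1,2)[OF es] by (simp_all add: n_def e_def e'_def)
    have \<Delta>_cl: "comult C (cl P q' q) = (\<Oplus>\<^bsub>CC.T\<^esub>i\<in>{..<n}. CC.pt (cl P q' (e i)) (cl P (e' i) q))"
      if "q' \<in> carrier (dl P)" "q \<in> carrier (U P)" for q' q
      using comult_class[OF P es that] by (simp add: split_sum_def n_def e_def e'_def)
    have "tensor_assoc C C C (?l (comult C (cl P p' p))) =
        tensor_assoc C C C (\<Oplus>\<^bsub>L.T\<^esub>i\<in>{..<n}. ?l (CC.pt (cl P p' (e i)) (cl P (e' i) p)))"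
      unfolding \<Delta>_cl[OF p' p]
      using P p' p by (subst additive_map_finsum[OF CC.abelian_tensor L.abelian_tensor l_add]) auto
    also have "\<dots> = (\<Oplus>\<^bsub>R.T\<^esub>i\<in>{..<n}. tensor_assoc C C C (?l (CC.pt (cl P p' (e i)) (cl P (e' i) p))))"
      using P p' p by (intro additive_map_finsum[OF L.abelian_tensor R.abelian_tensor a_add] additive_map_closed[OF l_add]) auto
    also have "\<dots> = (\<Oplus>\<^bsub>R.T\<^esub>i\<in>{..<n}. \<Oplus>\<^bsub>R.T\<^esub>j\<in>{..<n}. R.pt (cl P p' (e j)) (CC.pt (cl P (e' j) (e i)) (cl P (e' i) p)))"
    proof (rule R.T.finsum_cong'[OF refl])
      fix i assume "i \<in> {..<n}"
      then have i: "i < n" by simp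
      have "?l (CC.pt (cl P p' (e i)) (cl P (e' i) p)) = L.pt (comult C (cl P p' (e i))) (cl P (e' i) p)"
        using P p' p i by (simp add: l_pure)
      also have "\<dots> = L.pt (\<Oplus>\<^bsub>tensor UNIV C C\<^esub>j\<in>{..<n}. CC.pt (cl P p' (e j)) (cl P (e' j) (e i))) (cl P (e' i) p)"
        using P p' i by (simp add: \<Delta>_cl)
      also have "\<dots> = (\<Oplus>\<^bsub>L.T\<^esub>j\<in>{..<n}. L.pt (CC.pt (cl P p' (e j)) (cl P (e' j) (e i))) (cl P (e' i) p))"
        using P p' p i by (intro L.pure_finsum_left) auto
      finally have "tensor_assoc C C C (?l (CC.pt (cl P p' (e i)) (cl P (e' i) p))) =
          (\<Oplus>\<^bsub>R.T\<^esub>j\<in>{..<n}. tensor_assoc C C C (L.pt (CC.pt (cl P p' (e j)) (cl P (e' j) (e i))) (cl P (e' i) p)))"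
        using P p' p i by (simp, intro additive_map_finsum[OF L.abelian_tensor R.abelian_tensor a_add]) auto
      then show "tensor_assoc C C C (?l (CC.pt (cl P p' (e i)) (cl P (e' i) p))) =
        (\<Oplus>\<^bsub>R.T\<^esub>j\<in>{..<n}. R.pt (cl P p' (e j)) (CC.pt (cl P (e' j) (e i)) (cl P (e' i) p)))"
        using P p' p i by (simp add: a_pure cong: R.T.finsum_cong)
    qed (use P p' p in \<open>auto intro!: R.T.finsum_closed\<close>)
    also have "\<dots> = (\<Oplus>\<^bsub>R.T\<^esub>j\<in>{..<n}. \<Oplus>\<^bsub>R.T\<^esub>i\<in>{..<n}. R.pt (cl P p' (e j)) (CC.pt (cl P (e' j) (e i)) (cl P (e' i) p)))"
      using P p' p by (intro finsum_swap[OF R.abelian_tensor]) auto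
    also have "\<dots> = (\<Oplus>\<^bsub>R.T\<^esub>j\<in>{..<n}. ?r (CC.pt (cl P p' (e j)) (cl P (e' j) p)))"
    proof (rule R.T.finsum_cong'[OF refl])
      fix j assume "j \<in> {..<n}"
      then have j: "j < n" by simp
      have "?r (CC.pt (cl P p' (e j)) (cl P (e' j) p)) = R.pt (cl P p' (e j)) (comult C (cl P (e' j) p))"
        using P p' p j by (simp add: r_pure)
      also have "\<dots> = R.pt (cl P p' (e j)) (\<Oplus>\<^bsub>tensor UNIV C C\<^esub>i\<in>{..<n}. CC.pt (cl P (e' j) (e i)) (cl P (e' i) p))"
        using P p j by (simp add: \<Delta>_cl)
      also have "\<dots> = (\<Oplus>\<^bsub>R.T\<^esub>i\<in>{..<n}. R.pt (cl P p' (e j)) (CC.pt (cl P (e' j) (e i)) (cl P (e' i) p)))"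
        using P p' p j by (intro R.pure_finsum_right) auto
      finally show "(\<Oplus>\<^bsub>R.T\<^esub>i\<in>{..<n}. R.pt (cl P p' (e j)) (CC.pt (cl P (e' j) (e i)) (cl P (e' i) p))) =
        ?r (CC.pt (cl P p' (e j)) (cl P (e' j) p))" ..
    qed (use P p' p in \<open>auto intro!: additive_map_closed[OF r_add]\<close>)
    also have "\<dots> = ?r (comult C (cl P p' p))"
      unfolding \<Delta>_cl[OF p' p]
      using P p' p by (intro additive_map_finsum[OF CC.abelian_tensor R.abelian_tensor r_add, symmetric]) auto
    finally show "tensor_assoc C C C (?l (comult C (cl P p' p))) = ?r (comult C (cl P p' p))" .
  qed
qed

text \<open>The two expansions \<open>\<Sum> p\<^sup>*(e\<^sub>i) e\<^sub>i\<^sup>* = p\<^sup>*\<close> and \<open>\<Sum> e\<^sub>i e\<^sub>i\<^sup>*(p) = p\<close>.\<close>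

lemma counital:
  assumes z: "z \<in> carrier C"
  shows "tensor_lift UNIV C C C (\<lambda>x y. lact C (counit C x) y) (comult C z) = z"
    and "tensor_lift UNIV C C C (\<lambda>x y. ract C x (counit C y)) (comult C z) = z"
proof -
  have CA: "abelian_group C" by (rule two_sided_abelian[OF two_sided_C])
  note b = balanced_counit[OF coring_data_C]
  have split: "tensor_lift UNIV C C C \<beta> (comult C (cl P p' p)) =
     (\<Oplus>\<^bsub>C\<^esub>i\<in>{..<length (basis P)}. \<beta> (cl P p' (fst (basis P ! i))) (cl P (snd (basis P ! i)) p))"
    if P: "P \<in> Ob" and p': "p' \<in> carrier (dl P)" and p: "p \<in> carrier (U P)" and \<beta>: "balanced UNIV C C C \<beta>" for P p' p \<beta>
  proof -
    note es = dual_basis_basis[OF P]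
    note [simp] = dual_basisD(1,2)[OF es]
    have "tensor_lift UNIV C C C \<beta> (comult C (cl P p' p)) =
      (\<Oplus>\<^bsub>C\<^esub>i\<in>{..<length (basis P)}. tensor_lift UNIV C C C \<beta> (CC.pt (cl P p' (fst (basis P ! i))) (cl P (snd (basis P ! i)) p)))"
      unfolding comult_class[OF P es p' p] split_sum_def
      using P p' p by (intro CC.lift_finsum[OF CA \<beta>]) auto
    also have "\<dots> = (\<Oplus>\<^bsub>C\<^esub>i\<in>{..<length (basis P)}. \<beta> (cl P p' (fst (basis P ! i))) (cl P (snd (basis P ! i)) p))"
      using P p' p balancedD(1)[OF \<beta>]
      by (intro abelian_monoid.finsum_cong'[OF abelian_group.axioms(1)[OF CA]]) (auto simp: CA \<beta>)
    finally show ?thesis .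
  qed
  show "tensor_lift UNIV C C C (\<lambda>x y. lact C (counit C x) y) (comult C z) = z"
  proof (rule C_ext[OF CA _ _ _ z])
    show "additive_map C C (\<lambda>z. tensor_lift UNIV C C C (\<lambda>x y. lact C (counit C x) y) (comult C z))"
      by (rule additive_map_comp[OF coring_dataD(9)[OF coring_data_C] CC.additive_lift[OF CA b(1)]])
    show "additive_map C C (\<lambda>z. z)" by (rule rmod_homD(1)[OF rmod_hom_id])
    fix P p' p assume P: "P \<in> Ob" and p': "p' \<in> carrier (dl P)" and p: "p \<in> carrier (U P)"
    note es = dual_basis_basis[OF P]
    note [simp] = dual_basisD(1,2)[OF es] dual_closed(2)[OF U_module] left_moduleD(2)[OF two_sided_moduleD(2)[OF two_sided_C]]
    have "(\<Oplus>\<^bsub>C\<^esub>i\<in>{..<length (basis P)}. lact C (counit C (cl P p' (fst (basis P ! i)))) (cl P (snd (basis P ! i)) p)) =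
      (\<Oplus>\<^bsub>C\<^esub>i\<in>{..<length (basis P)}. cl P (lact (dl P) (p' (fst (basis P ! i))) (snd (basis P ! i))) p)"
      using P p' p left_linearD(2)[OF class_linear_left[OF P p]]
      by (intro abelian_monoid.finsum_cong'[OF abelian_group.axioms(1)[OF CA]]) (auto simp: counit_class)
    also have "\<dots> = cl P (\<Oplus>\<^bsub>dl P\<^esub>i\<in>{..<length (basis P)}. lact (dl P) (p' (fst (basis P ! i))) (snd (basis P ! i))) p"
      using P by (intro additive_map_finsum[OF abelian_dual[OF U_module[OF P]] CA left_linearD(1)[OF class_linear_left[OF P p]], symmetric]) auto
    finally show "tensor_lift UNIV C C C (\<lambda>x y. lact C (counit C x) y) (comult C (cl P p' p)) = cl P p' p"
      using dual_expand[OF U_module[OF P] es p'] split[OF P p' p b(1)] by simp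
  qed
  show "tensor_lift UNIV C C C (\<lambda>x y. ract C x (counit C y)) (comult C z) = z"
  proof (rule C_ext[OF CA _ _ _ z])
    show "additive_map C C (\<lambda>z. tensor_lift UNIV C C C (\<lambda>x y. ract C x (counit C y)) (comult C z))"
      by (rule additive_map_comp[OF coring_dataD(9)[OF coring_data_C] CC.additive_lift[OF CA b(2)]])
    show "additive_map C C (\<lambda>z. z)" by (rule rmod_homD(1)[OF rmod_hom_id])
    fix P p' p assume P: "P \<in> Ob" and p': "p' \<in> carrier (dl P)" and p: "p \<in> carrier (U P)"
    note es = dual_basis_basis[OF P]
    note [simp] = dual_basisD(1,2)[OF es] right_moduleD(2)[OF U_module] right_moduleD(2)[OF two_sided_moduleD(1)[OF two_sided_C]]
    have "(\<Oplus>\<^bsub>C\<^esub>i\<in>{..<length (basis P)}. ract C (cl P p' (fst (basis P ! i))) (counit C (cl P (snd (basis P ! i)) p))) =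
      (\<Oplus>\<^bsub>C\<^esub>i\<in>{..<length (basis P)}. cl P p' (ract (U P) (fst (basis P ! i)) (snd (basis P ! i) p)))"
      using P p' p rmod_homD(2)[OF class_linear_right[OF P p']]
      by (intro abelian_monoid.finsum_cong'[OF abelian_group.axioms(1)[OF CA]]) (auto simp: counit_class)
    also have "\<dots> = cl P p' (\<Oplus>\<^bsub>U P\<^esub>i\<in>{..<length (basis P)}. ract (U P) (fst (basis P ! i)) (snd (basis P ! i) p))"
      using P by (intro additive_map_finsum[OF right_moduleD(1)[OF U_module[OF P]] CA rmod_homD(1)[OF class_linear_right[OF P p']], symmetric]) auto
    finally show "tensor_lift UNIV C C C (\<lambda>x y. ract C x (counit C y)) (comult C (cl P p' p)) = cl P p' p"
      using dual_basisD(3)[OF es p] split[OF P p' p b(2)] by simp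
  qed
qed

text \<open>Over \<open>\<bbbk>\<close> the two actions on \<open>P\<^sup>* \<otimes> P\<close> agree because scalar multiplications are morphisms of the
  category and hence can be moved across the tensor sign.\<close>

lemma is_coring_recon:
  assumes scalar: "\<And>P c. P \<in> Ob \<Longrightarrow> \<exists>t\<in>Hm P P. \<forall>p\<in>carrier (U P). t p = ract (U P) p (\<eta>A c)"
  shows "is_coring \<eta>A C"
proof -
  have "lact C (\<eta>A c) z = ract C z (\<eta>A c)" if z: "z \<in> carrier C" for z c
  proof (rule C_ext[OF two_sided_abelian[OF two_sided_C] _ _ _ z])
    show "additive_map C C (lact C (\<eta>A c))" "additive_map C C (\<lambda>z. ract C z (\<eta>A c))"
      by (rule additive_lact additive_ract, rule two_sided_moduleD[OF two_sided_C])+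
    fix P p' p assume P: "P \<in> Ob" and p': "p' \<in> carrier (dl P)" and p: "p \<in> carrier (U P)"
    obtain t where t: "t \<in> Hm P P" "\<And>p. p \<in> carrier (U P) \<Longrightarrow> t p = ract (U P) p (\<eta>A c)"
      using scalar[OF P] by blast
    have "lact (dl P) (\<eta>A c) p' = (\<lambda>x\<in>carrier (U P). p' (t x))"
      using dual_apply(2)[OF p'] by (auto simp: dual_bimod_simps(5) t(2) mult.commute)
    then have "lact C (\<eta>A c) (cl P p' p) = cl P (\<lambda>x\<in>carrier (U P). p' (t x)) p"
      using left_linearD(2)[OF class_linear_left[OF P p] p', of "\<eta>A c"] by simp
    also have "\<dots> = ract C (cl P p' p) (\<eta>A c)"
      using class_hom[OF P P t(1) p p'] rmod_homD(2)[OF class_linear_right[OF P p'] p] by (simp add: t(2) p)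
    finally show "lact C (\<eta>A c) (cl P p' p) = ract C (cl P p' p) (\<eta>A c)" .
  qed
  then show ?thesis
    using coring_data_C coassociative counital
    by (simp add: is_coring_def coring_data_def bimodule_iff)
qed

end

section \<open>Functoriality\<close>

text \<open>Objects of different categories are compared by their underlying modules. Equality of
  records would be too strict, as it includes the values of the action outside the carrier.\<close>

definition same_module :: "('a,'m,'y) rmod_scheme \<Rightarrow> ('a,'m,'z) rmod_scheme \<Rightarrow> bool" where
  "same_module M N \<longleftrightarrow> carrier N = carrier M \<and> add N = add M \<and> zero N = zero M \<and>
     (\<forall>m\<in>carrier M. \<forall>a. ract N m a = ract M m a)"

lemma same_module_refl: "same_module M M"
  by (simp add: same_module_def)

lemma same_module_sym: "same_module M N \<Longrightarrow> same_module N M"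
  by (simp add: same_module_def)

lemma same_module_trans: "same_module M N \<Longrightarrow> same_module N K \<Longrightarrow> same_module M K"
  by (simp add: same_module_def)

lemma same_module_rmod_hom:
  assumes "same_module M N" "same_module M' N'"
  shows "rmod_hom N N' f \<longleftrightarrow> rmod_hom M M' f"
  using assms additive_map_cong_structure[of N M N' M' f] additive_map_closed[of M M' f]
  by (auto simp: same_module_def rmod_hom_def)

lemma same_module_right_module: "same_module M N \<Longrightarrow> right_module M \<Longrightarrow> right_module N"
  using abelian_group_cong[of M N] abelian_monoid.a_closed[OF abelian_group.axioms(1), of M]
  by (auto simp: same_module_def right_module_def)

lemma same_module_fg_projective:
  assumes "same_module M N" "fg_projective M" shows "fg_projective N"
proof -
  obtain n i p where "rmod_hom M (free_rmod n) i" "rmod_hom (free_rmod n) M p" "\<forall>m\<in>carrier M. p (i m) = m"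
    using assms(2) unfolding fg_projective_def by blast
  then have "rmod_hom N (free_rmod n) i" "rmod_hom (free_rmod n) N p" "\<forall>m\<in>carrier N. p (i m) = m"
    using assms(1) same_module_rmod_hom[OF same_module_refl[of "free_rmod n"] assms(1)]
      same_module_rmod_hom[OF assms(1) same_module_refl[of "free_rmod n"]]
    by (auto simp: same_module_def)
  then show ?thesis
    using same_module_right_module[OF assms(1)] assms(2) unfolding fg_projective_def by blast
qed

lemma same_module_dual:
  fixes M N :: "('a::{comm_ring,monoid_mult},'m) rmod"
  assumes "same_module M N" shows "dual_bimod N = dual_bimod M"
  using assms same_module_rmod_hom[OF assms same_module_refl, of regular_bimod]
  by (simp add: dual_bimod_def same_module_def)

lemma same_module_dual_basis:
  fixes M N :: "('a::{comm_ring,monoid_mult},'m) rmod"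
  assumes M: "right_module M" and same: "same_module M N" and es: "dual_basis M es" shows "dual_basis N es"
proof -
  interpret M: abelian_group M using M by (rule right_moduleD)
  have "(\<Oplus>\<^bsub>N\<^esub>i\<in>{..<length es}. ract N (fst (es ! i)) (snd (es ! i) p)) =
      (\<Oplus>\<^bsub>M\<^esub>i\<in>{..<length es}. ract M (fst (es ! i)) (snd (es ! i) p))" for p
  proof -
    have "(\<Oplus>\<^bsub>N\<^esub>i\<in>{..<length es}. ract N (fst (es ! i)) (snd (es ! i) p)) =
      (\<Oplus>\<^bsub>M\<^esub>i\<in>{..<length es}. ract N (fst (es ! i)) (snd (es ! i) p))"
      using same by (intro finsum_cong_structure) (simp_all add: same_module_def)
    also have "\<dots> = (\<Oplus>\<^bsub>M\<^esub>i\<in>{..<length es}. ract M (fst (es ! i)) (snd (es ! i) p))"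
      using same dual_basisD(1)[OF es] right_moduleD(2)[OF M]
      by (intro M.finsum_cong') (auto simp: same_module_def)
    finally show ?thesis .
  qed
  then show ?thesis
    using es same unfolding dual_basis_def same_module_dual[OF same] by (simp add: same_module_def)
qed

text \<open>The formulas for the coring structure mention only the underlying modules, so every functor \<open>\<Phi>\<close> that
  leaves these unchanged is compatible with them. The morphisms of the source only enter through the
  relations that they impose.\<close>

lemma recon_functor:
  fixes U :: "'o \<Rightarrow> ('a::{comm_ring,monoid_mult},'m) rmod" and U' :: "'p \<Rightarrow> ('a,'m) rmod"
  assumes "fgp_category Ob U Hm" "fgp_category Ob' U' Hm'"
    and \<Phi>: "\<And>P. P \<in> Ob \<Longrightarrow> \<Phi> P \<in> Ob'" "\<And>P. P \<in> Ob \<Longrightarrow> same_module (U P) (U' (\<Phi> P))"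
    and Hm: "\<And>P Q. P \<in> Ob \<Longrightarrow> Q \<in> Ob \<Longrightarrow> Hm P Q \<subseteq> Hm' (\<Phi> P) (\<Phi> Q)"
  shows "\<exists>h. coring_hom (recon Ob U Hm) (recon Ob' U' Hm') h \<and>
    (\<forall>P\<in>Ob. \<forall>p'\<in>carrier (dual_bimod (U P)). \<forall>p\<in>carrier (U P).
       h (recon_class Ob U Hm P p' p) = recon_class Ob' U' Hm' (\<Phi> P) p' p)"
proof -
  interpret A: fgp_category Ob U Hm by fact
  interpret A': fgp_category Ob' U' Hm' by fact
  let ?\<beta> = "\<lambda>P. A'.cl (\<Phi> P)"
  have dl: "dual_bimod (U' (\<Phi> P)) = A.dl P" if "P \<in> Ob" for P
    using same_module_dual[OF \<Phi>(2)[OF that]] .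
  have cr: "carrier (U' (\<Phi> P)) = carrier (U P)" if "P \<in> Ob" for P
    using \<Phi>(2)[OF that] by (simp add: same_module_def)
  have nat: "natural_pairing Ob U Hm A'.C ?\<beta>"
    unfolding natural_pairing_def
  proof (intro conjI ballI allI)
    fix P p' assume "P \<in> Ob" "p' \<in> carrier (A.dl P)"
    then show "rmod_hom (U P) A'.C (A'.cl (\<Phi> P) p')"
      using same_module_rmod_hom[OF \<Phi>(2) same_module_refl[of A'.C]] A'.class_linear_right[of "\<Phi> P" p'] by (simp add: \<Phi>(1) dl)
  next
    fix P p assume "P \<in> Ob" "p \<in> carrier (U P)"
    then show "additive_map (A.dl P) A'.C (\<lambda>p'. A'.cl (\<Phi> P) p' p)"
      using left_linearD(1)[OF A'.class_linear_left[of "\<Phi> P" p]] by (simp add: \<Phi>(1) dl cr)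
    fix p' a assume "p' \<in> carrier (A.dl P)"
    then show "A'.cl (\<Phi> P) (lact (A.dl P) a p') p = lact A'.C a (A'.cl (\<Phi> P) p' p)"
      using \<open>P \<in> Ob\<close> \<open>p \<in> carrier (U P)\<close> left_linearD(2)[OF A'.class_linear_left[of "\<Phi> P" p]] by (simp add: \<Phi>(1) dl cr)
  next
    fix P Q t p q' assume *: "P \<in> Ob" "Q \<in> Ob" "t \<in> Hm P Q" "p \<in> carrier (U P)" "q' \<in> carrier (A.dl Q)"
    then show "A'.cl (\<Phi> Q) q' (t p) = A'.cl (\<Phi> P) (\<lambda>x\<in>carrier (U P). q' (t x)) p"
      using A'.class_hom[of "\<Phi> P" "\<Phi> Q" t p q'] Hm by (auto simp: \<Phi>(1) dl cr)
  qed
  define h where "h = recon_extend Ob U Hm A'.C ?\<beta>"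
  have h: "bimod_hom A.C A'.C h" and h_cl: "\<And>P p' p. P \<in> Ob \<Longrightarrow> p' \<in> carrier (A.dl P) \<Longrightarrow> p \<in> carrier (U P) \<Longrightarrow>
      h (A.cl P p' p) = A'.cl (\<Phi> P) p' p"
    unfolding h_def using A.extend_hom[OF A'.two_sided_C nat] A.extend_class[OF A'.two_sided_C nat] by simp_all
  have "coring_hom A.C A'.C h"
  proof (rule A.coring_homI[OF A'.coring_data_C h])
    fix P p' p assume P: "P \<in> Ob" and p': "p' \<in> carrier (A.dl P)" and p: "p \<in> carrier (U P)"
    show "counit A'.C (h (A.cl P p' p)) = p' p"
      using P p' p by (simp add: h_cl A'.counit_class \<Phi>(1) dl cr)
    have es: "dual_basis (U P) (A.basis P)" by (rule A.dual_basis_basis[OF P])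
    have es': "dual_basis (U' (\<Phi> P)) (A.basis P)"
      by (rule same_module_dual_basis[OF A.U_module[OF P] \<Phi>(2)[OF P] es])
    have "comult A'.C (h (A.cl P p' p)) = A'.split_sum (\<Phi> P) (A.basis P) p' p"
      using P p' p es' by (simp add: h_cl A'.comult_class \<Phi>(1) dl cr)
    also have "\<dots> = (\<Oplus>\<^bsub>A'.CC.T\<^esub>i\<in>{..<length (A.basis P)}.
        A'.CC.pt (h (A.cl P p' (fst (A.basis P ! i)))) (h (A.cl P (snd (A.basis P ! i)) p)))"
      unfolding A'.split_sum_def using P p' p dual_basisD(1,2)[OF es]
      by (intro A'.CC.T.finsum_cong') (auto simp: h_cl \<Phi>(1) dl cr intro!: A'.CC.pure_closed A'.class_C)
    finally show "\<exists>es. dual_basis (U P) es \<and> comult A'.C (h (A.cl P p' p)) = (\<Oplus>\<^bsub>A'.CC.T\<^esub>i\<in>{..<length es}.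
        A'.CC.pt (h (A.cl P p' (fst (es ! i)))) (h (A.cl P (snd (es ! i)) p)))"
      using es by blast
  qed
  then show ?thesis using h_cl by blast
qed

text \<open>The identity map imposes a relation between the two objects. In this way objects that return from a round
  trip through another category as different records still have the same classes.\<close>

lemma (in fgp_category) class_same_module:
  assumes "P \<in> Ob" "Q \<in> Ob" "same_module (U P) (U Q)" "(\<lambda>x\<in>carrier (U P). x) \<in> Hm P Q"
    and "p' \<in> carrier (dl P)" "p \<in> carrier (U P)"
  shows "cl Q p' p = cl P p' p"
proof -
  have "cl Q p' p = cl P (\<lambda>x\<in>carrier (U P). p' ((\<lambda>x\<in>carrier (U P). x) x)) p"
    using class_hom[OF assms(1,2,4), of p p'] assms(5,6) same_module_dual[OF assms(3)] by simp
  also have "(\<lambda>x\<in>carrier (U P). p' ((\<lambda>x\<in>carrier (U P). x) x)) = p'"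
    using dual_apply(3)[OF assms(5)] by auto
  finally show ?thesis .
qed

section \<open>Contraction with a functional\<close>

text \<open>The map \<open>p\<^sup>* \<otimes> N : M \<otimes> N \<rightarrow> N\<close>. The canonical map of a coring sends the class of \<open>p\<^sup>* \<otimes> p\<close> to the
  contraction of the coaction of \<open>p\<close> with \<open>p\<^sup>*\<close>.\<close>

definition contract ::
  "('a::{comm_ring,monoid_mult},'m,'y) rmod_scheme \<Rightarrow> ('a,'t,'n,'z) bimod_scheme \<Rightarrow> ('m \<Rightarrow> 'a) \<Rightarrow>
     (('m \<times> 'n) \<Rightarrow>\<^sub>0 int) set \<Rightarrow> 'n" where
  "contract M N p' = tensor_lift UNIV M N N (\<lambda>x c. lact N (p' x) c)"

lemma balanced_contract:
  assumes "left_module N" "rmod_hom M regular_bimod p'"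
  shows "balanced UNIV M N N (\<lambda>x c. lact N (p' x) c)"
  by (rule balancedI) (simp_all add: left_moduleD[OF assms(1)] rmod_homD[OF assms(2)])

lemma
  assumes "right_module M" "left_module N" "rmod_hom M regular_bimod p'"
  shows additive_contract: "additive_map (tensor_ab UNIV M N) N (contract M N p')"
    and contract_pure: "x \<in> carrier M \<Longrightarrow> c \<in> carrier N \<Longrightarrow> contract M N p' (pure_tensor UNIV M N x c) = lact N (p' x) c"
proof -
  interpret tensor_pair UNIV M N by (rule tensor_pair_UNIV[OF assms(1,2)])
  show "additive_map (tensor_ab UNIV M N) N (contract M N p')"
    and "x \<in> carrier M \<Longrightarrow> c \<in> carrier N \<Longrightarrow> contract M N p' (pure_tensor UNIV M N x c) = lact N (p' x) c"
    unfolding contract_def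
    using additive_lift[OF abelian_right balanced_contract[OF assms(2,3)]]
      lift_pure[OF abelian_right balanced_contract[OF assms(2,3)]] by simp_all
qed

lemma contract_natural:
  assumes M: "right_module M" and N: "left_module N" and N': "left_module N'" and p': "rmod_hom M regular_bimod p'"
    and g: "left_linear N N' g" and X: "X \<in> carrier (tensor_ab UNIV M N)"
  shows "contract M N' p' (tensor_map M N M N' (\<lambda>m. m) g X) = g (contract M N p' X)"
proof -
  interpret A: tensor_pair UNIV M N by (rule tensor_pair_UNIV[OF M N])
  interpret A': tensor_pair UNIV M N' by (rule tensor_pair_UNIV[OF M N'])
  show ?thesis
    by (rule A.tensor_ext[OF additive_map_comp[OF additive_tensor_map[OF A.tensor_pair_axioms A'.tensor_pair_axioms
              rmod_hom_id g] additive_contract[OF M N' p']]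
          additive_map_comp[OF additive_contract[OF M N p'] left_linearD(1)[OF g]] _ X])
      (simp add: tensor_map_pure[OF A.tensor_pair_axioms A'.tensor_pair_axioms rmod_hom_id g]
        contract_pure[OF M N p'] contract_pure[OF M N' p'] left_linearD[OF g])
qed

lemma contract_tensor_map:
  assumes M: "right_module M" and M': "right_module M'" and N: "left_module N"
    and p': "rmod_hom M regular_bimod p'" and q': "rmod_hom M' regular_bimod q'"
    and t: "rmod_hom M M' t" and eq: "\<And>x. x \<in> carrier M \<Longrightarrow> q' (t x) = p' x" and X: "X \<in> carrier (tensor_ab UNIV M N)"
  shows "contract M' N q' (tensor_map M N M' N t (\<lambda>c. c) X) = contract M N p' X"
proof -
  interpret A: tensor_pair UNIV M N by (rule tensor_pair_UNIV[OF M N])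
  interpret A': tensor_pair UNIV M' N by (rule tensor_pair_UNIV[OF M' N])
  show ?thesis
    by (rule A.tensor_ext[OF additive_map_comp[OF additive_tensor_map[OF A.tensor_pair_axioms A'.tensor_pair_axioms
              t left_linear_id] additive_contract[OF M' N q']] additive_contract[OF M N p'] _ X])
      (simp add: tensor_map_pure[OF A.tensor_pair_axioms A'.tensor_pair_axioms t left_linear_id]
        contract_pure[OF M N p'] contract_pure[OF M' N q'] rmod_homD(3)[OF t] eq)
qed

lemma contract_linear:
  assumes M: "right_module M" and N: "left_module N"
    and p': "rmod_hom M regular_bimod p'" and q': "rmod_hom M regular_bimod q'"
    and X: "X \<in> carrier (tensor_ab UNIV M N)"
  shows "rmod_hom M regular_bimod r' \<Longrightarrow> (\<And>x. x \<in> carrier M \<Longrightarrow> r' x = p' x + q' x) \<Longrightarrow>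
      contract M N r' X = contract M N p' X \<oplus>\<^bsub>N\<^esub> contract M N q' X"
    and "rmod_hom M regular_bimod s' \<Longrightarrow> (\<And>x. x \<in> carrier M \<Longrightarrow> s' x = a * p' x) \<Longrightarrow>
      contract M N s' X = lact N a (contract M N p' X)"
proof -
  interpret A: tensor_pair UNIV M N by (rule tensor_pair_UNIV[OF M N])
  note add = additive_contract[OF M N]
  show "contract M N r' X = contract M N p' X \<oplus>\<^bsub>N\<^esub> contract M N q' X"
    if r': "rmod_hom M regular_bimod r'" "\<And>x. x \<in> carrier M \<Longrightarrow> r' x = p' x + q' x"
  proof (rule A.tensor_ext[OF add[OF r'(1)] _ _ X])
    show "additive_map A.T N (\<lambda>X. contract M N p' X \<oplus>\<^bsub>N\<^esub> contract M N q' X)"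
      by (rule additive_mapI) (simp_all add: additive_map_closed[OF add] additive_map_add[OF add] p' q' A.N.a_ac)
  qed (simp add: contract_pure[OF M N] p' q' r' left_moduleD[OF N])
  show "contract M N s' X = lact N a (contract M N p' X)"
    if s': "rmod_hom M regular_bimod s'" "\<And>x. x \<in> carrier M \<Longrightarrow> s' x = a * p' x"
    by (rule A.tensor_ext[OF add[OF s'(1)] additive_map_comp[OF add[OF p'] additive_lact[OF N]] _ X])
      (simp add: contract_pure[OF M N] p' s' left_moduleD[OF N])
qed

lemma contract_ract:
  assumes M: "right_module M" and N: "two_sided_module N" and p': "rmod_hom M regular_bimod p'"
    and X: "X \<in> carrier (tensor_ab UNIV M N)"
  shows "contract M N p' (ract (tensor_r UNIV M N) X a) = ract N (contract M N p' X) a"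
proof -
  interpret A: tensor_right UNIV M N by (rule tensor_right_UNIV[OF M N])
  note NR = two_sided_moduleD(1)[OF N] and NL = two_sided_moduleD(2)[OF N]
  note add = additive_contract[OF M NL p']
  show ?thesis
    by (rule A.tensor_ext[OF additive_map_comp[OF A.additive_ract_tensor add] additive_map_comp[OF add additive_ract[OF NR]] _ X])
      (simp add: contract_pure[OF M NL p'] right_moduleD[OF NR] two_sided_moduleD(3)[OF N])
qed

lemma truncate_simps [simp]:
  "carrier (rmod.truncate M) = carrier M" "zero (rmod.truncate M) = zero M" "add (rmod.truncate M) = add M"
  "ract (rmod.truncate M) = ract M"
  by (simp_all add: rmod.truncate_def)

lemma same_module_truncate: "same_module M (rmod.truncate M)" "same_module (rmod.truncate M) M"
  by (simp_all add: same_module_def)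

lemma right_module_truncate [simp]: "right_module (rmod.truncate M) \<longleftrightarrow> right_module M"
  using same_module_right_module[OF same_module_truncate(2), of M] same_module_right_module[OF same_module_truncate(1), of M]
  by (rule iffI)

lemma dual_truncate_rmod_hom: "p' \<in> carrier (dual_bimod (rmod.truncate M)) \<Longrightarrow> rmod_hom M regular_bimod p'"
  using same_module_rmod_hom[OF same_module_truncate(1)[of M] same_module_refl[of regular_bimod], of p']
  by (simp add: dual_bimod_simps)

text \<open>On \<open>x \<otimes> c\<close> this is \<open>\<Sum> e\<^sub>i \<otimes> e\<^sub>i\<^sup>*(x) c = x \<otimes> c\<close>. So an element of \<open>M \<otimes> N\<close> is determined by its contractions.\<close>

lemma tensor_expand:
  assumes M: "right_module M" and N: "left_module N" and es: "dual_basis (rmod.truncate M) es"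
    and X: "X \<in> carrier (tensor_ab UNIV M N)"
  shows "(\<Oplus>\<^bsub>tensor_ab UNIV M N\<^esub>i\<in>{..<length es}. pure_tensor UNIV M N (fst (es ! i)) (contract M N (snd (es ! i)) X)) = X"
proof -
  interpret A: tensor_pair UNIV M N by (rule tensor_pair_UNIV[OF M N])
  have e: "i < length es \<Longrightarrow> fst (es ! i) \<in> carrier M" "i < length es \<Longrightarrow> rmod_hom M regular_bimod (snd (es ! i))" for i
    using dual_basisD(1,2)[OF es] dual_truncate_rmod_hom[of _ M] by simp_all
  note [simp] = e contract_pure[OF M N] left_moduleD(2)[OF N] right_moduleD(2)[OF M]
  show ?thesis
  proof (rule A.tensor_ext[OF _ _ _ X])
    show "additive_map A.T A.T (\<lambda>X. \<Oplus>\<^bsub>A.T\<^esub>i\<in>{..<length es}. A.pt (fst (es ! i)) (contract M N (snd (es ! i)) X))"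
      by (rule additive_map_sum_of_maps[OF A.abelian_tensor])
        (auto intro!: additive_map_comp[OF additive_contract[OF M N] A.additive_pure_right])
    show "additive_map A.T A.T (\<lambda>X. X)" by (rule rmod_homD(1)[OF rmod_hom_id, of "tensor_r UNIV M N", simplified])
    fix x c assume x: "x \<in> carrier M" and c: "c \<in> carrier N"
    have "(\<Oplus>\<^bsub>A.T\<^esub>i\<in>{..<length es}. A.pt (fst (es ! i)) (contract M N (snd (es ! i)) (A.pt x c))) =
      (\<Oplus>\<^bsub>A.T\<^esub>i\<in>{..<length es}. A.pt (ract M (fst (es ! i)) (snd (es ! i) x)) c)"
      using x c by (intro A.T.finsum_cong') (auto simp: A.pure_balanced intro!: A.pure_closed)
    also have "\<dots> = A.pt (\<Oplus>\<^bsub>M\<^esub>i\<in>{..<length es}. ract M (fst (es ! i)) (snd (es ! i) x)) c"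
      using c by (intro A.pure_finsum_left[symmetric]) auto
    also have "(\<Oplus>\<^bsub>M\<^esub>i\<in>{..<length es}. ract M (fst (es ! i)) (snd (es ! i) x)) = x"
      using dual_basisD(3)[OF es, of x] x
        finsum_cong_structure[of "rmod.truncate M" M "\<lambda>i. ract M (fst (es ! i)) (snd (es ! i) x)" "{..<length es}"]
      by simp
    finally show "(\<Oplus>\<^bsub>A.T\<^esub>i\<in>{..<length es}. A.pt (fst (es ! i)) (contract M N (snd (es ! i)) (A.pt x c))) = A.pt x c" .
  qed
qed

section \<open>Comodules and the canonical map\<close>

lemma comoduleD:
  assumes "comodule D M"
  shows "right_module M" "rmod_hom M (tensor_r UNIV M D) (coact M)"
    "m \<in> carrier M \<Longrightarrow> coact M m \<in> carrier (tensor_ab UNIV M D)"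
    "additive_map M (tensor_ab UNIV M D) (coact M)"
    "m \<in> carrier M \<Longrightarrow> coact M (ract M m a) = ract (tensor_r UNIV M D) (coact M m) a"
    "m \<in> carrier M \<Longrightarrow> tensor_assoc M D D (tensor_map M D (tensor_r UNIV M D) D (coact M) (\<lambda>c. c) (coact M m)) =
        tensor_map M D M (tensor UNIV D D) (\<lambda>n. n) (comult D) (coact M m)"
    "m \<in> carrier M \<Longrightarrow> tensor_lift UNIV M D M (\<lambda>n c. ract M n (counit D c)) (coact M m) = m"
  using assms rmod_homD[of M "tensor_r UNIV M D" "coact M"] unfolding comodule_def by simp_all

lemma contract_coact_hom:
  assumes D: "coring_data D" and M: "comodule D M" and p': "rmod_hom M regular_bimod p'"
  shows "rmod_hom M D (\<lambda>x. contract M D p' (coact M x))"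
  unfolding rmod_hom_def
  by (auto intro!: additive_map_comp[OF comoduleD(4)[OF M] additive_contract[OF comoduleD(1)[OF M] coring_dataD(6)[OF D] p']]
      simp: comoduleD[OF M] contract_ract[OF comoduleD(1)[OF M] coring_dataD(1)[OF D] p'])

text \<open>\<open>\<Delta>(p\<^sup>*(p\<^sub>0) p\<^sub>1) = p\<^sup>*(p\<^sub>0\<^sub>0) p\<^sub>0\<^sub>1 \<otimes> p\<^sub>1\<close>: contract the coassociativity law with \<open>p\<^sup>*\<close>.\<close>

lemma comult_contract:
  assumes D: "coring_data D" and M: "comodule D M" and p': "rmod_hom M regular_bimod p'" and p: "p \<in> carrier M"
  shows "comult D (contract M D p' (coact M p)) =
    tensor_map M D D D (\<lambda>x. contract M D p' (coact M x)) (\<lambda>c. c) (coact M p)"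
proof -
  note MR = comoduleD(1)[OF M] and D2 = coring_dataD(1)[OF D] and DL = coring_dataD(6)[OF D]
  interpret DD: tensor_both UNIV D D by (rule coring_dataD(4)[OF D])
  note DD2 = DD.two_sided_module_tensor and DDL = two_sided_moduleD(2)[OF DD.two_sided_module_tensor]
  interpret MD: tensor_right UNIV M D by (rule tensor_right_UNIV[OF MR D2])
  interpret L: tensor_right UNIV "tensor_r UNIV M D" D by (rule tensor_right_UNIV[OF MD.right_module_tensor_r D2])
  interpret R: tensor_right UNIV M "tensor UNIV D D" by (rule tensor_right_UNIV[OF MR DD2])
  let ?K = "\<lambda>x. contract M D p' (coact M x)"
  note K = contract_coact_hom[OF D M p']
  note K_add = additive_tensor_map[OF MD.tensor_pair_axioms DD.tensor_pair_axioms K left_linear_id]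
    and K_pure = tensor_map_pure[OF MD.tensor_pair_axioms DD.tensor_pair_axioms K left_linear_id]
  note l_add = additive_tensor_map[OF MD.tensor_pair_axioms L.tensor_pair_axioms comoduleD(2)[OF M] left_linear_id]
    and l_pure = tensor_map_pure[OF MD.tensor_pair_axioms L.tensor_pair_axioms comoduleD(2)[OF M] left_linear_id]
  note a_add = additive_tensor_assoc[OF MR D2 D2] and a_pure = tensor_assoc_pure[OF MR D2 D2]
  let ?V = "contract M (tensor UNIV D D) p'"
  have V_add: "additive_map R.T DD.T ?V"
    using additive_contract[OF MR DDL p'] by simp
  note pl = DD.left_linear_pure
  have "?V (tensor_assoc M D D (tensor_map M D (tensor_r UNIV M D) D (coact M) (\<lambda>c. c) X)) =
      tensor_map M D D D ?K (\<lambda>c. c) X" if X: "X \<in> carrier MD.T" for X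
  proof (rule MD.tensor_ext[OF additive_map_comp[OF additive_map_comp[OF l_add a_add] V_add] K_add _ X])
    fix x c assume x: "x \<in> carrier M" and c: "c \<in> carrier D"
    have "?V (tensor_assoc M D D (L.pt (coact M x) c)) = ?V (tensor_map M D M (tensor UNIV D D) (\<lambda>m. m) (\<lambda>n. DD.pt n c) (coact M x))"
      using x c by (simp add: a_pure comoduleD(3)[OF M])
    also have "\<dots> = DD.pt (?K x) c"
      using x by (intro contract_natural[OF MR DL DDL p' pl[OF c]] comoduleD(3)[OF M])
    finally show "?V (tensor_assoc M D D (tensor_map M D (tensor_r UNIV M D) D (coact M) (\<lambda>c. c) (MD.pt x c))) =
      tensor_map M D D D ?K (\<lambda>c. c) (MD.pt x c)"
      using x c by (simp add: l_pure K_pure)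
  qed
  note * = this[OF comoduleD(3)[OF M p]]
  have "comult D (?K p) = ?V (tensor_map M D M (tensor UNIV D D) (\<lambda>m. m) (comult D) (coact M p))"
    by (rule contract_natural[OF MR DL DDL p' bimod_hom_left_linear[OF coring_dataD(2)[OF D]] comoduleD(3)[OF M p], symmetric])
  then show ?thesis
    using * comoduleD(6)[OF M p] by simp
qed

lemma counit_contract:
  assumes D: "coring_data D" and M: "comodule D M" and p': "rmod_hom M regular_bimod p'" and p: "p \<in> carrier M"
  shows "counit D (contract M D p' (coact M p)) = p' p"
proof -
  note MR = comoduleD(1)[OF M] and DL = coring_dataD(6)[OF D]
  interpret MD: tensor_pair UNIV M D by (rule tensor_pair_UNIV[OF MR DL])
  note e = bimod_homD[OF coring_dataD(3)[OF D]]
  have b: "balanced UNIV M D M (\<lambda>n c. ract M n (counit D c))"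
    by (rule balancedI) (simp_all add: e right_moduleD[OF MR])
  have "counit D (contract M D p' X) = p' (tensor_lift UNIV M D M (\<lambda>n c. ract M n (counit D c)) X)"
    if X: "X \<in> carrier MD.T" for X
    by (rule MD.tensor_ext[OF additive_map_comp[OF additive_contract[OF MR DL p'] e(3)]
          additive_map_comp[OF MD.additive_lift[OF MD.abelian_left b] rmod_homD(1)[OF p']] _ X])
      (simp add: contract_pure[OF MR DL p'] e MD.abelian_left b rmod_homD(2)[OF p'])
  from this[OF comoduleD(3)[OF M p]] show ?thesis by (simp add: comoduleD(7)[OF M p])
qed

lemma comod_HomD:
  assumes "t \<in> comod_Hom D M N"
  shows "comodule_hom D M N t" "rmod_hom M N t"
    "m \<in> carrier M \<Longrightarrow> coact N (t m) = tensor_map M D N D t (\<lambda>c. c) (coact M m)"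
  using assms by (auto simp: comod_Hom_def comodule_hom_def)

lemma fgp_category_comod: "fgp_category (comod_Ob D) rmod.truncate (comod_Hom D)"
proof
  fix P assume "P \<in> comod_Ob D"
  then show "fg_projective (rmod.truncate P)"
    using same_module_fg_projective[OF same_module_truncate(1)] by (auto simp: comod_Ob_def)
next
  fix P Q t assume "t \<in> comod_Hom D P Q"
  then show "rmod_hom (rmod.truncate P) (rmod.truncate Q) t"
    using same_module_rmod_hom[OF same_module_truncate(1) same_module_truncate(1)] comod_HomD(2) by blast
qed

locale coring_loc =
  fixes D :: "('a::{comm_ring,monoid_mult},'c) coring"
  assumes data: "coring_data D"
begin

sublocale A: fgp_category "comod_Ob D" rmod.truncate "comod_Hom D"
  by (rule fgp_category_comod)

lemma DL: "left_module D" and D2: "two_sided_module D"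
  using coring_dataD[OF data] by auto

lemma comod: "P \<in> comod_Ob D \<Longrightarrow> comodule D P"
  and comod_right: "P \<in> comod_Ob D \<Longrightarrow> right_module P"
  using comoduleD(1) by (auto simp: comod_Ob_def)

lemma natural_pairing_can:
  "natural_pairing (comod_Ob D) rmod.truncate (comod_Hom D) D (\<lambda>P p' p. contract P D p' (coact P p))"
  unfolding natural_pairing_def
proof (intro conjI ballI allI)
  fix P p' assume P: "P \<in> comod_Ob D" and "p' \<in> carrier (A.dl P)"
  then have p': "rmod_hom P regular_bimod p'" by (simp add: dual_truncate_rmod_hom)
  note M = comod[OF P] and MR = comod_right[OF P]
  have "rmod_hom P D (\<lambda>p. contract P D p' (coact P p))" by (rule contract_coact_hom[OF data M p'])
  then show "rmod_hom (rmod.truncate P) D (\<lambda>p. contract P D p' (coact P p))"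
    using same_module_rmod_hom[OF same_module_truncate(1)[of P] same_module_refl[of D]] by simp
next
  fix P p assume P: "P \<in> comod_Ob D" and "p \<in> carrier (rmod.truncate P)"
  then have p: "p \<in> carrier P" by simp
  note M = comod[OF P] and MR = comod_right[OF P]
  note X = comoduleD(3)[OF M p]
  note d = dual_truncate_rmod_hom[of _ P] and cl = dual_closed[OF A.U_module[OF P]]
  show "additive_map (A.dl P) D (\<lambda>p'. contract P D p' (coact P p))"
  proof (rule additive_mapI)
    fix p' q' assume p': "p' \<in> carrier (A.dl P)" and q': "q' \<in> carrier (A.dl P)"
    show "contract P D (p' \<oplus>\<^bsub>A.dl P\<^esub> q') (coact P p) = contract P D p' (coact P p) \<oplus>\<^bsub>D\<^esub> contract P D q' (coact P p)"
      by (rule contract_linear(1)[OF MR DL d[OF p'] d[OF q'] X d[OF cl(1)[OF p' q']]]) (simp_all add: dual_bimod_simps(3))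
  qed (use additive_map_closed[OF additive_contract[OF MR DL d] X] in simp)
  fix p' a assume p': "p' \<in> carrier (A.dl P)"
  show "contract P D (lact (A.dl P) a p') (coact P p) = lact D a (contract P D p' (coact P p))"
    by (rule contract_linear(2)[OF MR DL d[OF p'] d[OF p'] X d[OF cl(2)[OF p']]]) (simp_all add: dual_bimod_simps(5))
next
  fix P Q t p q' assume P: "P \<in> comod_Ob D" and Q: "Q \<in> comod_Ob D" and t: "t \<in> comod_Hom D P Q"
    and "p \<in> carrier (rmod.truncate P)" and q': "q' \<in> carrier (A.dl Q)"
  then have p: "p \<in> carrier P" by simp
  show "contract Q D q' (coact Q (t p)) = contract P D (\<lambda>x\<in>carrier (rmod.truncate P). q' (t x)) (coact P p)"
    unfolding comod_HomD(3)[OF t p]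
    by (rule contract_tensor_map[OF comod_right[OF P] comod_right[OF Q] DL
          dual_truncate_rmod_hom[OF A.hom_closed(2)[OF P Q t q']] dual_truncate_rmod_hom[OF q'] comod_HomD(2)[OF t] _
          comoduleD(3)[OF comod[OF P] p]]) simp
qed

lemma can_eq: "can_map D = recon_extend (comod_Ob D) rmod.truncate (comod_Hom D) D (\<lambda>P p' p. contract P D p' (coact P p))"
  by (simp add: can_map_def contract_def)

lemma recon_eq: "comod_recon D = A.C"
  by (simp add: comod_recon_def)

lemma can_class:
  "P \<in> comod_Ob D \<Longrightarrow> p' \<in> carrier (A.dl P) \<Longrightarrow> p \<in> carrier P \<Longrightarrow> can_map D (A.cl P p' p) = contract P D p' (coact P p)"
  unfolding can_eq by (rule A.extend_class[OF D2 natural_pairing_can]) simp_all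

text \<open>By \<open>comult_contract\<close> the comultiplication of \<open>p\<^sup>*(p\<^sub>0) p\<^sub>1\<close> is obtained from the coaction of \<open>p\<close> by applying
  \<open>x \<mapsto> p\<^sup>*(x\<^sub>0) x\<^sub>1\<close> to the left factor; expand the coaction by \<open>tensor_expand\<close>.\<close>

lemma coring_hom_can: "coring_hom (comod_recon D) D (can_map D)"
  unfolding recon_eq
proof (rule A.coring_homI[OF data])
  show "bimod_hom A.C D (can_map D)"
    unfolding can_eq by (rule A.extend_hom[OF D2 natural_pairing_can])
  fix P p' p assume P: "P \<in> comod_Ob D" and p': "p' \<in> carrier (A.dl P)" and "p \<in> carrier (rmod.truncate P)"
  then have p: "p \<in> carrier P" by simp
  note M = comod[OF P] and MR = comod_right[OF P]
  note d = dual_truncate_rmod_hom[of _ P]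
  note X = comoduleD(3)[OF M p]
  show "counit D (can_map D (A.cl P p' p)) = p' p"
    using counit_contract[OF data M d[OF p'] p] by (simp add: can_class[OF P p' p])
  note es = A.dual_basis_basis[OF P]
  have e: "i < length (A.basis P) \<Longrightarrow> fst (A.basis P ! i) \<in> carrier P"
    "i < length (A.basis P) \<Longrightarrow> snd (A.basis P ! i) \<in> carrier (A.dl P)" for i
    using dual_basisD(1,2)[OF es] by simp_all
  interpret DD: tensor_both UNIV D D by (rule coring_dataD(4)[OF data])
  interpret MD: tensor_right UNIV P D by (rule tensor_right_UNIV[OF MR D2])
  let ?K = "\<lambda>x. contract P D p' (coact P x)"
  note K = contract_coact_hom[OF data M d[OF p']]
  note K_add = additive_tensor_map[OF MD.tensor_pair_axioms DD.tensor_pair_axioms K left_linear_id]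
    and K_pure = tensor_map_pure[OF MD.tensor_pair_axioms DD.tensor_pair_axioms K left_linear_id]
  have c_closed: "contract P D q' (coact P p) \<in> carrier D" if "q' \<in> carrier (A.dl P)" for q'
    using additive_map_closed[OF additive_contract[OF MR DL d[OF that]] X] .
  have "comult D (can_map D (A.cl P p' p)) = tensor_map P D D D ?K (\<lambda>c. c) (coact P p)"
    using comult_contract[OF data M d[OF p'] p] by (simp add: can_class[OF P p' p])
  also have "\<dots> = tensor_map P D D D ?K (\<lambda>c. c) (\<Oplus>\<^bsub>MD.T\<^esub>i\<in>{..<length (A.basis P)}.
      MD.pt (fst (A.basis P ! i)) (contract P D (snd (A.basis P ! i)) (coact P p)))"
    using tensor_expand[OF MR DL es X] by simp
  also have "\<dots> = (\<Oplus>\<^bsub>DD.T\<^esub>i\<in>{..<length (A.basis P)}. tensor_map P D D D ?K (\<lambda>c. c)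
      (MD.pt (fst (A.basis P ! i)) (contract P D (snd (A.basis P ! i)) (coact P p))))"
    by (rule additive_map_finsum[OF MD.abelian_tensor DD.abelian_tensor K_add]) (auto simp: e c_closed)
  also have "\<dots> = (\<Oplus>\<^bsub>DD.T\<^esub>i\<in>{..<length (A.basis P)}.
      DD.pt (can_map D (A.cl P p' (fst (A.basis P ! i)))) (can_map D (A.cl P (snd (A.basis P ! i)) p)))"
    by (rule DD.T.finsum_cong'[OF refl])
      (auto simp: e c_closed K_pure can_class P p p' rmod_homD(3)[OF K] intro!: DD.pure_closed)
  finally show "\<exists>es. dual_basis (rmod.truncate P) es \<and> comult D (can_map D (A.cl P p' p)) =
      (\<Oplus>\<^bsub>DD.T\<^esub>i\<in>{..<length es}. DD.pt (can_map D (A.cl P p' (fst (es ! i)))) (can_map D (A.cl P (snd (es ! i)) p)))"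
    using es by blast
qed

end

section \<open>Coring maps\<close>

lemma tensor_map_comp:
  assumes "tensor_pair UNIV M N" "tensor_pair UNIV M' N'" "tensor_pair UNIV M'' N''"
    and f: "rmod_hom M M' f" "left_linear N N' f'" and g: "rmod_hom M' M'' g" "left_linear N' N'' g'"
    and h: "rmod_hom M M'' h" "left_linear N N'' h'"
    and eq: "\<And>x. x \<in> carrier M \<Longrightarrow> g (f x) = h x" "\<And>x. x \<in> carrier N \<Longrightarrow> g' (f' x) = h' x"
    and X: "X \<in> carrier (tensor_ab UNIV M N)"
  shows "tensor_map M' N' M'' N'' g g' (tensor_map M N M' N' f f' X) = tensor_map M N M'' N'' h h' X"
proof -
  interpret A: tensor_pair UNIV M N by fact
  note fa = additive_tensor_map[OF assms(1,2) f] and fp = tensor_map_pure[OF assms(1,2) f]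
    and ga = additive_tensor_map[OF assms(2,3) g] and gp = tensor_map_pure[OF assms(2,3) g]
    and ha = additive_tensor_map[OF assms(1,3) h] and hp = tensor_map_pure[OF assms(1,3) h]
  show ?thesis
    by (rule A.tensor_ext[OF additive_map_comp[OF fa ga] ha _ X])
      (simp add: fp gp hp rmod_homD(3)[OF f(1)] left_linearD(3)[OF f(2)] eq)
qed

lemma tensor_map_id:
  assumes "tensor_pair UNIV M N" "X \<in> carrier (tensor_ab UNIV M N)"
  shows "tensor_map M N M N (\<lambda>x. x) (\<lambda>x. x) X = X"
proof -
  interpret A: tensor_pair UNIV M N by fact
  have "additive_map A.T A.T (\<lambda>x. x)" by (simp add: additive_map_def hom_def)
  then show ?thesis
    by (rule A.tensor_ext[OF additive_tensor_map[OF assms(1,1) rmod_hom_id left_linear_id] _ _ assms(2)])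
      (simp add: tensor_map_pure[OF assms(1,1) rmod_hom_id left_linear_id])
qed

lemma coring_homD:
  assumes "coring_hom C D f"
  shows "bimod_hom C D f" "rmod_hom C D f" "left_linear C D f" "additive_map C D f"
    "z \<in> carrier C \<Longrightarrow> f z \<in> carrier D"
    "z \<in> carrier C \<Longrightarrow> comult D (f z) = tensor_map C C D D f f (comult C z)"
    "z \<in> carrier C \<Longrightarrow> counit D (f z) = counit C z"
  using assms bimod_homD[of C D f] bimod_hom_left_linear[of C D f] unfolding coring_hom_def by auto

lemma bimod_hom_comp:
  assumes "bimod_hom C D f" "bimod_hom D E g" shows "bimod_hom C E (\<lambda>x. g (f x))"
  using additive_map_comp[OF bimod_homD(3)[OF assms(1)] bimod_homD(3)[OF assms(2)]] bimod_homD[OF assms(1)] bimod_homD[OF assms(2)]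
  by (simp add: bimod_hom_def rmod_hom_def)

lemma coring_data_pair: "coring_data C \<Longrightarrow> tensor_pair UNIV C C"
  using coring_dataD(5,6) tensor_pair_UNIV by blast

lemma coring_hom_comp:
  assumes C: "coring_data C" and D: "coring_data D" and E: "coring_data E"
    and f: "coring_hom C D f" and g: "coring_hom D E g"
  shows "coring_hom C E (\<lambda>x. g (f x))"
proof -
  have gf: "bimod_hom C E (\<lambda>x. g (f x))" by (rule bimod_hom_comp[OF coring_homD(1)[OF f] coring_homD(1)[OF g]])
  show ?thesis
    unfolding coring_hom_def
  proof (intro conjI ballI gf)
    fix z assume z: "z \<in> carrier C"
    show "counit E (g (f z)) = counit C z"
      using coring_homD(5,7)[OF f z] coring_homD(7)[OF g] by simp
    show "comult E (g (f z)) = tensor_map C C E E (\<lambda>x. g (f x)) (\<lambda>x. g (f x)) (comult C z)"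
      using coring_homD(5,6)[OF f z] coring_homD(6)[OF g]
        tensor_map_comp[OF coring_data_pair[OF C] coring_data_pair[OF D] coring_data_pair[OF E] coring_homD(2,3)[OF f]
          coring_homD(2,3)[OF g] bimod_homD(1)[OF gf] bimod_hom_left_linear[OF gf] refl refl coring_dataD(8)[OF C z]]
      by simp
  qed
qed

lemma coring_hom_id:
  assumes "coring_data C" shows "coring_hom C C (\<lambda>x. x)"
  using tensor_map_id[OF coring_data_pair[OF assms]] coring_dataD(8)[OF assms] rmod_hom_id left_linear_id[of C]
  by (simp add: coring_hom_def bimod_hom_iff)

section \<open>Property \<open>(*)\<close>\<close>

lemma ring_dual_simps [simp]:
  "f \<in> carrier (ring_dual \<iota>) \<longleftrightarrow> (\<forall>x y. f (x + y) = f x + f y) \<and> (\<forall>x a. f (x * \<iota> a) = f x * a)"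
  "zero (ring_dual \<iota>) = (\<lambda>r. 0)" "add (ring_dual \<iota>) = (\<lambda>f g r. f r + g r)"
  "ract (ring_dual \<iota>) f b = (\<lambda>r. f (\<iota> b * r))" "lact (ring_dual \<iota>) a f = (\<lambda>r. a * f r)"
  by (simp_all add: ring_dual_def)

lemma unital_ring_homD:
  assumes "unital_ring_hom h"
  shows "h 1 = 1" "h (x + y) = h x + h y" "h (x * y) = h x * h y"
  using assms by (simp_all add: unital_ring_hom_def)

lemma two_sided_ring_dual:
  assumes "unital_ring_hom \<iota>" shows "two_sided_module (ring_dual \<iota>)"
proof -
  note [simp] = unital_ring_homD[OF assms]
  have "abelian_group (ring_dual \<iota>)"
  proof (rule abelian_groupI)
    fix f assume "f \<in> carrier (ring_dual \<iota>)"
    then show "\<exists>g\<in>carrier (ring_dual \<iota>). g \<oplus>\<^bsub>ring_dual \<iota>\<^esub> f = \<zero>\<^bsub>ring_dual \<iota>\<^esub>"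
      by (intro bexI[of _ "\<lambda>r. - f r"]) auto
  qed (auto simp: algebra_simps)
  then show ?thesis
    unfolding two_sided_module_def right_module_def left_module_def
    by (auto simp: algebra_simps) (metis mult.assoc mult.commute)
qed

lemma star_mapD:
  assumes "star_map \<iota> D f"
  shows "bimod_hom D (ring_dual \<iota>) f"
    "z \<in> carrier D \<Longrightarrow> f z (x + y) = f z x + f z y" "z \<in> carrier D \<Longrightarrow> f z (x * \<iota> a) = f z x * a"
    "z \<in> carrier D \<Longrightarrow> w \<in> carrier D \<Longrightarrow> f (z \<oplus>\<^bsub>D\<^esub> w) x = f z x + f w x"
    "z \<in> carrier D \<Longrightarrow> f (lact D a z) x = a * f z x" "z \<in> carrier D \<Longrightarrow> f (ract D z a) x = f z (\<iota> a * x)"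
    "z \<in> carrier D \<Longrightarrow> f z (x * y) = tensor_lift UNIV D D regular_bimod (\<lambda>z1 z2. f z1 (\<iota> (f z2 x) * y)) (comult D z)"
    "z \<in> carrier D \<Longrightarrow> f z 1 = counit D z"
proof -
  show f: "bimod_hom D (ring_dual \<iota>) f" using assms by (simp add: star_map_def)
  show "z \<in> carrier D \<Longrightarrow> f z (x + y) = f z x + f z y" "z \<in> carrier D \<Longrightarrow> f z (x * \<iota> a) = f z x * a"
    "z \<in> carrier D \<Longrightarrow> w \<in> carrier D \<Longrightarrow> f (z \<oplus>\<^bsub>D\<^esub> w) x = f z x + f w x"
    "z \<in> carrier D \<Longrightarrow> f (lact D a z) x = a * f z x" "z \<in> carrier D \<Longrightarrow> f (ract D z a) x = f z (\<iota> a * x)"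
    using bimod_homD[OF f] by (auto simp: fun_eq_iff)
  show "z \<in> carrier D \<Longrightarrow> f z (x * y) = tensor_lift UNIV D D regular_bimod (\<lambda>z1 z2. f z1 (\<iota> (f z2 x) * y)) (comult D z)"
    "z \<in> carrier D \<Longrightarrow> f z 1 = counit D z"
    using assms by (simp_all add: star_map_def)
qed

lemma balanced_star_product:
  assumes "unital_ring_hom \<iota>" "bimod_hom D (ring_dual \<iota>) f"
  shows "balanced UNIV D D regular_bimod (\<lambda>z1 z2. f z1 (\<iota> (f z2 x) * y))"
  using bimod_homD(4,5,6)[OF assms(2)] bimod_homD(2)[OF assms(2)]
  by (intro balancedI) (auto simp: fun_eq_iff unital_ring_homD[OF assms(1)] algebra_simps)

lemma star_map_comp:
  assumes \<iota>: "unital_ring_hom \<iota>" and C: "coring_data C" and D: "coring_data D"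
    and h: "coring_hom C D h" and f: "star_map \<iota> D f"
  shows "star_map \<iota> C (\<lambda>z. f (h z))"
proof -
  interpret CC: tensor_pair UNIV C C by (rule coring_data_pair[OF C])
  interpret DD: tensor_pair UNIV D D by (rule coring_data_pair[OF D])
  have fh: "bimod_hom C (ring_dual \<iota>) (\<lambda>z. f (h z))" by (rule bimod_hom_comp[OF coring_homD(1)[OF h] star_mapD(1)[OF f]])
  note t = additive_tensor_map[OF CC.tensor_pair_axioms DD.tensor_pair_axioms coring_homD(2,3)[OF h]]
    tensor_map_pure[OF CC.tensor_pair_axioms DD.tensor_pair_axioms coring_homD(2,3)[OF h]]
  have product: "tensor_lift UNIV D D regular_bimod (\<lambda>z1 z2. f z1 (\<iota> (f z2 x) * y)) (tensor_map C C D D h h X) =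
      tensor_lift UNIV C C regular_bimod (\<lambda>z1 z2. f (h z1) (\<iota> (f (h z2) x) * y)) X" if X: "X \<in> carrier CC.T" for X x y
    by (rule CC.tensor_ext[OF additive_map_comp[OF t(1) DD.additive_lift[OF abelian_regular balanced_star_product[OF \<iota> star_mapD(1)[OF f]]]]
          CC.additive_lift[OF abelian_regular balanced_star_product[OF \<iota> fh]] _ X])
      (simp add: t(2) coring_homD(5)[OF h] abelian_regular balanced_star_product[OF \<iota> star_mapD(1)[OF f]] balanced_star_product[OF \<iota> fh])
  show ?thesis
    unfolding star_map_def
  proof (intro conjI ballI allI fh)
    fix z x y assume z: "z \<in> carrier C"
    show "f (h z) (x * y) = tensor_lift UNIV C C regular_bimod (\<lambda>z1 z2. f (h z1) (\<iota> (f (h z2) x) * y)) (comult C z)"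
      using star_mapD(7)[OF f coring_homD(5)[OF h z], of x y] product[OF coring_dataD(8)[OF C z]]
      by (simp add: coring_homD(6)[OF h z])
    show "f (h z) 1 = counit C z"
      using star_mapD(8)[OF f coring_homD(5)[OF h z]] coring_homD(7)[OF h z] by simp
  next
    fix z a b x assume z: "z \<in> carrier C"
    have "lact C a z \<in> carrier C" using left_moduleD(2)[OF coring_dataD(6)[OF C] z] .
    then show "f (h (ract C (lact C a z) b)) x = a * f (h z) (\<iota> b * x)"
      using bimod_homD(2,4)[OF fh] z by simp
  qed
qed

section \<open>From comodules to \<open>R\<close>-modules\<close>

text \<open>The action \<open>m r = m\<^sub>0 f(m\<^sub>1)(r)\<close>, as a function of the coaction \<open>m\<^sub>0 \<otimes> m\<^sub>1\<close>. It is additive in that argument,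
  so the module axioms can be checked on pure tensors.\<close>

definition act_by :: "('a::{comm_ring,monoid_mult},'c) coring \<Rightarrow> ('c \<Rightarrow> 'r \<Rightarrow> 'a) \<Rightarrow> ('a,'m,'y) rmod_scheme \<Rightarrow>
    'r \<Rightarrow> (('m \<times> 'c) \<Rightarrow>\<^sub>0 int) set \<Rightarrow> 'm" where
  "act_by D f M r = tensor_lift UNIV M D M (\<lambda>m c. ract M m (f c r))"

definition rep_of :: "('a::{comm_ring,monoid_mult},'c) coring \<Rightarrow> ('c \<Rightarrow> 'r \<Rightarrow> 'a) \<Rightarrow> ('a,'m,'c) comod \<Rightarrow> ('r,'m) rmod" where
  "rep_of D f M = \<lparr>carrier = carrier M, mult = mult M, one = one M, zero = zero M, add = add M,
     ract = (\<lambda>m r. act_by D f M r (coact M m))\<rparr>"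

lemma rep_of_simps [simp]:
  "carrier (rep_of D f M) = carrier M" "zero (rep_of D f M) = zero M" "add (rep_of D f M) = add M"
  "ract (rep_of D f M) m r = act_by D f M r (coact M m)"
  by (simp_all add: rep_of_def)

locale star_coring = coring_loc D for D :: "('a::{comm_ring,monoid_mult},'c) coring" +
  fixes \<iota> :: "'a \<Rightarrow> 'r::{ring,monoid_mult}" and f :: "'c \<Rightarrow> 'r \<Rightarrow> 'a"
  assumes hom: "unital_ring_hom \<iota>" and star: "star_map \<iota> D f"
begin

lemma balanced_act: "right_module M \<Longrightarrow> balanced UNIV M D M (\<lambda>m c. ract M m (f c r))"
  by (rule balancedI) (simp_all add: right_moduleD star_mapD[OF star])

lemma
  assumes M: "right_module M"
  shows additive_act: "additive_map (tensor_ab UNIV M D) M (act_by D f M r)"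
    and act_pure: "m \<in> carrier M \<Longrightarrow> c \<in> carrier D \<Longrightarrow> act_by D f M r (pure_tensor UNIV M D m c) = ract M m (f c r)"
proof -
  interpret MD: tensor_pair UNIV M D by (rule tensor_pair_UNIV[OF M DL])
  show "additive_map (tensor_ab UNIV M D) M (act_by D f M r)"
    and "m \<in> carrier M \<Longrightarrow> c \<in> carrier D \<Longrightarrow> act_by D f M r (pure_tensor UNIV M D m c) = ract M m (f c r)"
    unfolding act_by_def using MD.additive_lift[OF MD.abelian_left balanced_act[OF M]]
      MD.lift_pure[OF MD.abelian_left balanced_act[OF M]] by simp_all
qed

lemma act_one:
  assumes M: "right_module M" and X: "X \<in> carrier (tensor_ab UNIV M D)"
  shows "act_by D f M 1 X = tensor_lift UNIV M D M (\<lambda>n c. ract M n (counit D c)) X"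
proof -
  interpret MD: tensor_pair UNIV M D by (rule tensor_pair_UNIV[OF M DL])
  have b: "balanced UNIV M D M (\<lambda>n c. ract M n (counit D c))"
    by (rule balancedI) (simp_all add: bimod_homD[OF coring_dataD(3)[OF data]] right_moduleD[OF M])
  show ?thesis
    by (rule MD.tensor_ext[OF additive_act[OF M] MD.additive_lift[OF MD.abelian_left b] _ X])
      (simp add: act_pure[OF M] MD.abelian_left b star_mapD(8)[OF star])
qed

lemma act_scalar:
  assumes M: "right_module M" and X: "X \<in> carrier (tensor_ab UNIV M D)"
  shows "act_by D f M (\<iota> a) X = ract M (act_by D f M 1 X) a"
proof -
  interpret MD: tensor_pair UNIV M D by (rule tensor_pair_UNIV[OF M DL])
  have "f c (\<iota> a) = f c 1 * a" if "c \<in> carrier D" for c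
    using star_mapD(3)[OF star that, of 1 a] by simp
  then show ?thesis
    by (intro MD.tensor_ext[OF additive_act[OF M] additive_map_comp[OF additive_act[OF M] additive_ract[OF M]] _ X])
      (simp add: act_pure[OF M] right_moduleD[OF M])
qed

lemma act_add:
  assumes M: "right_module M" and X: "X \<in> carrier (tensor_ab UNIV M D)"
  shows "act_by D f M (r + s) X = act_by D f M r X \<oplus>\<^bsub>M\<^esub> act_by D f M s X"
proof -
  interpret MD: tensor_pair UNIV M D by (rule tensor_pair_UNIV[OF M DL])
  have "additive_map MD.T M (\<lambda>X. act_by D f M r X \<oplus>\<^bsub>M\<^esub> act_by D f M s X)"
    by (rule additive_mapI) (simp_all add: additive_map_closed[OF additive_act[OF M]] additive_map_add[OF additive_act[OF M]] MD.M.a_ac)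
  then show ?thesis
    by (rule MD.tensor_ext[OF additive_act[OF M] _ _ X])
      (simp add: act_pure[OF M] right_moduleD[OF M] star_mapD(2)[OF star])
qed

text \<open>On \<open>m \<otimes> c\<close> both sides are \<open>p\<^sup>*(m) f(c)(r)\<close>. With the coaction of \<open>p\<close> for \<open>X\<close> this is the reason for
  \<open>\<zeta> \<circ> F = \<xi> \<circ> can\<close>.\<close>

lemma act_dual:
  assumes M: "right_module M" and X: "X \<in> carrier (tensor_ab UNIV M D)" and p': "rmod_hom M regular_bimod p'"
  shows "p' (act_by D f M r X) = f (contract M D p' X) r"
proof -
  interpret MD: tensor_pair UNIV M D by (rule tensor_pair_UNIV[OF M DL])
  have "additive_map D regular_bimod (\<lambda>c. f c r)"
    by (rule additive_mapI) (simp_all add: star_mapD[OF star])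
  note ev = this
  show ?thesis
    by (rule MD.tensor_ext[OF additive_map_comp[OF additive_act[OF M] rmod_homD(1)[OF p']]
          additive_map_comp[OF additive_contract[OF M DL p'] ev] _ X])
      (simp add: act_pure[OF M] contract_pure[OF M DL p'] rmod_homD(2)[OF p'] star_mapD(5)[OF star])
qed

text \<open>Associativity of the action is coassociativity, evaluated by
  \<open>m \<otimes> c \<otimes> d \<mapsto> m f(c)(f(d)(r) s)\<close>.\<close>

lemma act_mult:
  assumes M: "comodule D M" and m: "m \<in> carrier M"
  shows "act_by D f M (r * s) (coact M m) = act_by D f M s (coact M (act_by D f M r (coact M m)))"
proof -
  note MR = comoduleD(1)[OF M]
  interpret DD: tensor_both UNIV D D by (rule coring_dataD(4)[OF data])
  note DD2 = DD.two_sided_module_tensor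
  interpret MD: tensor_right UNIV M D by (rule tensor_right_UNIV[OF MR D2])
  interpret L: tensor_right UNIV "tensor_r UNIV M D" D by (rule tensor_right_UNIV[OF MD.right_module_tensor_r D2])
  interpret R: tensor_right UNIV M "tensor UNIV D D" by (rule tensor_right_UNIV[OF MR DD2])
  note \<Delta> = bimod_hom_left_linear[OF coring_dataD(2)[OF data]]
  define S where "S = tensor_lift UNIV D D regular_bimod (\<lambda>c d. f c (\<iota> (f d r) * s))"
  have Sb: "balanced UNIV D D regular_bimod (\<lambda>c d. f c (\<iota> (f d r) * s))"
    by (rule balanced_star_product[OF hom star_mapD(1)[OF star]])
  have S_add: "additive_map DD.T regular_bimod S"
    unfolding S_def by (rule DD.additive_lift[OF abelian_regular Sb])
  have S_pure: "S (DD.pt c d) = f c (\<iota> (f d r) * s)" if "c \<in> carrier D" "d \<in> carrier D" for c d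
    unfolding S_def using that by (simp add: abelian_regular Sb)
  have S_lact: "S (lact (tensor UNIV D D) a Y) = a * S Y" if Y: "Y \<in> carrier DD.T" for a Y
  proof (rule DD.tensor_ext[OF additive_map_comp[OF DD.additive_lact_tensor S_add] _ _ Y])
    show "additive_map DD.T regular_bimod (\<lambda>Y. a * S Y)"
      by (rule additive_mapI) (simp_all add: additive_map_add[OF S_add] algebra_simps)
  qed (simp add: S_pure left_moduleD[OF DL] star_mapD(5)[OF star])
  define W where "W = tensor_lift UNIV M (tensor UNIV D D) M (\<lambda>m Y. ract M m (S Y))"
  have Wb: "balanced UNIV M (tensor UNIV D D) M (\<lambda>m Y. ract M m (S Y))"
    by (rule balancedI) (simp_all add: right_moduleD[OF MR] S_lact additive_map_add[OF S_add])
  have W_add: "additive_map R.T M W"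
    unfolding W_def by (rule R.additive_lift[OF MD.abelian_left Wb])
  have W_pure: "W (R.pt n Y) = ract M n (S Y)" if "n \<in> carrier M" "Y \<in> carrier DD.T" for n Y
    unfolding W_def using that by (simp add: MD.abelian_left Wb)
  note la = additive_tensor_map[OF MD.tensor_pair_axioms L.tensor_pair_axioms comoduleD(2)[OF M] left_linear_id]
    and lp = tensor_map_pure[OF MD.tensor_pair_axioms L.tensor_pair_axioms comoduleD(2)[OF M] left_linear_id]
  note ra = additive_tensor_map[OF MD.tensor_pair_axioms R.tensor_pair_axioms rmod_hom_id \<Delta>]
    and rp = tensor_map_pure[OF MD.tensor_pair_axioms R.tensor_pair_axioms rmod_hom_id \<Delta>]
  note aa = additive_tensor_assoc[OF MR D2 D2] and ap = tensor_assoc_pure[OF MR D2 D2]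
  have 1: "act_by D f M (r * s) X = W (tensor_map M D M (tensor UNIV D D) (\<lambda>n. n) (comult D) X)"
    if X: "X \<in> carrier MD.T" for X
    by (rule MD.tensor_ext[OF additive_act[OF MR] additive_map_comp[OF ra W_add] _ X])
      (simp add: act_pure[OF MR] rp W_pure coring_dataD(8)[OF data] star_mapD(7)[OF star] S_def)
  note pl = DD.left_linear_pure
  have 2: "act_by D f M s (ract (tensor_r UNIV M D) Y (f c r)) = W (tensor_map M D M (tensor UNIV D D) (\<lambda>n. n) (\<lambda>n. DD.pt n c) Y)"
    if Y: "Y \<in> carrier MD.T" and c: "c \<in> carrier D" for Y c
    by (rule MD.tensor_ext[OF additive_map_comp[OF MD.additive_ract_tensor additive_act[OF MR]]
          additive_map_comp[OF additive_tensor_map[OF MD.tensor_pair_axioms R.tensor_pair_axioms rmod_hom_id pl[OF c]] W_add] _ Y])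
      (simp add: tensor_map_pure[OF MD.tensor_pair_axioms R.tensor_pair_axioms rmod_hom_id pl[OF c]] c W_pure S_pure
        act_pure[OF MR] right_moduleD(2)[OF coring_dataD(5)[OF data]] star_mapD(6)[OF star])
  have 3: "act_by D f M s (coact M (act_by D f M r X)) =
      W (tensor_assoc M D D (tensor_map M D (tensor_r UNIV M D) D (coact M) (\<lambda>c. c) X))"
    if X: "X \<in> carrier MD.T" for X
    by (rule MD.tensor_ext[OF additive_map_comp[OF additive_act[OF MR] additive_map_comp[OF comoduleD(4)[OF M] additive_act[OF MR]]]
          additive_map_comp[OF additive_map_comp[OF la aa] W_add] _ X])
      (simp add: act_pure[OF MR] lp ap comoduleD[OF M] 2)
  show ?thesis
    using 1 3 comoduleD(6)[OF M m] comoduleD(3)[OF M m] by simp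
qed

lemma right_module_rep_of:
  assumes M: "comodule D M" shows "right_module (rep_of D f M)"
proof -
  note MR = comoduleD(1)[OF M] and X = comoduleD(3)[OF M]
  have "abelian_group (rep_of D f M)" by (rule abelian_group_cong[OF right_moduleD(1)[OF MR]]) simp_all
  moreover have "act_by D f M 1 (coact M m) = m" if "m \<in> carrier M" for m
    using that by (simp add: act_one[OF MR] X comoduleD(7)[OF M])
  ultimately show ?thesis
    unfolding right_module_def
    by (simp add: additive_map_closed[OF additive_act[OF MR]] X additive_map_add[OF comoduleD(4)[OF M]]
        additive_map_add[OF additive_act[OF MR]] act_add[OF MR] act_mult[OF M])
qed

lemma same_module_rep_of:
  assumes M: "comodule D M" shows "same_module M (restrict_scalars \<iota> (rep_of D f M))"
  unfolding same_module_def
  using comoduleD(1,3,7)[OF M] by (simp add: restrict_scalars_def act_scalar act_one)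

lemma rep_of_Ob:
  assumes "M \<in> comod_Ob D" shows "rep_of D f M \<in> rep_Ob \<iota>"
  using assms right_module_rep_of[of M] same_module_fg_projective[OF same_module_rep_of[of M]]
  by (simp add: rep_Ob_def comod_Ob_def)

lemma rep_of_Hom:
  assumes M: "M \<in> comod_Ob D" and N: "N \<in> comod_Ob D" and t: "t \<in> comod_Hom D M N"
  shows "t \<in> rep_Hom (rep_of D f M) (rep_of D f N)"
proof -
  note MR = comod_right[OF M] and NR = comod_right[OF N] and th = comod_HomD(2)[OF t]
  interpret MD: tensor_pair UNIV M D by (rule tensor_pair_UNIV[OF MR DL])
  interpret ND: tensor_pair UNIV N D by (rule tensor_pair_UNIV[OF NR DL])
  have "t (act_by D f M r X) = act_by D f N r (tensor_map M D N D t (\<lambda>c. c) X)" if X: "X \<in> carrier MD.T" for X r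
    by (rule MD.tensor_ext[OF additive_map_comp[OF additive_act[OF MR] rmod_homD(1)[OF th]]
          additive_map_comp[OF additive_tensor_map[OF MD.tensor_pair_axioms ND.tensor_pair_axioms th left_linear_id] additive_act[OF NR]] _ X])
      (simp add: act_pure[OF MR] act_pure[OF NR] tensor_map_pure[OF MD.tensor_pair_axioms ND.tensor_pair_axioms th left_linear_id]
        rmod_homD[OF th])
  then have "rmod_hom (rep_of D f M) (rep_of D f N) t"
    using rmod_homD(1)[OF th] additive_map_cong_structure[of M "rep_of D f M" N "rep_of D f N" t] comoduleD(3)[OF comod[OF M]]
    by (simp add: rmod_hom_def comod_HomD(3)[OF t])
  then show ?thesis
    using t by (simp add: rep_Hom_def comod_Hom_def)
qed

end

section \<open>From objects to comodules\<close>

context fgp_category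
begin

text \<open>The classes \<open>e\<^sub>i\<^sup>* \<otimes> p\<close> make every object a comodule over \<open>\<R>(\<A>)\<close>; push this coaction forward
  along a map \<open>g : \<R>(\<A>) \<rightarrow> D\<close>.\<close>

definition coaction where
  "coaction D g P p = (\<Oplus>\<^bsub>tensor_ab UNIV (U P) D\<^esub>i\<in>{..<length (basis P)}.
     pure_tensor UNIV (U P) D (fst (basis P ! i)) (g (cl P (snd (basis P ! i)) p)))"

definition comodule_along where
  "comodule_along D g P = rmod.extend (U P) (comod.fields (coaction D g P))"

lemma comodule_along_simps [simp]:
  "carrier (comodule_along D g P) = carrier (U P)" "zero (comodule_along D g P) = zero (U P)"
  "add (comodule_along D g P) = add (U P)" "ract (comodule_along D g P) = ract (U P)"
  "coact (comodule_along D g P) = coaction D g P" "rmod.truncate (comodule_along D g P) = U P"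
  by (simp_all add: comodule_along_def rmod.extend_def comod.fields_def rmod.truncate_def)

lemma tensor_along:
  "tensor_ab UNIV (comodule_along D g P) N = tensor_ab UNIV (U P) N"
  "pure_tensor UNIV (comodule_along D g P) N = pure_tensor UNIV (U P) N"
  "tensor_lift UNIV (comodule_along D g P) N = tensor_lift UNIV (U P) N"
  by (rule tensor_ab_cong; simp)+

end

locale recon_hom = fgp_category Ob U Hm + coring_loc D
  for Ob :: "'o set" and U :: "'o \<Rightarrow> ('a::{comm_ring,monoid_mult},'m) rmod" and Hm :: "'o \<Rightarrow> 'o \<Rightarrow> ('m \<Rightarrow> 'm) set"
    and D :: "('a,'c) coring" +
  fixes g :: "('o,'a,'m) recon_elem \<Rightarrow> 'c"
  assumes hom_g: "coring_hom (recon Ob U Hm) D g"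
begin

lemma g_closed: "P \<in> Ob \<Longrightarrow> p' \<in> carrier (dl P) \<Longrightarrow> p \<in> carrier (U P) \<Longrightarrow> g (cl P p' p) \<in> carrier D"
  using coring_homD(5)[OF hom_g] by simp

lemma g_left: "P \<in> Ob \<Longrightarrow> p \<in> carrier (U P) \<Longrightarrow> left_linear (dl P) D (\<lambda>p'. g (cl P p' p))"
  using left_linearD[OF class_linear_left] left_linearD(2)[OF coring_homD(3)[OF hom_g]]
    additive_map_comp[OF left_linearD(1)[OF class_linear_left] coring_homD(4)[OF hom_g]]
  by (simp add: left_linear_def)

lemma g_right: "P \<in> Ob \<Longrightarrow> p' \<in> carrier (dl P) \<Longrightarrow> rmod_hom (U P) D (\<lambda>p. g (cl P p' p))"
  using rmod_homD[OF class_linear_right] rmod_homD(2)[OF coring_homD(2)[OF hom_g]]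
    additive_map_comp[OF rmod_homD(1)[OF class_linear_right] coring_homD(4)[OF hom_g]]
  by (simp add: rmod_hom_def)

lemma PD: "P \<in> Ob \<Longrightarrow> tensor_right UNIV (U P) D"
  by (rule tensor_right_UNIV[OF U_module D2])

lemma e_closed [simp]:
  "P \<in> Ob \<Longrightarrow> i < length (basis P) \<Longrightarrow> fst (basis P ! i) \<in> carrier (U P)"
  "P \<in> Ob \<Longrightarrow> i < length (basis P) \<Longrightarrow> snd (basis P ! i) \<in> carrier (dl P)"
  using dual_basisD(1,2)[OF dual_basis_basis] by auto

lemma coaction_hom:
  assumes P: "P \<in> Ob" shows "rmod_hom (U P) (tensor_r UNIV (U P) D) (coaction D g P)"
proof -
  interpret PD: tensor_right UNIV "U P" D by (rule PD[OF P])
  show ?thesis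
    unfolding rmod_hom_def
  proof (intro conjI ballI allI)
    show "additive_map (U P) (tensor_r UNIV (U P) D) (coaction D g P)"
      unfolding coaction_def additive_map_tensor_iff
      using P by (intro additive_map_sum_of_maps[OF PD.abelian_tensor] additive_map_comp[OF rmod_homD(1)[OF g_right] PD.additive_pure_right]) auto
    fix p a assume p: "p \<in> carrier (U P)"
    have "ract (tensor_r UNIV (U P) D) (coaction D g P p) a =
      (\<Oplus>\<^bsub>PD.T\<^esub>i\<in>{..<length (basis P)}. ract (tensor_r UNIV (U P) D) (PD.pt (fst (basis P ! i)) (g (cl P (snd (basis P ! i)) p))) a)"
      unfolding coaction_def using P p by (intro additive_map_finsum[OF PD.abelian_tensor PD.abelian_tensor PD.additive_ract_tensor]) (auto simp: g_closed)
    also have "\<dots> = coaction D g P (ract (U P) p a)"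
      unfolding coaction_def using P p rmod_homD(2)[OF g_right] right_moduleD(2)[OF U_module] right_moduleD(2)[OF coring_dataD(5)[OF data]]
      by (intro PD.T.finsum_cong') (auto simp: g_closed intro!: PD.pure_closed)
    finally show "coaction D g P (ract (U P) p a) = ract (tensor_r UNIV (U P) D) (coaction D g P p) a" ..
  qed
qed

lemma coaction_closed: "P \<in> Ob \<Longrightarrow> p \<in> carrier (U P) \<Longrightarrow> coaction D g P p \<in> carrier (tensor_ab UNIV (U P) D)"
  using rmod_homD(3)[OF coaction_hom] by simp

text \<open>The coefficients of this coaction are the values of \<open>g\<close>, because \<open>\<Sum> p\<^sup>*(e\<^sub>i) e\<^sub>i\<^sup>* = p\<^sup>*\<close>.\<close>

lemma contract_coaction:
  assumes P: "P \<in> Ob" and p': "p' \<in> carrier (dl P)" and p: "p \<in> carrier (U P)"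
  shows "contract (U P) D p' (coaction D g P p) = g (cl P p' p)"
proof -
  interpret PD: tensor_right UNIV "U P" D by (rule PD[OF P])
  have p'_hom: "rmod_hom (U P) regular_bimod p'" using p' by (simp add: dual_bimod_simps)
  note cd = additive_contract[OF U_module[OF P] DL p'_hom] contract_pure[OF U_module[OF P] DL p'_hom]
  have "contract (U P) D p' (coaction D g P p) =
    (\<Oplus>\<^bsub>D\<^esub>i\<in>{..<length (basis P)}. contract (U P) D p' (PD.pt (fst (basis P ! i)) (g (cl P (snd (basis P ! i)) p))))"
    unfolding coaction_def using P p
    by (intro additive_map_finsum[OF PD.abelian_tensor PD.abelian_right cd(1)]) (auto simp: g_closed)
  also have "\<dots> = (\<Oplus>\<^bsub>D\<^esub>i\<in>{..<length (basis P)}. g (cl P (lact (dl P) (p' (fst (basis P ! i))) (snd (basis P ! i))) p))"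
    using P p left_linearD(2)[OF g_left[OF P p]]
    by (intro PD.N.finsum_cong') (auto simp: g_closed cd(2) left_moduleD(2)[OF DL])
  also have "\<dots> = g (cl P (\<Oplus>\<^bsub>dl P\<^esub>i\<in>{..<length (basis P)}. lact (dl P) (p' (fst (basis P ! i))) (snd (basis P ! i))) p)"
    using P p dual_closed(2)[OF U_module[OF P]]
    by (intro additive_map_finsum[OF abelian_dual[OF U_module[OF P]] PD.abelian_right left_linearD(1)[OF g_left[OF P p]], symmetric]) auto
  finally show ?thesis using dual_expand[OF U_module[OF P] dual_basis_basis[OF P] p'] by simp
qed

end

context fgp_category
begin

lemma along_cong:
  "tensor_r UNIV (comodule_along D g P) N = tensor_r UNIV (U P) N"
  "tensor_map (comodule_along D g P) N M' N' = tensor_map (U P) N M' N'"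
  "tensor_map M N (comodule_along D g P) N' = tensor_map M N (U P) N'"
  "tensor_assoc (comodule_along D g P) N K = tensor_assoc (U P) N K"
  by (simp_all add: tensor_r_def tensor_map_def tensor_along tensor_assoc_def fun_eq_iff)

lemma same_module_along: "same_module (U P) (comodule_along D g P)"
  by (simp add: same_module_def)

end

context recon_hom
begin

lemma coaction_pure_map:
  assumes P: "P \<in> Ob" and p: "p \<in> carrier (U P)" and G: "abelian_group G"
    and h: "additive_map (tensor_ab UNIV (U P) D) G h"
  shows "h (coaction D g P p) = (\<Oplus>\<^bsub>G\<^esub>i\<in>{..<length (basis P)}.
    h (pure_tensor UNIV (U P) D (fst (basis P ! i)) (g (cl P (snd (basis P ! i)) p))))"
proof -
  interpret PD: tensor_right UNIV "U P" D by (rule PD[OF P])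
  show ?thesis
    unfolding coaction_def using P p
    by (intro additive_map_finsum[OF PD.abelian_tensor G h]) (auto simp: g_closed)
qed

lemma coaction_counital:
  assumes P: "P \<in> Ob" and p: "p \<in> carrier (U P)"
  shows "tensor_lift UNIV (U P) D (U P) (\<lambda>n c. ract (U P) n (counit D c)) (coaction D g P p) = p"
proof -
  interpret PD: tensor_right UNIV "U P" D by (rule PD[OF P])
  have b: "balanced UNIV (U P) D (U P) (\<lambda>n c. ract (U P) n (counit D c))"
    by (rule balancedI) (simp_all add: bimod_homD[OF coring_dataD(3)[OF data]] right_moduleD[OF U_module[OF P]])
  have "tensor_lift UNIV (U P) D (U P) (\<lambda>n c. ract (U P) n (counit D c)) (coaction D g P p) =
    (\<Oplus>\<^bsub>U P\<^esub>i\<in>{..<length (basis P)}. ract (U P) (fst (basis P ! i)) (snd (basis P ! i) p))"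
    unfolding coaction_pure_map[OF P p PD.abelian_left PD.additive_lift[OF PD.abelian_left b]]
    using P p right_moduleD(2)[OF U_module[OF P]]
    by (intro PD.M.finsum_cong')
      (auto simp: g_closed PD.abelian_left b coring_homD(7)[OF hom_g] counit_class)
  then show ?thesis using dual_basisD(3)[OF dual_basis_basis[OF P] p] by simp
qed

text \<open>Both sides are \<open>\<Sum> e\<^sub>j \<otimes> g(e\<^sub>j\<^sup>* \<otimes> e\<^sub>i) \<otimes> g(e\<^sub>i\<^sup>* \<otimes> p)\<close>: on the left by the definition of the coaction, on
  the right because \<open>g\<close> is compatible with the comultiplications.\<close>

lemma coaction_coassociative:
  assumes P: "P \<in> Ob" and p: "p \<in> carrier (U P)"
  shows "tensor_assoc (U P) D D (tensor_map (U P) D (tensor_r UNIV (U P) D) D (coaction D g P) (\<lambda>c. c) (coaction D g P p)) =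
    tensor_map (U P) D (U P) (tensor UNIV D D) (\<lambda>n. n) (comult D) (coaction D g P p)"
proof -
  note MR = U_module[OF P]
  interpret DD: tensor_both UNIV D D by (rule coring_dataD(4)[OF data])
  note DD2 = DD.two_sided_module_tensor
  interpret MD: tensor_right UNIV "U P" D by (rule PD[OF P])
  interpret L: tensor_right UNIV "tensor_r UNIV (U P) D" D by (rule tensor_right_UNIV[OF MD.right_module_tensor_r D2])
  interpret R: tensor_right UNIV "U P" "tensor UNIV D D" by (rule tensor_right_UNIV[OF MR DD2])
  note \<Delta> = bimod_hom_left_linear[OF coring_dataD(2)[OF data]]
  note la = additive_tensor_map[OF MD.tensor_pair_axioms L.tensor_pair_axioms coaction_hom[OF P] left_linear_id]
    and lp = tensor_map_pure[OF MD.tensor_pair_axioms L.tensor_pair_axioms coaction_hom[OF P] left_linear_id]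
  note ra = additive_tensor_map[OF MD.tensor_pair_axioms R.tensor_pair_axioms rmod_hom_id \<Delta>]
    and rp = tensor_map_pure[OF MD.tensor_pair_axioms R.tensor_pair_axioms rmod_hom_id \<Delta>]
  note aa = additive_tensor_assoc[OF MR D2 D2] and ap = tensor_assoc_pure[OF MR D2 D2]
  note pl = DD.left_linear_pure
  define n where "n = length (basis P)"
  define e where "e i = fst (basis P ! i)" for i
  define e' where "e' i = snd (basis P ! i)" for i
  have e [simp]: "i < n \<Longrightarrow> e i \<in> carrier (U P)" "i < n \<Longrightarrow> e' i \<in> carrier (dl P)" for i
    using P by (simp_all add: n_def e_def e'_def)
  note expand = coaction_pure_map[OF P, folded n_def e_def e'_def]
  note [simp] = g_closed[OF P] coaction_closed[OF P]
  have "tensor_assoc (U P) D D (tensor_map (U P) D (tensor_r UNIV (U P) D) D (coaction D g P) (\<lambda>c. c) (coaction D g P p)) =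
    (\<Oplus>\<^bsub>R.T\<^esub>i\<in>{..<n}. \<Oplus>\<^bsub>R.T\<^esub>j\<in>{..<n}. R.pt (e j) (DD.pt (g (cl P (e' j) (e i))) (g (cl P (e' i) p))))"
    unfolding expand[OF p R.abelian_tensor additive_map_comp[OF la aa]]
  proof (rule R.T.finsum_cong'[OF refl])
    fix i assume "i \<in> {..<n}"
    then have i: "i < n" by simp
    have c: "g (cl P (e' i) p) \<in> carrier D" using i p by simp
    have "tensor_assoc (U P) D D (tensor_map (U P) D (tensor_r UNIV (U P) D) D (coaction D g P) (\<lambda>c. c)
        (MD.pt (e i) (g (cl P (e' i) p)))) =
      tensor_map (U P) D (U P) (tensor UNIV D D) (\<lambda>m. m) (\<lambda>n. DD.pt n (g (cl P (e' i) p))) (coaction D g P (e i))"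
      using i c by (simp add: lp ap)
    also have "\<dots> = (\<Oplus>\<^bsub>R.T\<^esub>j\<in>{..<n}. R.pt (e j) (DD.pt (g (cl P (e' j) (e i))) (g (cl P (e' i) p))))"
      unfolding expand[OF e(1)[OF i] R.abelian_tensor
          additive_tensor_map[OF MD.tensor_pair_axioms R.tensor_pair_axioms rmod_hom_id pl[OF c]]]
      using i c by (intro R.T.finsum_cong')
        (auto simp: tensor_map_pure[OF MD.tensor_pair_axioms R.tensor_pair_axioms rmod_hom_id pl[OF c]] intro!: R.pure_closed)
    finally show "tensor_assoc (U P) D D (tensor_map (U P) D (tensor_r UNIV (U P) D) D (coaction D g P) (\<lambda>c. c)
        (MD.pt (e i) (g (cl P (e' i) p)))) =
      (\<Oplus>\<^bsub>R.T\<^esub>j\<in>{..<n}. R.pt (e j) (DD.pt (g (cl P (e' j) (e i))) (g (cl P (e' i) p))))" .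
  qed (use p in \<open>auto intro!: R.T.finsum_closed\<close>)
  also have "\<dots> = (\<Oplus>\<^bsub>R.T\<^esub>j\<in>{..<n}. \<Oplus>\<^bsub>R.T\<^esub>i\<in>{..<n}. R.pt (e j) (DD.pt (g (cl P (e' j) (e i))) (g (cl P (e' i) p))))"
    using p by (intro finsum_swap[OF R.abelian_tensor]) auto
  also have "\<dots> = tensor_map (U P) D (U P) (tensor UNIV D D) (\<lambda>n. n) (comult D) (coaction D g P p)"
    unfolding expand[OF p R.abelian_tensor ra]
  proof (rule R.T.finsum_cong'[OF refl])
    fix j assume "j \<in> {..<n}"
    then have j: "j < n" by simp
    note tg = additive_tensor_map[OF CC.tensor_pair_axioms DD.tensor_pair_axioms coring_homD(2,3)[OF hom_g]]
      tensor_map_pure[OF CC.tensor_pair_axioms DD.tensor_pair_axioms coring_homD(2,3)[OF hom_g]]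
    have "comult D (g (cl P (e' j) p)) = tensor_map C C D D g g (split_sum P (basis P) (e' j) p)"
      using P p j by (simp add: coring_homD(6)[OF hom_g] comult_class[OF P dual_basis_basis[OF P]])
    also have "\<dots> = (\<Oplus>\<^bsub>DD.T\<^esub>i\<in>{..<n}. tensor_map C C D D g g (CC.pt (cl P (e' j) (e i)) (cl P (e' i) p)))"
      unfolding split_sum_def n_def e_def[symmetric] e'_def[symmetric]
      using P p j by (intro additive_map_finsum[OF CC.abelian_tensor DD.abelian_tensor tg(1)]) (auto simp: n_def[symmetric])
    also have "\<dots> = (\<Oplus>\<^bsub>tensor UNIV D D\<^esub>i\<in>{..<n}. DD.pt (g (cl P (e' j) (e i))) (g (cl P (e' i) p)))"
      using P p j by (simp, intro DD.T.finsum_cong') (auto simp: tg(2) intro!: DD.pure_closed)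
    finally have "R.pt (e j) (comult D (g (cl P (e' j) p))) =
        (\<Oplus>\<^bsub>R.T\<^esub>i\<in>{..<n}. R.pt (e j) (DD.pt (g (cl P (e' j) (e i))) (g (cl P (e' i) p))))"
      using P p j by (simp only:, intro R.pure_finsum_right) auto
    then show "(\<Oplus>\<^bsub>R.T\<^esub>i\<in>{..<n}. R.pt (e j) (DD.pt (g (cl P (e' j) (e i))) (g (cl P (e' i) p)))) =
      tensor_map (U P) D (U P) (tensor UNIV D D) (\<lambda>n. n) (comult D) (MD.pt (e j) (g (cl P (e' j) p)))"
      using P p j by (simp add: rp)
  qed (use p in \<open>auto intro!: additive_map_closed[OF ra]\<close>)
  finally show ?thesis .
qed

lemma comodule_comodule_along:
  assumes P: "P \<in> Ob" shows "comodule D (comodule_along D g P)"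
  unfolding comodule_def along_cong tensor_along comodule_along_simps
  using same_module_right_module[OF same_module_along U_module[OF P]]
    same_module_rmod_hom[OF same_module_along[of P D g] same_module_refl[of "tensor_r UNIV (U P) D"], of "coaction D g P"]
    coaction_hom[OF P] coaction_coassociative[OF P] coaction_counital[OF P]
  by (simp add: tensor_lift_def additive_map_cong_structure[of _ _ "comodule_along D g P" "U P"])

text \<open>Morphisms are comodule maps, by \<open>dual_basis_transport\<close> with \<open>u = id\<close>.\<close>

lemma coaction_natural:
  assumes P: "P \<in> Ob" and Q: "Q \<in> Ob" and t: "t \<in> Hm P Q" and p: "p \<in> carrier (U P)"
  shows "coaction D g Q (t p) = tensor_map (U P) D (U Q) D t (\<lambda>c. c) (coaction D g P p)"
proof -
  interpret PD: tensor_right UNIV "U P" D by (rule PD[OF P])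
  interpret QD: tensor_right UNIV "U Q" D by (rule PD[OF Q])
  note th = Hm_hom[OF P Q t]
  have "coaction D g Q (t p) = (\<Oplus>\<^bsub>QD.T\<^esub>j\<in>{..<length (basis Q)}.
      QD.pt (fst (basis Q ! j)) (g (cl P (\<lambda>x\<in>carrier (U P). snd (basis Q ! j) (t x)) p)))"
    unfolding coaction_def using P Q p hom_closed[OF P Q t]
    by (intro QD.T.finsum_cong') (auto simp: class_hom[OF P Q t p] g_closed intro!: QD.pure_closed)
  also have "\<dots> = (\<Oplus>\<^bsub>QD.T\<^esub>i\<in>{..<length (basis P)}. QD.pt (t (fst (basis P ! i))) (g (cl P (snd (basis P ! i)) p)))"
    by (rule dual_basis_transport[OF U_module[OF P] U_module[OF Q] U_module[OF Q] DL
          dual_basis_basis[OF P] dual_basis_basis[OF Q] th rmod_hom_id g_left[OF P p]])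
  also have "\<dots> = tensor_map (U P) D (U Q) D t (\<lambda>c. c) (coaction D g P p)"
    unfolding coaction_pure_map[OF P p QD.abelian_tensor
        additive_tensor_map[OF PD.tensor_pair_axioms QD.tensor_pair_axioms th left_linear_id]]
    using P p rmod_homD(3)[OF th]
    by (intro QD.T.finsum_cong')
      (auto simp: tensor_map_pure[OF PD.tensor_pair_axioms QD.tensor_pair_axioms th left_linear_id] g_closed intro!: QD.pure_closed)
  finally show ?thesis .
qed

end

section \<open>The finite dual\<close>

lemma restrict_scalars_simps [simp]:
  "carrier (restrict_scalars \<iota> M) = carrier M" "zero (restrict_scalars \<iota> M) = zero M"
  "add (restrict_scalars \<iota> M) = add M" "ract (restrict_scalars \<iota> M) m a = ract M m (\<iota> a)"
  by (simp_all add: restrict_scalars_def)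

lemma rmod_hom_restrict_scalars:
  "rmod_hom M N t \<Longrightarrow> rmod_hom (restrict_scalars \<iota> M) (restrict_scalars \<iota> N) t"
  using additive_map_cong_structure[of M "restrict_scalars \<iota> M" N "restrict_scalars \<iota> N" t]
  by (simp add: rmod_hom_def)

lemma rep_ObD:
  assumes "P \<in> rep_Ob \<iota>" shows "right_module P" "fg_projective (restrict_scalars \<iota> P)"
  using assms by (simp_all add: rep_Ob_def)

lemma rep_HomD: "t \<in> rep_Hom M N \<Longrightarrow> rmod_hom M N t"
  by (simp add: rep_Hom_def)

locale ring_over =
  fixes \<eta>A :: "'k::field \<Rightarrow> 'a::{comm_ring,monoid_mult}"
    and \<eta>R :: "'k \<Rightarrow> 'r::{ring,monoid_mult}"
    and \<iota> :: "'a \<Rightarrow> 'r"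
  assumes A_ring: "A_ring \<eta>A \<eta>R \<iota>"
begin

lemma hom: "unital_ring_hom \<iota>" and central: "\<iota> (\<eta>A c) * x = x * \<iota> (\<eta>A c)"
  using A_ring by (simp_all add: A_ring_def k_algebra_def)

sublocale R: fgp_category "rep_Ob \<iota>" "restrict_scalars \<iota>" rep_Hom
  by unfold_locales (auto simp: rep_ObD intro: rmod_hom_restrict_scalars rep_HomD)

abbreviation "R0 \<equiv> fin_dual \<iota>"

lemma R0_eq: "R0 = R.C"
  by (simp add: fin_dual_def)

text \<open>As \<open>\<bbbk>\<close> acts centrally on \<open>R\<close>, its scalars act on \<open>R\<close>-modules by \<open>R\<close>-linear maps.\<close>

lemma coring_R0: "is_coring \<eta>A R0"
  unfolding R0_eq
proof (rule R.is_coring_recon)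
  fix P c assume P: "P \<in> rep_Ob \<iota>"
  note PR = rep_ObD(1)[OF P]
  let ?t = "\<lambda>p\<in>carrier P. ract P p (\<iota> (\<eta>A c))"
  have "ract P (ract P p r) (\<iota> (\<eta>A c)) = ract P (ract P p (\<iota> (\<eta>A c))) r" if "p \<in> carrier P" for p r
    using right_moduleD(5)[OF PR that, of r "\<iota> (\<eta>A c)"] right_moduleD(5)[OF PR that, of "\<iota> (\<eta>A c)" r] by (simp add: central)
  then have "rmod_hom P P ?t"
    using abelian_monoid.a_closed[OF abelian_group.axioms(1)[OF right_moduleD(1)[OF PR]]]
    by (auto simp: rmod_hom_def right_moduleD[OF PR] intro!: additive_mapI)
  then have "?t \<in> rep_Hom P P" by (simp add: rep_Hom_def)
  then show "\<exists>t\<in>rep_Hom P P. \<forall>p\<in>carrier (restrict_scalars \<iota> P). t p = ract (restrict_scalars \<iota> P) p (\<eta>A c)"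
    by (intro bexI[of _ ?t]) simp_all
qed

lemma data_R0: "coring_data R0"
  by (rule is_coring_data[OF coring_R0])

lemma dual_restrict:
  assumes "p' \<in> carrier (dual_bimod (restrict_scalars \<iota> P))"
  shows "x \<in> carrier P \<Longrightarrow> y \<in> carrier P \<Longrightarrow> p' (x \<oplus>\<^bsub>P\<^esub> y) = p' x + p' y"
    "x \<in> carrier P \<Longrightarrow> p' (ract P x (\<iota> a)) = p' x * a"
  using dual_apply[OF assms] by auto

lemma natural_pairing_zeta:
  "natural_pairing (rep_Ob \<iota>) (restrict_scalars \<iota>) rep_Hom (ring_dual \<iota>) (\<lambda>P p' p r. p' (ract P p r))"
  unfolding natural_pairing_def rmod_hom_def
  by (auto intro!: additive_mapI simp: right_moduleD[OF rep_ObD(1)] dual_restrict dual_bimod_simps(3-)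
      rmod_homD(2)[OF rep_HomD] fun_eq_iff)

lemma zeta_class:
  "P \<in> rep_Ob \<iota> \<Longrightarrow> p' \<in> carrier (R.dl P) \<Longrightarrow> p \<in> carrier P \<Longrightarrow> zeta \<iota> (R.cl P p' p) = (\<lambda>r. p' (ract P p r))"
  unfolding zeta_def by (rule R.extend_class[OF two_sided_ring_dual[OF hom] natural_pairing_zeta]) simp_all

lemma zeta_hom: "bimod_hom R0 (ring_dual \<iota>) (zeta \<iota>)"
  unfolding zeta_def R0_eq by (rule R.extend_hom[OF two_sided_ring_dual[OF hom] natural_pairing_zeta])

lemma additive_at:
  assumes "bimod_hom D (ring_dual \<iota>) f" shows "additive_map D regular_bimod (\<lambda>z. f z r)"
  using bimod_homD(6)[OF assms] by (intro additive_mapI) (auto simp: fun_eq_iff)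

text \<open>\<open>\<zeta>(p\<^sup>* \<otimes> p)(x y) = p\<^sup>*(p x y)\<close>; expand \<open>p x\<close> in a dual basis.\<close>

lemma star_zeta: "star_map \<iota> R0 (zeta \<iota>)"
proof -
  note z = zeta_hom[unfolded R0_eq]
  have product: "zeta \<iota> X (x * y) = tensor_lift UNIV R.C R.C regular_bimod (\<lambda>z1 z2. zeta \<iota> z1 (\<iota> (zeta \<iota> z2 x) * y)) (comult R.C X)"
    (is "_ = ?l (comult R.C X)") if X: "X \<in> carrier R.C" for X x y
  proof (rule R.C_ext[OF abelian_regular additive_at[OF z] _ _ X])
    note b = balanced_star_product[OF hom z]
    show "additive_map R.C regular_bimod (\<lambda>X. ?l (comult R.C X))"
      by (rule additive_map_comp[OF coring_dataD(9)[OF R.coring_data_C] R.CC.additive_lift[OF abelian_regular b]])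
    fix P p' p assume P: "P \<in> rep_Ob \<iota>" and p': "p' \<in> carrier (R.dl P)" and "p \<in> carrier (restrict_scalars \<iota> P)"
    then have p: "p \<in> carrier P" by simp
    note PR = rep_ObD(1)[OF P] and es = R.dual_basis_basis[OF P]
    interpret PA: abelian_group P by (rule right_moduleD(1)[OF PR])
    have e: "i < length (R.basis P) \<Longrightarrow> fst (R.basis P ! i) \<in> carrier P"
      "i < length (R.basis P) \<Longrightarrow> snd (R.basis P ! i) \<in> carrier (R.dl P)" for i
      using dual_basisD(1,2)[OF es] by simp_all
    have ev: "additive_map P regular_bimod (\<lambda>q. p' (ract P q y))"
      by (rule additive_mapI) (simp_all add: right_moduleD[OF PR] dual_restrict[OF p'])
    have "?l (comult R.C (R.cl P p' p)) = (\<Oplus>\<^bsub>regular_bimod\<^esub>i\<in>{..<length (R.basis P)}.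
        ?l (R.CC.pt (R.cl P p' (fst (R.basis P ! i))) (R.cl P (snd (R.basis P ! i)) p)))"
      unfolding R.comult_class[OF P es p' \<open>p \<in> carrier (restrict_scalars \<iota> P)\<close>] R.split_sum_def
      using P p' p e by (intro R.CC.lift_finsum[OF abelian_regular b]) auto
    also have "\<dots> = (\<Oplus>\<^bsub>regular_bimod\<^esub>i\<in>{..<length (R.basis P)}.
        p' (ract P (ract P (fst (R.basis P ! i)) (\<iota> (snd (R.basis P ! i) (ract P p x)))) y))"
      using P p' p e
      by (intro abelian_monoid.finsum_cong'[OF abelian_group.axioms(1)[OF abelian_regular]])
        (auto simp: abelian_regular b zeta_class right_moduleD(5)[OF PR])
    also have "\<dots> = p' (ract P (\<Oplus>\<^bsub>P\<^esub>i\<in>{..<length (R.basis P)}. ract P (fst (R.basis P ! i)) (\<iota> (snd (R.basis P ! i) (ract P p x)))) y)"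
      using e right_moduleD(2)[OF PR]
      by (intro additive_map_finsum[OF right_moduleD(1)[OF PR] abelian_regular ev, symmetric]) auto
    also have "(\<Oplus>\<^bsub>P\<^esub>i\<in>{..<length (R.basis P)}. ract P (fst (R.basis P ! i)) (\<iota> (snd (R.basis P ! i) (ract P p x)))) = ract P p x"
    proof -
      have "(\<Oplus>\<^bsub>P\<^esub>i\<in>{..<length (R.basis P)}. ract P (fst (R.basis P ! i)) (\<iota> (snd (R.basis P ! i) (ract P p x)))) =
        (\<Oplus>\<^bsub>restrict_scalars \<iota> P\<^esub>i\<in>{..<length (R.basis P)}. ract P (fst (R.basis P ! i)) (\<iota> (snd (R.basis P ! i) (ract P p x))))"
        by (rule finsum_cong_structure) simp_all
      then show ?thesis
        using dual_basisD(3)[OF es, of "ract P p x"] right_moduleD(2)[OF PR p] by simp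
    qed
    finally show "zeta \<iota> (R.cl P p' p) (x * y) = ?l (comult R.C (R.cl P p' p))"
      using P p' p by (simp add: zeta_class right_moduleD(5)[OF PR])
  qed
  have unit: "zeta \<iota> X 1 = counit R.C X" if X: "X \<in> carrier R.C" for X
    by (rule R.C_ext[OF abelian_regular additive_at[OF z] bimod_homD(3)[OF coring_dataD(3)[OF R.coring_data_C]] _ X])
      (simp add: zeta_class R.counit_class right_moduleD(6)[OF rep_ObD(1)])
  have "zeta \<iota> (ract R.C (lact R.C a X) b) x = a * zeta \<iota> X (\<iota> b * x)" if X: "X \<in> carrier R.C" for X a b x
    using bimod_homD(2,4)[OF z] X left_moduleD(2)[OF coring_dataD(6)[OF R.coring_data_C]] by simp
  then show ?thesis
    unfolding star_map_def R0_eq using z product unit by simp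
qed

end

section \<open>Galois corings and the finite dual\<close>

lemma coring_isoE:
  assumes "coring_iso C D f"
  obtains k where "coring_hom D C k" "\<And>z. z \<in> carrier C \<Longrightarrow> k (f z) = z" "\<And>w. w \<in> carrier D \<Longrightarrow> f (k w) = w"
proof -
  have "\<exists>k. coring_hom D C k \<and> (\<forall>z\<in>carrier C. k (f z) = z) \<and> (\<forall>w\<in>carrier D. f (k w) = w)"
    using assms unfolding coring_iso_def by (rule conjunct2)
  then show thesis using that by (elim exE conjE) simp
qed

lemma coring_isoI:
  assumes "coring_hom C D f" "coring_hom D C k"
    and "\<And>z. z \<in> carrier C \<Longrightarrow> k (f z) = z" "\<And>w. w \<in> carrier D \<Longrightarrow> f (k w) = w"
  shows "coring_iso C D f"
  unfolding coring_iso_def by (intro conjI exI[of _ k] ballI assms)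

lemma universal_for_unique:
  fixes C :: "('a::{comm_ring,monoid_mult},'c) coring"
  assumes univ: "universal_for TYPE('c) \<eta>A \<iota> D \<xi>" and C: "is_coring \<eta>A C" "star_map \<iota> C f"
    and g: "coring_hom C D g" "\<forall>z\<in>carrier C. \<xi> (g z) = f z"
    and g': "coring_hom C D g'" "\<forall>z\<in>carrier C. \<xi> (g' z) = f z"
    and z: "z \<in> carrier C"
  shows "g z = g' z"
proof -
  have "\<exists>u. coring_hom C D u \<and> (\<forall>z\<in>carrier C. \<xi> (u z) = f z) \<and>
      (\<forall>g'. coring_hom C D g' \<and> (\<forall>z\<in>carrier C. \<xi> (g' z) = f z) \<longrightarrow> (\<forall>z\<in>carrier C. g' z = u z))"
    using univ C unfolding universal_for_def by (elim allE impE) (rule conjI)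
  then obtain u where
    u: "\<forall>g'. coring_hom C D g' \<and> (\<forall>z\<in>carrier C. \<xi> (g' z) = f z) \<longrightarrow> (\<forall>z\<in>carrier C. g' z = u z)"
    by (elim exE conjE) (rule that)
  note eq = u[THEN spec, THEN mp, OF conjI, THEN bspec, OF _ _ z]
  show ?thesis by (rule trans[OF eq[OF g] eq[OF g', symmetric]])
qed

abbreviation comod_class where
  "comod_class D \<equiv> recon_class (comod_Ob D) rmod.truncate (comod_Hom D)"

context ring_over
begin

lemma star_coringI: "coring_data D \<Longrightarrow> star_map \<iota> D f \<Longrightarrow> star_coring D \<iota> f"
  by (intro star_coring.intro coring_loc.intro star_coring_axioms.intro hom)

lemma recon_homI: "coring_data D \<Longrightarrow> coring_hom R0 D g \<Longrightarrow> recon_hom (rep_Ob \<iota>) (restrict_scalars \<iota>) rep_Hom D g"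
  by (intro recon_hom.intro coring_loc.intro recon_hom_axioms.intro R.fgp_category_axioms) (simp_all add: R0_eq)

text \<open>The last property is \<open>p\<^sup>*(p\<^sub>0 f(p\<^sub>1)(r)) = f(p\<^sup>*(p\<^sub>0) p\<^sub>1)(r)\<close>.\<close>

lemma comodules_to_representations:
  assumes D: "coring_data D" and f: "star_map \<iota> D f"
  obtains F where "coring_hom (comod_recon D) R0 F"
    and "\<And>M p' p. M \<in> comod_Ob D \<Longrightarrow> p' \<in> carrier (dual_bimod (rmod.truncate M)) \<Longrightarrow> p \<in> carrier M \<Longrightarrow>
      F (comod_class D M p' p) = R.cl (rep_of D f M) p' p"
    and "\<And>z. z \<in> carrier (comod_recon D) \<Longrightarrow> zeta \<iota> (F z) = f (can_map D z)"
proof -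
  interpret S: star_coring D \<iota> f by (rule star_coringI[OF D f])
  have same: "same_module (rmod.truncate M) (restrict_scalars \<iota> (rep_of D f M))" if "M \<in> comod_Ob D" for M
    using same_module_trans[OF same_module_truncate(2)[of M] S.same_module_rep_of[OF S.comod[OF that]]] .
  obtain F where F: "coring_hom (comod_recon D) R0 F"
    and F_cl: "\<And>M p' p. M \<in> comod_Ob D \<Longrightarrow> p' \<in> carrier (dual_bimod (rmod.truncate M)) \<Longrightarrow> p \<in> carrier M \<Longrightarrow>
      F (comod_class D M p' p) = R.cl (rep_of D f M) p' p"
    using recon_functor[OF S.A.fgp_category_axioms R.fgp_category_axioms, where \<Phi> = "rep_of D f"]
      S.rep_of_Ob same S.rep_of_Hom unfolding S.recon_eq R0_eq by (auto simp: subset_iff)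
  have "zeta \<iota> (F z) = f (can_map D z)" if z: "z \<in> carrier (comod_recon D)" for z
  proof (rule S.A.C_ext[OF two_sided_abelian[OF two_sided_ring_dual[OF hom]] _ _ _ z[unfolded S.recon_eq]])
    show "additive_map S.A.C (ring_dual \<iota>) (\<lambda>z. zeta \<iota> (F z))"
      using additive_map_comp[OF coring_homD(4)[OF F] bimod_homD(3)[OF zeta_hom]] by (simp add: S.recon_eq)
    show "additive_map S.A.C (ring_dual \<iota>) (\<lambda>z. f (can_map D z))"
      using additive_map_comp[OF coring_homD(4)[OF S.coring_hom_can] bimod_homD(3)[OF star_mapD(1)[OF f]]] by (simp add: S.recon_eq)
    fix M p' p assume M: "M \<in> comod_Ob D" and p': "p' \<in> carrier (S.A.dl M)" and "p \<in> carrier (rmod.truncate M)"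
    then have p: "p \<in> carrier M" by simp
    have "p' \<in> carrier (R.dl (rep_of D f M))" using p' same_module_dual[OF same[OF M]] by simp
    then have "zeta \<iota> (F (S.A.cl M p' p)) = (\<lambda>r. p' (act_by D f M r (coact M p)))"
      using M p' p by (simp add: F_cl zeta_class S.rep_of_Ob)
    also have "\<dots> = f (contract M D p' (coact M p))"
      using S.act_dual[OF S.comod_right[OF M] comoduleD(3)[OF S.comod[OF M] p] dual_truncate_rmod_hom[OF p']] by auto
    finally show "zeta \<iota> (F (S.A.cl M p' p)) = f (can_map D (S.A.cl M p' p))"
      using S.can_class[OF M p' p] by simp
  qed
  then show thesis using that[OF F F_cl] by blast
qed

text \<open>The map \<open>can\<close> reads off the coefficients of a coaction, and those along \<open>g\<close> are the values of \<open>g\<close>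
  (\<open>contract_coaction\<close>).\<close>

lemma representations_to_comodules:
  assumes D: "coring_data D" and g: "coring_hom R0 D g"
  obtains G where "coring_hom R0 (comod_recon D) G"
    and "\<And>P p' p. P \<in> rep_Ob \<iota> \<Longrightarrow> p' \<in> carrier (R.dl P) \<Longrightarrow> p \<in> carrier P \<Longrightarrow>
      G (R.cl P p' p) = comod_class D (R.comodule_along D g P) p' p"
    and "\<And>P. P \<in> rep_Ob \<iota> \<Longrightarrow> R.comodule_along D g P \<in> comod_Ob D"
    and "\<And>z. z \<in> carrier R0 \<Longrightarrow> can_map D (G z) = g z"
proof -
  interpret S: recon_hom "rep_Ob \<iota>" "restrict_scalars \<iota>" rep_Hom D g by (rule recon_homI[OF D g])
  let ?along = "R.comodule_along D g"
  have Ob: "?along P \<in> comod_Ob D" if "P \<in> rep_Ob \<iota>" for P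
    using S.comodule_comodule_along[OF that] same_module_fg_projective[OF R.same_module_along rep_ObD(2)[OF that]]
    by (simp add: comod_Ob_def)
  have Hom: "t \<in> comod_Hom D (?along P) (?along Q)" if P: "P \<in> rep_Ob \<iota>" and Q: "Q \<in> rep_Ob \<iota>" and t: "t \<in> rep_Hom P Q" for P Q t
  proof -
    have "rmod_hom (?along P) (?along Q) t"
      using same_module_rmod_hom[OF R.same_module_along[of P D g] R.same_module_along[of Q D g]] R.Hm_hom[OF P Q t] by simp
    then show ?thesis
      using t S.coaction_natural[OF P Q t] by (simp add: comod_Hom_def comodule_hom_def rep_Hom_def R.along_cong)
  qed
  obtain G where G: "coring_hom R0 (comod_recon D) G"
    and G_cl: "\<And>P p' p. P \<in> rep_Ob \<iota> \<Longrightarrow> p' \<in> carrier (R.dl P) \<Longrightarrow> p \<in> carrier P \<Longrightarrow>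
      G (R.cl P p' p) = comod_class D (?along P) p' p"
    using recon_functor[OF R.fgp_category_axioms S.A.fgp_category_axioms, where \<Phi> = ?along]
      Ob Hom unfolding S.recon_eq R0_eq by (auto simp: subset_iff same_module_refl)
  have "can_map D (G z) = g z" if z: "z \<in> carrier R0" for z
  proof (rule R.C_ext[OF coring_dataD(7)[OF D] _ _ _ z[unfolded R0_eq]])
    show "additive_map R.C D (\<lambda>z. can_map D (G z))"
      using additive_map_comp[OF coring_homD(4)[OF G] coring_homD(4)[OF S.coring_hom_can]] by (simp add: R0_eq)
    show "additive_map R.C D g" using coring_homD(4)[OF g] by (simp add: R0_eq)
    fix P p' p assume P: "P \<in> rep_Ob \<iota>" and p': "p' \<in> carrier (R.dl P)" and p: "p \<in> carrier (restrict_scalars \<iota> P)"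
    have "can_map D (G (R.cl P p' p)) = contract (?along P) D p' (R.coaction D g P p)"
      using P p' p S.can_class[OF Ob[OF P], of p' p] by (simp add: G_cl)
    also have "\<dots> = contract (restrict_scalars \<iota> P) D p' (R.coaction D g P p)"
      by (simp add: contract_def R.tensor_along)
    finally show "can_map D (G (R.cl P p' p)) = g (R.cl P p' p)"
      using S.contract_coaction[OF P p' p] by simp
  qed
  then show thesis using that[OF G G_cl Ob] by blast
qed

text \<open>Going from an \<open>R\<close>-module to a comodule and back gives the same action:
  \<open>\<Sum> e\<^sub>i \<xi>(g(e\<^sub>i\<^sup>* \<otimes> p))(r) = \<Sum> e\<^sub>i e\<^sub>i\<^sup>*(p r) = p r\<close>.\<close>

lemma act_along:
  assumes D: "coring_data D" and \<xi>: "star_map \<iota> D \<xi>" and g: "coring_hom R0 D g"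
    and \<xi>g: "\<And>z. z \<in> carrier R0 \<Longrightarrow> \<xi> (g z) = zeta \<iota> z"
    and P: "P \<in> rep_Ob \<iota>" and p: "p \<in> carrier P"
  shows "act_by D \<xi> (R.comodule_along D g P) r (R.coaction D g P p) = ract P p r"
proof -
  interpret S: recon_hom "rep_Ob \<iota>" "restrict_scalars \<iota>" rep_Hom D g by (rule recon_homI[OF D g])
  interpret X: star_coring D \<iota> \<xi> by (rule star_coringI[OF D \<xi>])
  note PR = rep_ObD(1)[OF P] and UR = R.U_module[OF P] and es = R.dual_basis_basis[OF P]
  interpret U: abelian_group "restrict_scalars \<iota> P" by (rule right_moduleD(1)[OF UR])
  have p': "p \<in> carrier (restrict_scalars \<iota> P)" using p by simp
  have cl: "R.cl P (snd (R.basis P ! i)) p \<in> carrier R0" if "i < length (R.basis P)" for i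
    using P p' that by (simp add: R0_eq)
  have "act_by D \<xi> (R.comodule_along D g P) r (R.coaction D g P p) =
      act_by D \<xi> (restrict_scalars \<iota> P) r (R.coaction D g P p)"
    by (simp add: act_by_def R.tensor_along tensor_lift_def additive_map_cong_structure[of _ _ "R.comodule_along D g P" "restrict_scalars \<iota> P"])
  also have "\<dots> = (\<Oplus>\<^bsub>restrict_scalars \<iota> P\<^esub>i\<in>{..<length (R.basis P)}.
      ract (restrict_scalars \<iota> P) (fst (R.basis P ! i)) (snd (R.basis P ! i) (ract P p r)))"
    unfolding S.coaction_pure_map[OF P p' right_moduleD(1)[OF UR] X.additive_act[OF UR]]
    using P p S.e_closed[OF P] S.g_closed[OF P _ p'] right_moduleD(2)[OF PR]
    by (intro U.finsum_cong') (auto simp: X.act_pure[OF UR] \<xi>g[OF cl] zeta_class)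
  also have "\<dots> = ract P p r"
    using dual_basisD(3)[OF es, of "ract P p r"] right_moduleD(2)[OF PR p] by simp
  finally show ?thesis .
qed

lemma identity_rep_Hom:
  assumes "right_module P" "same_module P Q"
  shows "(\<lambda>x\<in>carrier P. x) \<in> rep_Hom P Q"
proof -
  interpret abelian_group P using assms(1) by (rule right_moduleD)
  show ?thesis
    using assms by (auto simp: rep_Hom_def rmod_hom_def same_module_def right_moduleD intro!: additive_mapI)
qed

text \<open>As soon as \<open>can\<close> factors as \<open>g \<circ> F\<close>, where \<open>F\<close> is induced by the passage from \<open>D\<close>-comodules to
  \<open>R\<close>-modules, \<open>F\<close> is invertible, its inverse \<open>G\<close> being induced by the passage back along \<open>g\<close>. So \<open>can\<close> and
  \<open>g\<close> differ by an isomorphism.\<close>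

lemma can_iso_iff:
  fixes D :: "('a,'c) coring"
  assumes D: "coring_data D" and \<xi>: "star_map \<iota> D \<xi>" and g: "coring_hom R0 D g"
    and \<xi>g: "\<And>z. z \<in> carrier R0 \<Longrightarrow> \<xi> (g z) = zeta \<iota> z"
    and can: "\<And>M p' p. M \<in> comod_Ob D \<Longrightarrow> p' \<in> carrier (dual_bimod (rmod.truncate M)) \<Longrightarrow> p \<in> carrier M \<Longrightarrow>
      can_map D (comod_class D M p' p) = g (R.cl (rep_of D \<xi> M) p' p)"
  shows "coring_iso (comod_recon D) D (can_map D) \<longleftrightarrow> coring_iso R0 D g"
proof -
  interpret S: recon_hom "rep_Ob \<iota>" "restrict_scalars \<iota>" rep_Hom D g by (rule recon_homI[OF D g])
  interpret X: star_coring D \<iota> \<xi> by (rule star_coringI[OF D \<xi>])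
  let ?along = "R.comodule_along D g"
  obtain F where F: "coring_hom (comod_recon D) R0 F"
    and F_cl: "\<And>M p' p. M \<in> comod_Ob D \<Longrightarrow> p' \<in> carrier (dual_bimod (rmod.truncate M)) \<Longrightarrow> p \<in> carrier M \<Longrightarrow>
      F (comod_class D M p' p) = R.cl (rep_of D \<xi> M) p' p"
    using comodules_to_representations[OF D \<xi>] by metis
  obtain G where G: "coring_hom R0 (comod_recon D) G"
    and G_cl: "\<And>P p' p. P \<in> rep_Ob \<iota> \<Longrightarrow> p' \<in> carrier (R.dl P) \<Longrightarrow> p \<in> carrier P \<Longrightarrow> G (R.cl P p' p) = comod_class D (?along P) p' p"
    and along_Ob: "\<And>P. P \<in> rep_Ob \<iota> \<Longrightarrow> ?along P \<in> comod_Ob D"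
    and can_G: "\<And>z. z \<in> carrier R0 \<Longrightarrow> can_map D (G z) = g z"
    using representations_to_comodules[OF D g] by metis
  have data_recon: "coring_data (comod_recon D)"
    unfolding S.recon_eq by (rule S.A.coring_data_C)
  have FG: "F (G z) = z" if z: "z \<in> carrier R0" for z
  proof (rule R.C_ext[OF two_sided_abelian[OF R.two_sided_C] _ _ _ z[unfolded R0_eq]])
    show "additive_map R.C R.C (\<lambda>z. F (G z))"
      using additive_map_comp[OF coring_homD(4)[OF G] coring_homD(4)[OF F]] by (simp add: R0_eq)
    show "additive_map R.C R.C (\<lambda>z. z)" by (rule rmod_homD(1)[OF rmod_hom_id])
    fix P p' p assume P: "P \<in> rep_Ob \<iota>" and p': "p' \<in> carrier (R.dl P)" and "p \<in> carrier (restrict_scalars \<iota> P)"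
    then have p: "p \<in> carrier P" by simp
    have rep: "rep_of D \<xi> (?along P) \<in> rep_Ob \<iota>" by (rule X.rep_of_Ob[OF along_Ob[OF P]])
    have same: "same_module P (rep_of D \<xi> (?along P))"
      using act_along[OF D \<xi> g \<xi>g P] by (simp add: same_module_def)
    have "F (G (R.cl P p' p)) = R.cl (rep_of D \<xi> (?along P)) p' p"
      using P p' p by (simp add: G_cl F_cl along_Ob)
    also have "\<dots> = R.cl P p' p"
      using P rep p' p same identity_rep_Hom[OF rep_ObD(1)[OF P] same]
      by (intro R.class_same_module) (auto simp: same_module_def)
    finally show "F (G (R.cl P p' p)) = R.cl P p' p" .
  qed
  have GF: "G (F z) = z" if z: "z \<in> carrier (comod_recon D)" for z
  proof (rule S.A.C_ext[OF two_sided_abelian[OF S.A.two_sided_C] _ _ _ z[unfolded S.recon_eq]])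
    show "additive_map S.A.C S.A.C (\<lambda>z. G (F z))"
      using additive_map_comp[OF coring_homD(4)[OF F] coring_homD(4)[OF G]] by (simp add: S.recon_eq)
    show "additive_map S.A.C S.A.C (\<lambda>z. z)" by (rule rmod_homD(1)[OF rmod_hom_id])
    fix M p' p assume M: "M \<in> comod_Ob D" and p': "p' \<in> carrier (S.A.dl M)" and "p \<in> carrier (rmod.truncate M)"
    then have p: "p \<in> carrier M" by simp
    define N where "N = rep_of D \<xi> M"
    have N: "N \<in> rep_Ob \<iota>" unfolding N_def by (rule X.rep_of_Ob[OF M])
    note MR = S.comod_right[OF M] and UN = R.U_module[OF N]
    have same: "same_module M (restrict_scalars \<iota> N)" unfolding N_def by (rule X.same_module_rep_of[OF S.comod[OF M]])
    have sameT: "same_module (rmod.truncate M) (restrict_scalars \<iota> N)"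
      by (rule same_module_trans[OF same_module_truncate(2) same])
    have carrier_N: "carrier N = carrier M" by (simp add: N_def)
    have dl: "R.dl N = S.A.dl M" by (rule same_module_dual[OF sameT])
    have es: "dual_basis (rmod.truncate M) (R.basis N)"
      by (rule same_module_dual_basis[OF UN same_module_sym[OF sameT] R.dual_basis_basis[OF N]])
    interpret MD: tensor_right UNIV M D by (rule tensor_right_UNIV[OF MR S.D2])
    interpret ND: tensor_right UNIV "restrict_scalars \<iota> N" D by (rule S.PD[OF N])
    have t: "rmod_hom M (restrict_scalars \<iota> N) (\<lambda>x. x)"
      using same_module_rmod_hom[OF same_module_refl[of M] same] rmod_hom_id by blast
    note tm = additive_tensor_map[OF MD.tensor_pair_axioms ND.tensor_pair_axioms t left_linear_id]
      tensor_map_pure[OF MD.tensor_pair_axioms ND.tensor_pair_axioms t left_linear_id]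
    \<comment> \<open>The coefficients of the two coactions agree by the factorization of \<open>can\<close>.\<close>
    have coact: "tensor_map M D (restrict_scalars \<iota> N) D (\<lambda>x. x) (\<lambda>c. c) (coact M x) = R.coaction D g N x" if x: "x \<in> carrier M" for x
    proof -
      note X = comoduleD(3)[OF S.comod[OF M] x]
      have e: "i < length (R.basis N) \<Longrightarrow> fst (R.basis N ! i) \<in> carrier M"
        "i < length (R.basis N) \<Longrightarrow> snd (R.basis N ! i) \<in> carrier (S.A.dl M)" for i
        using dual_basisD(1,2)[OF es] by simp_all
      have coeff: "contract M D (snd (R.basis N ! i)) (coact M x) = g (R.cl N (snd (R.basis N ! i)) x)"
        if "i < length (R.basis N)" for i
        using can[OF M e(2)[OF that] x] S.can_class[OF M e(2)[OF that] x] by (simp add: N_def)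
      have coeff_closed: "contract M D (snd (R.basis N ! i)) (coact M x) \<in> carrier D" if "i < length (R.basis N)" for i
        using additive_map_closed[OF additive_contract[OF MR S.DL dual_truncate_rmod_hom[OF e(2)[OF that]]] X] .
      have "tensor_map M D (restrict_scalars \<iota> N) D (\<lambda>x. x) (\<lambda>c. c) (coact M x) =
        tensor_map M D (restrict_scalars \<iota> N) D (\<lambda>x. x) (\<lambda>c. c) (\<Oplus>\<^bsub>MD.T\<^esub>i\<in>{..<length (R.basis N)}.
          MD.pt (fst (R.basis N ! i)) (contract M D (snd (R.basis N ! i)) (coact M x)))"
        using tensor_expand[OF MR S.DL es X] by simp
      also have "\<dots> = (\<Oplus>\<^bsub>ND.T\<^esub>i\<in>{..<length (R.basis N)}. tensor_map M D (restrict_scalars \<iota> N) D (\<lambda>x. x) (\<lambda>c. c)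
          (MD.pt (fst (R.basis N ! i)) (contract M D (snd (R.basis N ! i)) (coact M x))))"
        using e coeff_closed by (intro additive_map_finsum[OF MD.abelian_tensor ND.abelian_tensor tm(1)]) auto
      also have "\<dots> = R.coaction D g N x"
        unfolding R.coaction_def using e coeff_closed
        by (intro ND.T.finsum_cong') (auto simp: tm(2) coeff[symmetric] carrier_N intro!: ND.pure_closed)
      finally show ?thesis .
    qed
    have "(\<lambda>x\<in>carrier M. x) \<in> comod_Hom D M (?along N)"
    proof -
      have idh: "rmod_hom M (?along N) (\<lambda>x\<in>carrier M. x)"
        using same MD.M.a_closed right_moduleD(2)[OF MR]
        by (auto simp: rmod_hom_def same_module_def intro!: additive_mapI)
      have "tensor_map M D (?along N) D (\<lambda>x\<in>carrier M. x) (\<lambda>c. c) X = tensor_map M D (restrict_scalars \<iota> N) D (\<lambda>x. x) (\<lambda>c. c) X"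
        if X: "X \<in> carrier MD.T" for X
      proof -
        have AN: "tensor_pair UNIV (?along N) D"
          by (rule tensor_pair_UNIV[OF S.comod_right[OF along_Ob[OF N]] S.DL])
        note ta = additive_tensor_map[OF MD.tensor_pair_axioms AN idh left_linear_id]
          tensor_map_pure[OF MD.tensor_pair_axioms AN idh left_linear_id]
        show ?thesis
          by (rule MD.tensor_ext[OF ta(1)[unfolded R.tensor_along] tm(1) _ X]) (simp add: ta(2) tm(2) R.tensor_along)
      qed
      then show ?thesis
        using idh comoduleD(3)[OF S.comod[OF M]] coact by (simp add: comod_Hom_def comodule_hom_def)
    qed
    then have "S.A.cl (?along N) p' p = S.A.cl M p' p"
      using M along_Ob[OF N] p' p sameT by (intro S.A.class_same_module) simp_all
    then show "G (F (S.A.cl M p' p)) = S.A.cl M p' p"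
      using M N p' p by (simp add: F_cl G_cl dl carrier_N flip: N_def)
  qed
  have can_F: "can_map D z = g (F z)" if "z \<in> carrier (comod_recon D)" for z
    using can_G[OF coring_homD(5)[OF F that]] GF[OF that] by simp
  show ?thesis
  proof
    assume iso: "coring_iso (comod_recon D) D (can_map D)"
    obtain k where k: "coring_hom D (comod_recon D) k"
      and k_can: "\<And>z. z \<in> carrier (comod_recon D) \<Longrightarrow> k (can_map D z) = z"
      and can_k: "\<And>w. w \<in> carrier D \<Longrightarrow> can_map D (k w) = w"
      using coring_isoE[OF iso] by metis
    have "coring_hom D R0 (\<lambda>w. F (k w))" by (rule coring_hom_comp[OF D data_recon data_R0 k F])
    moreover have "F (k (g z)) = z" if "z \<in> carrier R0" for z
      using FG[OF that] k_can[OF coring_homD(5)[OF G that]] can_G[OF that] by simp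
    moreover have "g (F (k w)) = w" if "w \<in> carrier D" for w
      using can_F[OF coring_homD(5)[OF k that]] can_k[OF that] by simp
    ultimately show "coring_iso R0 D g" by (rule coring_isoI[OF g])
  next
    assume iso: "coring_iso R0 D g"
    obtain k where k: "coring_hom D R0 k"
      and k_g: "\<And>z. z \<in> carrier R0 \<Longrightarrow> k (g z) = z"
      and g_k: "\<And>w. w \<in> carrier D \<Longrightarrow> g (k w) = w"
      using coring_isoE[OF iso] by metis
    have "coring_hom D (comod_recon D) (\<lambda>w. G (k w))" by (rule coring_hom_comp[OF D data_R0 data_recon k G])
    moreover have "G (k (can_map D z)) = z" if "z \<in> carrier (comod_recon D)" for z
      using can_F[OF that] k_g[OF coring_homD(5)[OF F that]] GF[OF that] by simp
    moreover have "can_map D (G (k w)) = w" if "w \<in> carrier D" for w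
      using can_G[OF coring_homD(5)[OF k that]] g_k[OF that] by simp
    ultimately show "coring_iso (comod_recon D) D (can_map D)"
      by (rule coring_isoI[OF S.coring_hom_can])
  qed
qed

text \<open>From \<open>\<zeta> \<circ> F = \<zeta> \<circ> can\<close> injectivity gives \<open>can = F\<close>, so \<open>can_iso_iff\<close> applies with \<open>g = id\<close>.\<close>

lemma galois_fin_dual:
  assumes inj: "inj_on (zeta \<iota>) (carrier R0)"
  shows "galois_coring \<eta>A R0"
proof -
  interpret X: star_coring R0 \<iota> "zeta \<iota>" by (rule star_coringI[OF data_R0 star_zeta])
  obtain F where F: "coring_hom (comod_recon R0) R0 F"
    and F_cl: "\<And>M p' p. M \<in> comod_Ob R0 \<Longrightarrow> p' \<in> carrier (dual_bimod (rmod.truncate M)) \<Longrightarrow> p \<in> carrier M \<Longrightarrow>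
      F (comod_class R0 M p' p) = R.cl (rep_of R0 (zeta \<iota>) M) p' p"
    and zeta_F: "\<And>z. z \<in> carrier (comod_recon R0) \<Longrightarrow> zeta \<iota> (F z) = zeta \<iota> (can_map R0 z)"
    using comodules_to_representations[OF data_R0 star_zeta] by metis
  have "can_map R0 z = F z" if "z \<in> carrier (comod_recon R0)" for z
    using inj_onD[OF inj zeta_F[OF that]] coring_homD(5)[OF F that] coring_homD(5)[OF X.coring_hom_can that] by simp
  then have "can_map R0 (comod_class R0 M p' p) = R.cl (rep_of R0 (zeta \<iota>) M) p' p"
    if "M \<in> comod_Ob R0" "p' \<in> carrier (dual_bimod (rmod.truncate M))" "p \<in> carrier M" for M p' p
    using that F_cl X.A.class_C[of M p' p] by (simp add: X.recon_eq)
  note can = this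
  have "coring_iso R0 R0 (\<lambda>x. x)"
    by (rule coring_isoI[OF coring_hom_id[OF data_R0] coring_hom_id[OF data_R0] refl refl])
  moreover have "coring_iso (comod_recon R0) R0 (can_map R0) \<longleftrightarrow> coring_iso R0 R0 (\<lambda>x. x)"
    by (rule can_iso_iff[OF data_R0 star_zeta coring_hom_id[OF data_R0] refl]) (fact can)
  ultimately have "coring_iso (comod_recon R0) R0 (can_map R0)" by simp
  then show ?thesis
    unfolding galois_coring_def by (rule conjI[OF coring_R0])
qed

text \<open>Take \<open>f' = F \<circ> can\<^sup>-\<^sup>1\<close>; it is injective because \<open>\<zeta> \<circ> f' = f\<close> is.\<close>

lemma galois_embeds:
  assumes C: "galois_coring \<eta>A C" and f: "star_map \<iota> C f" and inj: "inj_on f (carrier C)"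
  shows "\<exists>f'. coring_hom C R0 f' \<and> inj_on f' (carrier C) \<and> (\<forall>z\<in>carrier C. zeta \<iota> (f' z) = f z)"
proof -
  have data: "coring_data C" using C is_coring_data by (auto simp: galois_coring_def)
  interpret X: coring_loc C by (rule coring_loc.intro[OF data])
  obtain F where F: "coring_hom (comod_recon C) R0 F"
    and zeta_F: "\<And>z. z \<in> carrier (comod_recon C) \<Longrightarrow> zeta \<iota> (F z) = f (can_map C z)"
    using comodules_to_representations[OF data f] by metis
  obtain k where k: "coring_hom C (comod_recon C) k" and can_k: "\<And>w. w \<in> carrier C \<Longrightarrow> can_map C (k w) = w"
    using coring_isoE[OF C[unfolded galois_coring_def, THEN conjunct2]] by metis
  have "coring_hom C R0 (\<lambda>w. F (k w))"
    by (rule coring_hom_comp[OF data _ data_R0 k F]) (simp add: X.recon_eq X.A.coring_data_C)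
  moreover have z: "zeta \<iota> (F (k w)) = f w" if "w \<in> carrier C" for w
    using zeta_F[OF coring_homD(5)[OF k that]] can_k[OF that] by simp
  moreover have "inj_on (\<lambda>w. F (k w)) (carrier C)"
  proof (rule inj_onI)
    fix v w assume vw: "v \<in> carrier C" "w \<in> carrier C" "F (k v) = F (k w)"
    then have "f v = f w" using z[OF vw(1)] z[OF vw(2)] by simp
    then show "v = w" by (rule inj_onD[OF inj _ vw(1,2)])
  qed
  ultimately show ?thesis by (intro exI[of _ "\<lambda>w. F (k w)"]) simp
qed

text \<open>Uniqueness cannot be applied to \<open>\<R>(\<A>\<^sup>D)\<close> itself, whose elements lie in a type different from those of \<open>D\<close>
  and \<open>R\<degree>\<close>. It suffices to treat one comodule \<open>M\<close> at a time, and the comatrix coring of \<open>M\<close> can be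
  built with the \<open>R\<close>-module \<open>N\<close> associated to \<open>M\<close> as its only object and the comodule endomorphisms of \<open>M\<close> as
  its morphisms. Its elements then have the type of those of \<open>R\<degree>\<close>, and it maps to \<open>D\<close> in two ways: through
  \<open>R\<degree>\<close> and through \<open>\<R>(\<A>\<^sup>D)\<close>.\<close>

lemma universal_can:
  fixes D :: "('a,'d) coring"
  assumes D: "is_coring \<eta>A D" and \<xi>: "star_map \<iota> D \<xi>"
    and univ: "universal_for TYPE(('a,'r) fin_dual_elem) \<eta>A \<iota> D \<xi>"
    and g: "coring_hom R0 D g" and \<xi>g: "\<And>z. z \<in> carrier R0 \<Longrightarrow> \<xi> (g z) = zeta \<iota> z"
    and M: "M \<in> comod_Ob D" and p': "p' \<in> carrier (dual_bimod (rmod.truncate M))" and p: "p \<in> carrier M"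
  shows "can_map D (comod_class D M p' p) = g (R.cl (rep_of D \<xi> M) p' p)"
proof -
  have data: "coring_data D" by (rule is_coring_data[OF D])
  interpret X: star_coring D \<iota> \<xi> by (rule star_coringI[OF data \<xi>])
  obtain F where F: "coring_hom (comod_recon D) R0 F"
    and F_cl: "\<And>M p' p. M \<in> comod_Ob D \<Longrightarrow> p' \<in> carrier (dual_bimod (rmod.truncate M)) \<Longrightarrow> p \<in> carrier M \<Longrightarrow>
      F (comod_class D M p' p) = R.cl (rep_of D \<xi> M) p' p"
    and zeta_F: "\<And>z. z \<in> carrier (comod_recon D) \<Longrightarrow> zeta \<iota> (F z) = \<xi> (can_map D z)"
    using comodules_to_representations[OF data \<xi>] by metis
  define N where "N = rep_of D \<xi> M"
  have N: "N \<in> rep_Ob \<iota>" unfolding N_def by (rule X.rep_of_Ob[OF M])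
  note MR = X.comod_right[OF M]
  have same: "same_module M (restrict_scalars \<iota> N)" unfolding N_def by (rule X.same_module_rep_of[OF X.comod[OF M]])
  have sameT: "same_module (restrict_scalars \<iota> N) (rmod.truncate M)"
    by (rule same_module_sym[OF same_module_trans[OF same_module_truncate(2) same]])
  have dl: "dual_bimod (restrict_scalars \<iota> N) = dual_bimod (rmod.truncate M)"
    by (rule same_module_dual[OF sameT, symmetric])
  define T :: "('r, nat \<Rightarrow> 'a) rmod \<Rightarrow> ('r, nat \<Rightarrow> 'a) rmod \<Rightarrow> ((nat \<Rightarrow> 'a) \<Rightarrow> (nat \<Rightarrow> 'a)) set"
    where "T = (\<lambda>_ _. comod_Hom D M M)"
  interpret E: fgp_category "{N}" "restrict_scalars \<iota>" T
  proof
    show "fg_projective (restrict_scalars \<iota> P)" if "P \<in> {N}" for P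
      using that rep_ObD(2)[OF N] by simp
    show "rmod_hom (restrict_scalars \<iota> P) (restrict_scalars \<iota> Q) t" if "P \<in> {N}" "Q \<in> {N}" "t \<in> T P Q" for P Q t
      using that comod_HomD(2)[of t D M M] same_module_rmod_hom[OF same same] by (auto simp: T_def)
  qed
  have coring_E: "is_coring \<eta>A E.C"
  proof (rule E.is_coring_recon)
    fix P c assume "P \<in> {N}"
    then have P: "P = N" by simp
    let ?t = "\<lambda>m\<in>carrier M. ract M m (\<eta>A c)"
    interpret MD: tensor_right UNIV M D by (rule tensor_right_UNIV[OF MR X.D2])
    have "ract M (ract M m a) (\<eta>A c) = ract M (ract M m (\<eta>A c)) a" if "m \<in> carrier M" for m a
      using right_moduleD(5)[OF MR that, of a "\<eta>A c"] right_moduleD(5)[OF MR that, of "\<eta>A c" a] by (simp add: mult.commute)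
    then have t: "rmod_hom M M ?t"
      using MD.M.a_closed by (auto simp: rmod_hom_def right_moduleD(2,3)[OF MR] intro!: additive_mapI)
    have k: "lact D (\<eta>A c) z = ract D z (\<eta>A c)" if "z \<in> carrier D" for z
      using D that by (simp add: is_coring_def bimodule_iff)
    have "tensor_map M D M D ?t (\<lambda>c. c) X = ract (tensor_r UNIV M D) X (\<eta>A c)" if X: "X \<in> carrier MD.T" for X
      by (rule MD.tensor_ext[OF additive_tensor_map[OF MD.tensor_pair_axioms MD.tensor_pair_axioms t left_linear_id] MD.additive_ract_tensor _ X])
        (simp add: tensor_map_pure[OF MD.tensor_pair_axioms MD.tensor_pair_axioms t left_linear_id] MD.pure_balanced k)
    then have "?t \<in> comod_Hom D M M"
      using t comoduleD(3,5)[OF X.comod[OF M]] by (simp add: comod_Hom_def comodule_hom_def)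
    moreover have "\<forall>p\<in>carrier (restrict_scalars \<iota> P). ?t p = ract (restrict_scalars \<iota> P) p (\<eta>A c)"
      using same unfolding P same_module_def by simp
    ultimately show "\<exists>t\<in>T P P. \<forall>p\<in>carrier (restrict_scalars \<iota> P). t p = ract (restrict_scalars \<iota> P) p (\<eta>A c)"
      unfolding T_def by blast
  qed
  have data_E: "coring_data E.C" by (rule is_coring_data[OF coring_E])
  obtain h1 where h1: "coring_hom E.C R0 h1"
    and h1_cl: "\<And>q' q. q' \<in> carrier (E.dl N) \<Longrightarrow> q \<in> carrier N \<Longrightarrow> h1 (E.cl N q' q) = R.cl N q' q"
    using recon_functor[OF E.fgp_category_axioms R.fgp_category_axioms, where \<Phi> = "\<lambda>P. P"] N
      X.rep_of_Hom[OF M M] unfolding R0_eq by (auto simp: subset_iff T_def N_def same_module_refl)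
  obtain h2 where h2: "coring_hom E.C (comod_recon D) h2"
    and h2_cl: "\<And>q' q. q' \<in> carrier (E.dl N) \<Longrightarrow> q \<in> carrier N \<Longrightarrow> h2 (E.cl N q' q) = comod_class D M q' q"
    using recon_functor[OF E.fgp_category_axioms X.A.fgp_category_axioms, where \<Phi> = "\<lambda>P. M"] M sameT
    unfolding X.recon_eq by (auto simp: T_def)
  have data_recon: "coring_data (comod_recon D)"
    unfolding X.recon_eq by (rule X.A.coring_data_C)
  define k1 where "k1 = (\<lambda>z. g (h1 z))"
  define k2 where "k2 = (\<lambda>z. can_map D (h2 z))"
  have k1: "coring_hom E.C D k1" unfolding k1_def by (rule coring_hom_comp[OF data_E data_R0 data h1 g])
  have k2: "coring_hom E.C D k2" unfolding k2_def by (rule coring_hom_comp[OF data_E data_recon data h2 X.coring_hom_can])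
  have \<xi>k: "\<xi> (k1 z) = \<xi> (k2 z)" if z: "z \<in> carrier E.C" for z
  proof (rule E.C_ext[OF two_sided_abelian[OF two_sided_ring_dual[OF hom]] _ _ _ z])
    show "additive_map E.C (ring_dual \<iota>) (\<lambda>z. \<xi> (k1 z))" "additive_map E.C (ring_dual \<iota>) (\<lambda>z. \<xi> (k2 z))"
      by (rule additive_map_comp[OF coring_homD(4) bimod_homD(3)[OF star_mapD(1)[OF \<xi>]]], rule k1 k2)+
    fix P q' q assume "P \<in> {N}" and q': "q' \<in> carrier (E.dl P)" and q: "q \<in> carrier (restrict_scalars \<iota> P)"
    then have P: "P = N" by simp
    have q1: "q' \<in> carrier (E.dl N)" "q \<in> carrier N" "q' \<in> carrier (dual_bimod (rmod.truncate M))" "q \<in> carrier M"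
      using q' q same by (auto simp: P dl same_module_def)
    have z2: "comod_class D M q' q \<in> carrier (comod_recon D)"
      using X.A.class_C[OF M q1(3)] q1(4) by (simp add: X.recon_eq)
    have z1: "R.cl N q' q \<in> carrier R0"
      using R.class_C[OF N] q1 by (simp add: R0_eq)
    have "\<xi> (k1 (E.cl N q' q)) = zeta \<iota> (R.cl N q' q)"
      using q1 z1 by (simp add: k1_def h1_cl \<xi>g)
    also have "\<dots> = zeta \<iota> (F (comod_class D M q' q))"
      using q1 M by (simp add: F_cl N_def)
    also have "\<dots> = \<xi> (k2 (E.cl N q' q))"
      using q1 by (simp add: k2_def h2_cl zeta_F[OF z2])
    finally show "\<xi> (k1 (E.cl P q' q)) = \<xi> (k2 (E.cl P q' q))" by (simp add: P)
  qed
  have "star_map \<iota> E.C (\<lambda>z. \<xi> (k2 z))"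
    by (rule star_map_comp[OF hom data_E data k2 \<xi>])
  note star = this
  have "k1 z = k2 z" if "z \<in> carrier E.C" for z
    by (rule universal_for_unique[OF univ coring_E star k1 _ k2 _ that]) (simp_all add: \<xi>k)
  moreover have q: "p' \<in> carrier (E.dl N)" "p \<in> carrier N"
    using p' p same by (auto simp: dl same_module_def)
  ultimately have "k1 (E.cl N p' p) = k2 (E.cl N p' p)"
    using E.class_C[of N p' p] by simp
  then show ?thesis
    unfolding k1_def k2_def h1_cl[OF q] h2_cl[OF q] unfolding N_def by (rule sym)
qed

lemma galois_universal_iff:
  assumes "is_universal_coring \<eta>A \<iota> D \<xi>"
  shows "galois_coring \<eta>A D \<longleftrightarrow> coring_iso R0 D (zeta_hat \<iota> D \<xi>)"
proof -
  have D: "is_coring \<eta>A D" and \<xi>: "star_map \<iota> D \<xi>" and univ: "universal_for TYPE(('a,'r) fin_dual_elem) \<eta>A \<iota> D \<xi>"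
    using assms by (simp_all add: is_universal_coring_def)
  have "\<exists>g. coring_hom R0 D g \<and> (\<forall>z\<in>carrier R0. \<xi> (g z) = zeta \<iota> z)"
    using univ[unfolded universal_for_def, THEN spec, THEN spec, THEN mp, OF conjI[OF coring_R0 star_zeta]]
    by (elim exE conjE) (rule exI, rule conjI)
  from someI_ex[OF this, folded zeta_hat_def] have hat: "coring_hom R0 D (zeta_hat \<iota> D \<xi>)"
    "\<And>z. z \<in> carrier R0 \<Longrightarrow> \<xi> (zeta_hat \<iota> D \<xi> z) = zeta \<iota> z"
    by (rule conjunct1, elim conjE bspec)
  have iff: "coring_iso (comod_recon D) D (can_map D) \<longleftrightarrow> coring_iso R0 D (zeta_hat \<iota> D \<xi>)"
    by (rule can_iso_iff[OF is_coring_data[OF D] \<xi> hat(1)], erule hat(2))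
      (rule universal_can[OF D \<xi> univ hat(1)], erule hat(2))
  show ?thesis
    unfolding galois_coring_def iff by (rule iffI, erule conjunct2, rule conjI, rule D)
qed

end

theorem corollary4p10:
  fixes \<eta>A :: "'k::field \<Rightarrow> 'a::{comm_ring,monoid_mult}"
    and \<eta>R :: "'k \<Rightarrow> 'r::{ring,monoid_mult}"
    and \<iota> :: "'a \<Rightarrow> 'r"
  assumes "A_ring \<eta>A \<eta>R \<iota>"
  shows
    "(inj_on (zeta \<iota>) (carrier (fin_dual \<iota>)) \<longrightarrow>
        galois_coring \<eta>A (fin_dual \<iota>) \<and> star_map \<iota> (fin_dual \<iota>) (zeta \<iota>) \<and>
        (\<forall>(C :: ('a,'c) coring) f.
           galois_coring \<eta>A C \<and> star_map \<iota> C f \<and> inj_on f (carrier C) \<longrightarrow>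
           (\<exists>f'. coring_hom C (fin_dual \<iota>) f' \<and> inj_on f' (carrier C) \<and>
              (\<forall>z\<in>carrier C. zeta \<iota> (f' z) = f z)))) \<and>
     (\<forall>(D :: ('a,'d) coring) \<xi>. is_universal_coring \<eta>A \<iota> D \<xi> \<longrightarrow>
        (galois_coring \<eta>A D \<longleftrightarrow> coring_iso (fin_dual \<iota>) D (zeta_hat \<iota> D \<xi>)))"
proof -
  interpret ring_over \<eta>A \<eta>R \<iota> by (rule ring_over.intro) fact
  show ?thesis
    by (intro conjI impI allI;
        (rule galois_fin_dual star_zeta galois_universal_iff | elim conjE, rule galois_embeds); assumption?)
qed

end
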